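(* Let $\mathcal{I}\subset\mathcal{O}\subset\mathrm{ST}$ be the sub-species of $\mathrm{MG}^{\bullet}_{orc}$ defined, for every finite nonempty set $V$, as the linear spans $$\mathrm{ST}[V]=\mathbb{K}\{(g,\mathtt{o}_{(t,r)},r): g \text{ a connected multigraph on } V,\ r\in V,\ t \text{ a spanning tree of } g\},$$ $$\mathcal{O}[V]=\mathbb{K}\Big\{\sum_{r\in V}(g,\mathtt{o}_{(t(r),r)},r): g\text{ a connected multigraph on }V\text{ and, for each } r\in V,\ t(r)\text{ a spanning tree of }g\Big\},$$ $$\mathcal{I}[V]=\mathbb{K}\{(g,\mathtt{o}_{(t_1,r)},r)-(g,\mathtt{o}_{(t_2,r)},r): g\text{ a connected multigraph on }V,\ r\in V,\ t_1,t_2\text{ spanning trees of }g\}.$$ Then: (i) $\mathrm{ST}$ is a sub-operad of $\mathrm{MG}^{\bullet}_{orc}$, isomorphic to the Hadamard product operad $\mathrm{MG}\times\mathrm{PLie}$; (ii) $\mathcal{O}$ is a sub-operad of $\mathrm{ST}$; (iii) $\mathcal{I}$ is an ideal of $\mathcal{O}$.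
   Context: $\mathbb{K}$ is a field of characteristic $0$. A (linear) species is a functor from finite sets with bijections to $\mathbb{K}$-vector spaces. An operad is a species $O$ with $O[\emptyset]=\{0\}$, units $e(v)\in O[\{v\}]$, and natural bilinear partial compositions $\circ_*:O[V_1\sqcup\{*\}]\times O[V_2]\to O[V_1\sqcup V_2]$ satisfying the usual parallel and sequential associativity axioms and unit axioms of symmetric operads. A sub-operad is a sub-species containing the units and stable under partial composition. An ideal of $O$ is a sub-species $\mathcal{I}$ with $x\circ_* y\in\mathcal{I}$ whenever $x\in\mathcal{I}$, $y\in O$ or $x\in O$, $y\in\mathcal{I}$. The Hadamard product $O_1\times O_2$ has $(O_1\times O_2)[V]=O_1[V]\otimes O_2[V]$ and $(x_1\otimes x_2)\circ_*(y_1\otimes y_2)=(x_1\circ_*y_1)\otimes(x_2\circ_*y_2)$. A multigraph on $V$ is a finite multiset of unordered pairs of (possibly equal) elements of $V$ (edges; each edge has two ends). An oriented multigraph is a multigraph in which each end of each edge is labelled "source" or "target" (both ends of an edge may have the same label). Operad $\mathrm{MG}$: $\mathrm{MG}[V]$ ($V$ nonempty) has basis the multigraphs on $V$; $g_1\circ_*g_2$ is the sum, over all ways of reconnecting independently each edge end attached to $*$ in $g_1$ to a vertex of $V_2$, of the resulting multigraph on $V_1\sqcup V_2$ (edges of $g_1$ after reconnection together with the edges of $g_2$). Units: edgeless one-vertex graphs. Operad $\mathrm{MG}^{\bullet}_{or}$: $\mathrm{MG}^{\bullet}_{or}[V]$ has basis the pairs (also written as triples $(g,\mathtt{o},v)$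 with $\mathtt{o}$ the orientation) of an oriented multigraph on $V$ and a vertex $v\in V$. The composition $(g_1,v_1)\circ_*(g_2,v_2)$ is the sum over all elements obtained by taking the disjoint union, removing $*$, connecting each loose source end to $v_2$, and connecting each loose target end independently to any vertex of $V_2$ (sum over all choices; ends keep their labels); the new root is $v_1$ if $v_1\ne *$ and $v_2$ otherwise. $\mathrm{MG}^{\bullet}_{orc}$ is the sub-operad spanned by the elements whose underlying multigraph is connected. Operad $\mathrm{PLie}$: $\mathrm{PLie}[V]$ has basis the rooted trees $(t,r)$ on $V$; $t_1\circ_*t_2$ is the sum over all rooted trees obtained by taking the disjoint union, removing $*$, adding an edge between the parent of $*$ (if any) and the root of $t_2$ and, for each child of $*$, an edge between this child and any vertex of $t_2$; the root is that of $t_1$ if it is not $*$, and that of $t_2$ otherwise. For a connected multigraph $g$ on $V$, a spanning tree $t$ of $g$ (a sub-multiset of edges forming a tree on $V$) and $r\in V$, $\mathtt{o}_{(t,r)}$ is the orientation of $g$ in which, for each edge of $t$, the end nearer to $r$ in $t$ (parent end) is a target and the other (child) end is a source, and in which both ends of every edge not in $t$ are targets. *)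

theory Defs
  imports Complex_Main "HOL-Library.Poly_Mapping" "HOL-Library.Multiset" "HOL-Library.FuncSet"
begin

section \<open>Finitely supported formal linear combinations\<close>

text \<open>
  \<open>'b \<Rightarrow>\<^sub>0 'k\<close> is the vector space with basis \<open>'b\<close>. Every vector space has a basis, so nothing is
  lost by taking the spaces of a species to be subspaces of such a space.
\<close>

definition scale :: "'k::field \<Rightarrow> ('b \<Rightarrow>\<^sub>0 'k) \<Rightarrow> ('b \<Rightarrow>\<^sub>0 'k)" where
  "scale c x = Poly_Mapping.map ((*) c) x"

lemma lookup_scale [simp]: "Poly_Mapping.lookup (scale c x) b = c * Poly_Mapping.lookup x b"
  by (simp add: scale_def Poly_Mapping.map.rep_eq when_def)

global_interpretation fs: vector_space "scale :: 'k::field \<Rightarrow> ('b \<Rightarrow>\<^sub>0 'k) \<Rightarrow> _"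
  by unfold_locales (auto intro!: poly_mapping_eqI simp: lookup_add algebra_simps)

abbreviation basis :: "'b \<Rightarrow> ('b \<Rightarrow>\<^sub>0 'k::field)" where
  "basis b \<equiv> Poly_Mapping.single b 1"

definition formal_sum :: "'b multiset \<Rightarrow> ('b \<Rightarrow>\<^sub>0 'k::field)" where
  "formal_sum M = (\<Sum>b\<in>#M. basis b)"

definition lin_ext :: "('b \<Rightarrow> ('c \<Rightarrow>\<^sub>0 'k::field)) \<Rightarrow> ('b \<Rightarrow>\<^sub>0 'k) \<Rightarrow> ('c \<Rightarrow>\<^sub>0 'k)" where
  "lin_ext F x = (\<Sum>b\<in>Poly_Mapping.keys x. scale (Poly_Mapping.lookup x b) (F b))"

definition bilin_ext ::
  "('a \<Rightarrow> 'b \<Rightarrow> ('c \<Rightarrow>\<^sub>0 'k::field)) \<Rightarrow> ('a \<Rightarrow>\<^sub>0 'k) \<Rightarrow> ('b \<Rightarrow>\<^sub>0 'k) \<Rightarrow> ('c \<Rightarrow>\<^sub>0 'k)" where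
  "bilin_ext F x y = lin_ext (\<lambda>a. lin_ext (\<lambda>b. F a b) y) x"

definition linear_on :: "('b \<Rightarrow>\<^sub>0 'k::field) set \<Rightarrow> (('b \<Rightarrow>\<^sub>0 'k) \<Rightarrow> ('c \<Rightarrow>\<^sub>0 'k)) \<Rightarrow> bool" where
  "linear_on S f \<longleftrightarrow>
     (\<forall>x\<in>S. \<forall>y\<in>S. f (x + y) = f x + f y) \<and> (\<forall>c. \<forall>x\<in>S. f (scale c x) = scale c (f x))"


section \<open>Species, operads, sub-operads, ideals\<close>

text \<open>
  A species is given on the finite sets of elements of \<open>'v\<close>: \<open>transport Q V \<sigma>\<close> is the map
  \<open>Q[V] \<rightarrow> Q[\<sigma>(V)]\<close> induced by a function \<open>\<sigma>\<close> that is injective on \<open>V\<close>, and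
  \<open>pcomp Q V\<^sub>1 s V\<^sub>2\<close> is \<open>\<circ>\<^sub>s : Q[V\<^sub>1 \<squnion> {s}] \<times> Q[V\<^sub>2] \<rightarrow> Q[V\<^sub>1 \<squnion> V\<^sub>2]\<close>.
\<close>

record (overloaded) ('v, 'b, 'k) operad_data =
  space :: "'v set \<Rightarrow> ('b \<Rightarrow>\<^sub>0 'k) set"
  transport :: "'v set \<Rightarrow> ('v \<Rightarrow> 'v) \<Rightarrow> ('b \<Rightarrow>\<^sub>0 'k) \<Rightarrow> ('b \<Rightarrow>\<^sub>0 'k)"
  unit :: "'v \<Rightarrow> ('b \<Rightarrow>\<^sub>0 'k)"
  pcomp :: "'v set \<Rightarrow> 'v \<Rightarrow> 'v set \<Rightarrow> ('b \<Rightarrow>\<^sub>0 'k) \<Rightarrow> ('b \<Rightarrow>\<^sub>0 'k) \<Rightarrow> ('b \<Rightarrow>\<^sub>0 'k)"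

definition species :: "('v, 'b, 'k::field) operad_data \<Rightarrow> bool" where
  "species Q \<longleftrightarrow>
     (\<forall>V. finite V \<longrightarrow> fs.subspace (space Q V)) \<and>
     (\<forall>V \<sigma>. finite V \<and> inj_on \<sigma> V \<longrightarrow>
        linear_on (space Q V) (transport Q V \<sigma>) \<and>
        transport Q V \<sigma> ` space Q V \<subseteq> space Q (\<sigma> ` V)) \<and>
     (\<forall>V \<sigma> \<tau>. finite V \<and> inj_on \<sigma> V \<and> (\<forall>v\<in>V. \<sigma> v = \<tau> v) \<longrightarrow>
        (\<forall>x\<in>space Q V. transport Q V \<sigma> x = transport Q V \<tau> x)) \<and>
     (\<forall>V. finite V \<longrightarrow> (\<forall>x\<in>space Q V. transport Q V id x = x)) \<and>
     (\<forall>V \<sigma> \<tau>. finite V \<and> inj_on \<sigma> V \<and> inj_on \<tau> (\<sigma> ` V) \<longrightarrow>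
        (\<forall>x\<in>space Q V. transport Q (\<sigma> ` V) \<tau> (transport Q V \<sigma> x) = transport Q V (\<tau> \<circ> \<sigma>) x))"

definition composable :: "'v set \<Rightarrow> 'v \<Rightarrow> 'v set \<Rightarrow> bool" where
  "composable V1 s V2 \<longleftrightarrow> finite V1 \<and> finite V2 \<and> s \<notin> V1 \<and> V1 \<inter> V2 = {}"

text \<open>
  The conjuncts after the closure and bilinearity of composition are: naturality of the units,
  naturality of composition, the two unit axioms, parallel associativity, sequential associativity.
\<close>

definition operad :: "('v, 'b, 'k::field) operad_data \<Rightarrow> bool" where
  "operad Q \<longleftrightarrow>
     species Q \<and>
     space Q {} = {0} \<and>
     (\<forall>v. unit Q v \<in> space Q {v}) \<and>
     (\<forall>V1 s V2. composable V1 s V2 \<longrightarrow>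
        (\<forall>x\<in>space Q (insert s V1). \<forall>y\<in>space Q V2. pcomp Q V1 s V2 x y \<in> space Q (V1 \<union> V2)) \<and>
        (\<forall>x\<in>space Q (insert s V1). linear_on (space Q V2) (\<lambda>y. pcomp Q V1 s V2 x y)) \<and>
        (\<forall>y\<in>space Q V2. linear_on (space Q (insert s V1)) (\<lambda>x. pcomp Q V1 s V2 x y))) \<and>
     (\<forall>v \<sigma>. transport Q {v} \<sigma> (unit Q v) = unit Q (\<sigma> v)) \<and>
     (\<forall>V1 s V2 \<sigma> \<tau> \<rho>.
        composable V1 s V2 \<and> inj_on \<sigma> (insert s V1) \<and> inj_on \<tau> V2 \<and> inj_on \<rho> (V1 \<union> V2) \<and>
        (\<forall>v\<in>V1. \<rho> v = \<sigma> v) \<and> (\<forall>v\<in>V2. \<rho> v = \<tau> v) \<longrightarrow>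
        (\<forall>x\<in>space Q (insert s V1). \<forall>y\<in>space Q V2.
           transport Q (V1 \<union> V2) \<rho> (pcomp Q V1 s V2 x y) =
           pcomp Q (\<sigma> ` V1) (\<sigma> s) (\<tau> ` V2) (transport Q (insert s V1) \<sigma> x) (transport Q V2 \<tau> y))) \<and>
     (\<forall>V s. finite V \<longrightarrow> (\<forall>y\<in>space Q V. pcomp Q {} s V (unit Q s) y = y)) \<and>
     (\<forall>V1 s v. composable V1 s {v} \<longrightarrow>
        (\<forall>x\<in>space Q (insert s V1).
           pcomp Q V1 s {v} x (unit Q v) = transport Q (insert s V1) (id(s := v)) x)) \<and>
     (\<forall>V1 V2 V3 s t.
        finite V1 \<and> finite V2 \<and> finite V3 \<and>
        V1 \<inter> V2 = {} \<and> V1 \<inter> V3 = {} \<and> V2 \<inter> V3 = {} \<and>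
        s \<noteq> t \<and> s \<notin> V1 \<union> V3 \<and> t \<notin> V1 \<union> V2 \<longrightarrow>
        (\<forall>x\<in>space Q (insert s (insert t V1)). \<forall>y\<in>space Q V2. \<forall>z\<in>space Q V3.
           pcomp Q (V1 \<union> V2) t V3 (pcomp Q (insert t V1) s V2 x y) z =
           pcomp Q (V1 \<union> V3) s V2 (pcomp Q (insert s V1) t V3 x z) y)) \<and>
     (\<forall>V1 V2 V3 s t.
        finite V1 \<and> finite V2 \<and> finite V3 \<and>
        V1 \<inter> V2 = {} \<and> V1 \<inter> V3 = {} \<and> V2 \<inter> V3 = {} \<and>
        s \<notin> V1 \<and> t \<notin> V1 \<union> V2 \<longrightarrow>
        (\<forall>x\<in>space Q (insert s V1). \<forall>y\<in>space Q (insert t V2). \<forall>z\<in>space Q V3.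
           pcomp Q (V1 \<union> V2) t V3 (pcomp Q V1 s (insert t V2) x y) z =
           pcomp Q V1 s (V2 \<union> V3) x (pcomp Q V2 t V3 y z)))"

definition subspecies :: "('v set \<Rightarrow> ('b \<Rightarrow>\<^sub>0 'k) set) \<Rightarrow> ('v, 'b, 'k::field) operad_data \<Rightarrow> bool" where
  "subspecies S Q \<longleftrightarrow>
     (\<forall>V. finite V \<longrightarrow> fs.subspace (S V) \<and> S V \<subseteq> space Q V) \<and>
     (\<forall>V \<sigma>. finite V \<and> inj_on \<sigma> V \<longrightarrow> transport Q V \<sigma> ` S V \<subseteq> S (\<sigma> ` V))"

definition suboperad :: "('v set \<Rightarrow> ('b \<Rightarrow>\<^sub>0 'k) set) \<Rightarrow> ('v, 'b, 'k::field) operad_data \<Rightarrow> bool" where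
  "suboperad S Q \<longleftrightarrow>
     operad Q \<and> subspecies S Q \<and>
     (\<forall>v. unit Q v \<in> S {v}) \<and>
     (\<forall>V1 s V2. composable V1 s V2 \<longrightarrow>
        (\<forall>x\<in>S (insert s V1). \<forall>y\<in>S V2. pcomp Q V1 s V2 x y \<in> S (V1 \<union> V2)))"

definition operad_ideal :: "('v set \<Rightarrow> ('b \<Rightarrow>\<^sub>0 'k) set) \<Rightarrow> ('v, 'b, 'k::field) operad_data \<Rightarrow> bool" where
  "operad_ideal I Q \<longleftrightarrow>
     operad Q \<and> subspecies I Q \<and>
     (\<forall>V1 s V2. composable V1 s V2 \<longrightarrow>
        (\<forall>x\<in>I (insert s V1). \<forall>y\<in>space Q V2. pcomp Q V1 s V2 x y \<in> I (V1 \<union> V2)) \<and>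
        (\<forall>x\<in>space Q (insert s V1). \<forall>y\<in>I V2. pcomp Q V1 s V2 x y \<in> I (V1 \<union> V2)))"

abbreviation restrict_to ::
  "('v, 'b, 'k) operad_data \<Rightarrow> ('v set \<Rightarrow> ('b \<Rightarrow>\<^sub>0 'k) set) \<Rightarrow> ('v, 'b, 'k::field) operad_data" where
  "restrict_to Q S \<equiv> Q\<lparr>space := S\<rparr>"

definition operad_isomorphic ::
  "('v, 'b, 'k::field) operad_data \<Rightarrow> ('v, 'c, 'k) operad_data \<Rightarrow> bool" where
  "operad_isomorphic P Q \<longleftrightarrow>
     operad P \<and> operad Q \<and>
     (\<exists>\<phi>. (\<forall>V. finite V \<longrightarrow>
              linear_on (space P V) (\<phi> V) \<and> bij_betw (\<phi> V) (space P V) (space Q V)) \<and>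
          (\<forall>V \<sigma>. finite V \<and> inj_on \<sigma> V \<longrightarrow>
             (\<forall>x\<in>space P V. \<phi> (\<sigma> ` V) (transport P V \<sigma> x) = transport Q V \<sigma> (\<phi> V x))) \<and>
          (\<forall>v. \<phi> {v} (unit P v) = unit Q v) \<and>
          (\<forall>V1 s V2. composable V1 s V2 \<longrightarrow>
             (\<forall>x\<in>space P (insert s V1). \<forall>y\<in>space P V2.
                \<phi> (V1 \<union> V2) (pcomp P V1 s V2 x y) =
                pcomp Q V1 s V2 (\<phi> (insert s V1) x) (\<phi> V2 y))))"


section \<open>The Hadamard product\<close>

text \<open>
  The tensor product of two spaces with bases \<open>'b\<close> and \<open>'c\<close> is the space with basis \<open>'b \<times> 'c\<close>; over
  a field, the tensor product of subspaces is the span of their pure tensors in it.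
\<close>

definition tensor :: "('b \<Rightarrow>\<^sub>0 'k::field) \<Rightarrow> ('c \<Rightarrow>\<^sub>0 'k) \<Rightarrow> ('b \<times> 'c \<Rightarrow>\<^sub>0 'k)" (infixr "\<otimes>\<^sub>v" 70) where
  "x \<otimes>\<^sub>v y = bilin_ext (\<lambda>b c. basis (b, c)) x y"

text \<open>
  Transport and composition are given on the basis \<open>'b \<times> 'c\<close> and extended linearly. They are
  computed factorwise on arbitrary pure tensors when the structure maps of both factors are
  linear on the whole ambient space, as those of \<open>MG\<close> and \<open>PLie\<close> are
  (see \<open>hadamard_comp_tensor\<close>, \<open>hadamard_transport_tensor\<close>).
\<close>

definition hadamard ::
  "('v, 'b, 'k::field) operad_data \<Rightarrow> ('v, 'c, 'k) operad_data \<Rightarrow> ('v, 'b \<times> 'c, 'k) operad_data" where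
  "hadamard P Q =
     \<lparr> space = (\<lambda>V. fs.span {x \<otimes>\<^sub>v y | x y. x \<in> space P V \<and> y \<in> space Q V}),
       transport = (\<lambda>V \<sigma>. lin_ext (\<lambda>(b, c).
         transport P V \<sigma> (basis b) \<otimes>\<^sub>v transport Q V \<sigma> (basis c))),
       unit = (\<lambda>v. unit P v \<otimes>\<^sub>v unit Q v),
       pcomp = (\<lambda>V1 s V2. bilin_ext (\<lambda>(b1, c1) (b2, c2).
         pcomp P V1 s V2 (basis b1) (basis b2) \<otimes>\<^sub>v pcomp Q V1 s V2 (basis c1) (basis c2))) \<rparr>"

lemma lin_ext_superset:
  assumes "finite A" "Poly_Mapping.keys x \<subseteq> A"
  shows "lin_ext F x = (\<Sum>b\<in>A. scale (Poly_Mapping.lookup x b) (F b))"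
  unfolding lin_ext_def by (rule sum.mono_neutral_left) (use assms in \<open>auto simp: in_keys_iff\<close>)

lemma lin_ext_add: "lin_ext F (x + y) = lin_ext F x + lin_ext F y"
proof -
  let ?A = "Poly_Mapping.keys x \<union> Poly_Mapping.keys y"
  have "Poly_Mapping.keys (x + y) \<subseteq> ?A" by (rule Poly_Mapping.keys_add)
  then show ?thesis
    by (simp add: lin_ext_superset[of ?A] lookup_add fs.scale_left_distrib sum.distrib)
qed

lemma lin_ext_scale: "lin_ext F (scale c x) = scale c (lin_ext F x)"
proof -
  have "Poly_Mapping.keys (scale c x) \<subseteq> Poly_Mapping.keys x" by (auto simp: in_keys_iff)
  then show ?thesis
    by (simp add: lin_ext_superset[of "Poly_Mapping.keys x"] fs.scale_sum_right)
qed

lemma lin_ext_zero [simp]: "lin_ext F 0 = 0"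
  by (simp add: lin_ext_def)

lemma lin_ext_sum: "lin_ext F (\<Sum>i\<in>A. f i) = (\<Sum>i\<in>A. lin_ext F (f i))"
  by (induction A rule: infinite_finite_induct) (auto simp: lin_ext_add)

lemma lin_ext_basis [simp]: "lin_ext F (basis b) = F b"
  by (simp add: lin_ext_def)

lemma lin_ext_fun_add: "lin_ext (\<lambda>b. F b + G b) x = lin_ext F x + lin_ext G x"
  by (simp add: lin_ext_def fs.scale_right_distrib sum.distrib)

lemma lin_ext_fun_scale: "lin_ext (\<lambda>b. scale c (F b)) x = scale c (lin_ext F x)"
  by (simp add: lin_ext_def fs.scale_sum_right mult.commute)

lemma basis_expansion: "lin_ext basis x = x"
proof (rule poly_mapping_eqI)
  fix b
  have "Poly_Mapping.lookup (lin_ext basis x) b = (\<Sum>a\<in>Poly_Mapping.keys x. Poly_Mapping.lookup x a * (1 when a = b))"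
    by (simp add: lin_ext_def lookup_sum lookup_single)
  also have "\<dots> = Poly_Mapping.lookup x b"
    by (simp add: when_def in_keys_iff if_distrib cong: if_cong)
  finally show "Poly_Mapping.lookup (lin_ext basis x) b = Poly_Mapping.lookup x b" .
qed

lemma linear_eq_lin_ext:
  assumes "linear_on UNIV f"
  shows "f x = lin_ext (\<lambda>b. f (basis b)) x"
proof -
  have f0: "f 0 = 0"
    using assms[unfolded linear_on_def, THEN conjunct2, rule_format, of 0 0] by simp
  have fsum: "f (\<Sum>i\<in>A. g i) = (\<Sum>i\<in>A. f (g i))" for A :: "'a set" and g
    using assms by (induction A rule: infinite_finite_induct) (auto simp: linear_on_def f0)
  have "f x = f (lin_ext basis x)" by (simp add: basis_expansion)
  also have "\<dots> = lin_ext (\<lambda>b. f (basis b)) x"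
    using assms by (simp add: lin_ext_def fsum linear_on_def)
  finally show ?thesis .
qed

lemma lin_ext_linear_on: "linear_on S (lin_ext F)"
  by (simp add: linear_on_def lin_ext_add lin_ext_scale)

lemma lin_ext_comp: "lin_ext F (lin_ext G x) = lin_ext (\<lambda>b. lin_ext F (G b)) x"
  by (simp add: lin_ext_def[of G] lin_ext_def[of "\<lambda>b. lin_ext F (G b)"] lin_ext_sum lin_ext_scale)

lemma lin_ext_swap:
  "lin_ext (\<lambda>a. lin_ext (\<lambda>b. F a b) y) x = lin_ext (\<lambda>b. lin_ext (\<lambda>a. F a b) x) y"
  unfolding lin_ext_def fs.scale_sum_right
  by (subst sum.swap) (simp add: mult.commute)

lemma tensor_lin_ext:
  "lin_ext F x \<otimes>\<^sub>v lin_ext G y = lin_ext (\<lambda>b. lin_ext (\<lambda>c. F b \<otimes>\<^sub>v G c) y) x"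
proof -
  have "lin_ext F x \<otimes>\<^sub>v lin_ext G y =
      lin_ext (\<lambda>b. lin_ext (\<lambda>a. lin_ext (\<lambda>d. lin_ext (\<lambda>c. basis (a, c)) (G d)) y) (F b)) x"
    by (simp add: tensor_def bilin_ext_def lin_ext_comp)
  also have "\<dots> = lin_ext (\<lambda>b. lin_ext (\<lambda>c. F b \<otimes>\<^sub>v G c) y) x"
    unfolding tensor_def bilin_ext_def by (subst lin_ext_swap) (rule refl)
  finally show ?thesis .
qed

lemma lin_ext_tensor:
  "lin_ext F (x \<otimes>\<^sub>v y) = lin_ext (\<lambda>b. lin_ext (\<lambda>c. F (b, c)) y) x"
  by (simp add: tensor_def bilin_ext_def lin_ext_comp)

lemma hadamard_transport_tensor:
  assumes "linear_on UNIV (transport P V \<sigma>)" "linear_on UNIV (transport Q V \<sigma>)"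
  shows "transport (hadamard P Q) V \<sigma> (x \<otimes>\<^sub>v y) = transport P V \<sigma> x \<otimes>\<^sub>v transport Q V \<sigma> y"
  unfolding linear_eq_lin_ext[OF assms(1), of x] linear_eq_lin_ext[OF assms(2), of y] tensor_lin_ext
  by (simp add: hadamard_def lin_ext_tensor)

lemma hadamard_comp_tensor:
  assumes "\<And>x. linear_on UNIV (\<lambda>y. pcomp P V1 s V2 x y)" "\<And>y. linear_on UNIV (\<lambda>x. pcomp P V1 s V2 x y)"
    and "\<And>x. linear_on UNIV (\<lambda>y. pcomp Q V1 s V2 x y)" "\<And>y. linear_on UNIV (\<lambda>x. pcomp Q V1 s V2 x y)"
  shows "pcomp (hadamard P Q) V1 s V2 (x1 \<otimes>\<^sub>v x2) (y1 \<otimes>\<^sub>v y2) =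
         pcomp P V1 s V2 x1 y1 \<otimes>\<^sub>v pcomp Q V1 s V2 x2 y2"
proof -
  have P: "pcomp P V1 s V2 x1 y1 =
      lin_ext (\<lambda>a. lin_ext (\<lambda>b. pcomp P V1 s V2 (basis a) (basis b)) y1) x1"
    by (subst linear_eq_lin_ext[OF assms(2)], subst linear_eq_lin_ext[OF assms(1)]) (rule refl)
  have Q: "pcomp Q V1 s V2 x2 y2 =
      lin_ext (\<lambda>a. lin_ext (\<lambda>b. pcomp Q V1 s V2 (basis a) (basis b)) y2) x2"
    by (subst linear_eq_lin_ext[OF assms(4)], subst linear_eq_lin_ext[OF assms(3)]) (rule refl)
  show ?thesis
    unfolding P Q tensor_lin_ext
    by (simp add: hadamard_def bilin_ext_def lin_ext_tensor)
qed


section \<open>Multigraphs\<close>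

text \<open>
  An edge is the two-element multiset of its ends, so a loop at \<open>v\<close> is \<open>{#v, v#}\<close>. In an oriented
  multigraph each end carries its own label.
\<close>

datatype end_label = Source | Target

type_synonym 'v multigraph = "'v multiset multiset"
type_synonym 'v or_multigraph = "(end_label \<times> 'v) multiset multiset"

definition multigraphs :: "'v set \<Rightarrow> 'v multigraph set" where
  "multigraphs V = {g. \<forall>e\<in>#g. size e = 2 \<and> set_mset e \<subseteq> V}"

definition underlying :: "'v or_multigraph \<Rightarrow> 'v multigraph" where
  "underlying h = image_mset (image_mset snd) h"

definition or_multigraphs :: "'v set \<Rightarrow> 'v or_multigraph set" where
  "or_multigraphs V = {h. underlying h \<in> multigraphs V}"

definition adjacency :: "'v multigraph \<Rightarrow> ('v \<times> 'v) set" where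
  "adjacency g = {(u, v). {#u, v#} \<in># g}"

definition connected_on :: "'v set \<Rightarrow> 'v multigraph \<Rightarrow> bool" where
  "connected_on V g \<longleftrightarrow>
     g \<in> multigraphs V \<and> V \<noteq> {} \<and> (\<forall>u\<in>V. \<forall>v\<in>V. (u, v) \<in> (adjacency g)\<^sup>*)"

text \<open>
  The cycle through distinct vertices \<open>v\<^sub>1, \<dots>, v\<^sub>n\<close> has the edges \<open>v\<^sub>1v\<^sub>2, \<dots>, v\<^sub>nv\<^sub>1\<close>, counted with
  multiplicity: a loop for \<open>n = 1\<close>, a pair of parallel edges for \<open>n = 2\<close>.
\<close>

definition cycle_edges :: "'v list \<Rightarrow> 'v multigraph" where
  "cycle_edges vs = mset (map2 (\<lambda>u v. {#u, v#}) vs (rotate1 vs))"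

definition tree_on :: "'v set \<Rightarrow> 'v multigraph \<Rightarrow> bool" where
  "tree_on V t \<longleftrightarrow>
     connected_on V t \<and> \<not> (\<exists>vs. vs \<noteq> [] \<and> distinct vs \<and> cycle_edges vs \<subseteq># t)"

definition spanning_tree :: "'v set \<Rightarrow> 'v multigraph \<Rightarrow> 'v multigraph \<Rightarrow> bool" where
  "spanning_tree V g t \<longleftrightarrow> t \<subseteq># g \<and> tree_on V t"

definition graph_dist :: "'v multigraph \<Rightarrow> 'v \<Rightarrow> 'v \<Rightarrow> nat" where
  "graph_dist g u v = (LEAST n. (u, v) \<in> adjacency g ^^ n)"


section \<open>The operads of multigraphs and of rooted trees\<close>

text \<open>
  \<open>choices R M\<close> is the multiset of all results of independently replacing each occurrence of each
  element \<open>x\<close> of \<open>M\<close> by a member of \<open>R x\<close>, one result for every combination of choices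
  (\<open>choices_add_mset\<close>). When \<open>R\<close> lists the possible reconnections of an end,
  \<open>choices R e\<close> lists those of an edge \<open>e\<close> and \<open>choices (choices R) g\<close> those of a multigraph \<open>g\<close>.
\<close>

definition choices :: "('a \<Rightarrow> 'b multiset) \<Rightarrow> 'a multiset \<Rightarrow> 'b multiset multiset" where
  "choices R M = fold_mset (\<lambda>x C. \<Sum>y\<in>#R x. image_mset (add_mset y) C) {#{#}#} M"

lemma choices_empty [simp]: "choices R {#} = {#{#}#}"
  by (simp add: choices_def)

lemma choices_add_mset [simp]:
  fixes R :: "'a \<Rightarrow> 'b multiset"
  shows "choices R (add_mset x M) = (\<Sum>y\<in>#R x. image_mset (add_mset y) (choices R M))"
proof -
  have img: "image_mset h (\<Sum>y\<in>#A. g y) = (\<Sum>y\<in>#A. image_mset h (g y))"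
    for h :: "'b multiset \<Rightarrow> 'b multiset" and g :: "'b \<Rightarrow> 'b multiset multiset" and A
    by (induction A) auto
  interpret comp_fun_commute "\<lambda>x C. \<Sum>y\<in>#R x. image_mset (add_mset y) C"
  proof
    fix x x' :: 'a
    show "(\<lambda>C. \<Sum>y\<in>#R x. image_mset (add_mset y) C) \<circ> (\<lambda>C. \<Sum>y\<in>#R x'. image_mset (add_mset y) C) =
          (\<lambda>C. \<Sum>y\<in>#R x'. image_mset (add_mset y) C) \<circ> (\<lambda>C. \<Sum>y\<in>#R x. image_mset (add_mset y) C)"
      unfolding comp_def img multiset.map_comp
      by (rule ext, subst sum_mset.swap) (simp add: add_mset_commute)
  qed
  show ?thesis by (simp add: choices_def)
qed

definition MG :: "('v, 'v multigraph, 'k::field) operad_data" where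
  "MG =
     \<lparr> space = (\<lambda>V. fs.span {basis g | g. g \<in> multigraphs V \<and> V \<noteq> {}}),
       transport = (\<lambda>V \<sigma>. lin_ext (\<lambda>g. basis (image_mset (image_mset \<sigma>) g))),
       unit = (\<lambda>v. basis {#}),
       pcomp = (\<lambda>V1 s V2. bilin_ext (\<lambda>g1 g2.
         let R = (\<lambda>v. if v = s then mset_set V2 else {#v#})
         in formal_sum {# h + g2. h \<in># choices (choices R) g1 #})) \<rparr>"

definition MG_or :: "('v, 'v or_multigraph \<times> 'v, 'k::field) operad_data" where
  "MG_or =
     \<lparr> space = (\<lambda>V. fs.span {basis (g, v) | g v. g \<in> or_multigraphs V \<and> v \<in> V}),
       transport = (\<lambda>V \<sigma>. lin_ext (\<lambda>(g, v).
         basis (image_mset (image_mset (map_prod id \<sigma>)) g, \<sigma> v))),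
       unit = (\<lambda>v. basis ({#}, v)),
       pcomp = (\<lambda>V1 s V2. bilin_ext (\<lambda>(g1, v1) (g2, v2).
         let R = (\<lambda>(l, v). if v \<noteq> s then {#(l, v)#}
                           else case l of
                             Source \<Rightarrow> {#(Source, v2)#}
                           | Target \<Rightarrow> {#(Target, u). u \<in># mset_set V2#})
         in formal_sum {# (h + g2, if v1 = s then v2 else v1). h \<in># choices (choices R) g1 #})) \<rparr>"

definition MG_orc :: "('v, 'v or_multigraph \<times> 'v, 'k::field) operad_data" where
  "MG_orc = restrict_to MG_or (\<lambda>V. fs.span
     {basis (g, v) | g v. g \<in> or_multigraphs V \<and> v \<in> V \<and> connected_on V (underlying g)})"

text \<open>In a tree \<open>t\<close> rooted at \<open>r\<close>, the parent of a vertex is its neighbour nearer to \<open>r\<close>.\<close>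

definition parent :: "'v multigraph \<Rightarrow> 'v \<Rightarrow> 'v \<Rightarrow> 'v" where
  "parent t r v = (THE p. {#p, v#} \<in># t \<and> graph_dist t r p < graph_dist t r v)"

definition children :: "'v multigraph \<Rightarrow> 'v \<Rightarrow> 'v \<Rightarrow> 'v set" where
  "children t r v = {c. {#c, v#} \<in># t \<and> graph_dist t r v < graph_dist t r c}"

text \<open>The sum in the composition of \<open>PLie\<close> is over the maps \<open>f\<close> from the children of \<open>s\<close> to \<open>V2\<close>.\<close>

definition PLie :: "('v, 'v multigraph \<times> 'v, 'k::field) operad_data" where
  "PLie =
     \<lparr> space = (\<lambda>V. fs.span {basis (t, r) | t r. tree_on V t \<and> r \<in> V}),
       transport = (\<lambda>V \<sigma>. lin_ext (\<lambda>(t, r). basis (image_mset (image_mset \<sigma>) t, \<sigma> r))),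
       unit = (\<lambda>v. basis ({#}, v)),
       pcomp = (\<lambda>V1 s V2. bilin_ext (\<lambda>(t1, r1) (t2, r2).
         \<Sum>f \<in> children t1 r1 s \<rightarrow>\<^sub>E V2.
           basis ({#e \<in># t1. s \<notin># e#} + t2
                    + (if r1 = s then {#} else {#{#parent t1 r1 s, r2#}#})
                    + {#{#c, f c#}. c \<in># mset_set (children t1 r1 s)#},
                  if r1 = s then r2 else r1))) \<rparr>"


section \<open>Orientations from rooted spanning trees\<close>

definition orient_tree_edge :: "'v multigraph \<Rightarrow> 'v \<Rightarrow> 'v multiset \<Rightarrow> (end_label \<times> 'v) multiset" where
  "orient_tree_edge t r e =
     {# (if \<forall>u\<in>#e. graph_dist t r v \<le> graph_dist t r u then Target else Source, v). v \<in># e #}"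

definition orient :: "'v multigraph \<Rightarrow> 'v multigraph \<Rightarrow> 'v \<Rightarrow> 'v or_multigraph" where
  "orient g t r =
     image_mset (orient_tree_edge t r) t + image_mset (image_mset (Pair Target)) (g - t)"

definition ST :: "'v set \<Rightarrow> ('v or_multigraph \<times> 'v \<Rightarrow>\<^sub>0 'k::field) set" where
  "ST V = fs.span
     {basis (orient g t r, r) | g t r. connected_on V g \<and> r \<in> V \<and> spanning_tree V g t}"

definition OST :: "'v set \<Rightarrow> ('v or_multigraph \<times> 'v \<Rightarrow>\<^sub>0 'k::field) set" where
  "OST V = fs.span
     {(\<Sum>r\<in>V. basis (orient g (t r) r, r)) | g t.
        connected_on V g \<and> (\<forall>r\<in>V. spanning_tree V g (t r))}"

definition IST :: "'v set \<Rightarrow> ('v or_multigraph \<times> 'v \<Rightarrow>\<^sub>0 'k::field) set" where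
  "IST V = fs.span
     {basis (orient g t1 r, r) - basis (orient g t2 r, r) | g t1 t2 r.
        connected_on V g \<and> r \<in> V \<and> spanning_tree V g t1 \<and> spanning_tree V g t2}"

end

theory Submission
  imports Defs
begin

text \<open>
  A rooted tree on a finite set is the same thing as a parent function that decreases some rank. In
  these terms \<open>(g, orient g t r, r)\<close> consists of one edge from the source \<open>v\<close> to the target \<open>p v\<close> for each
  \<open>v \<noteq> r\<close>, plus the edges of \<open>g - t\<close> with two target ends. In a composition the former compose as in
  \<open>PLie\<close> and the latter as in \<open>MG\<close>, and they can be told apart by the presence of a source end; this
  gives (i), the operad axioms of the Hadamard product being transported from \<open>ST\<close>.

  For (ii) and (iii), let \<open>\<pi>\<close> forget the orientation but keep the root. Then \<open>IST\<close> is the kernel of \<open>\<pi>\<close>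
  on \<open>ST\<close>, and \<open>OST\<close> is the preimage in \<open>ST\<close> of the span of the sums \<open>\<Sum>r\<in>V. (g, r)\<close>. The image \<open>\<pi> (x \<circ> y)\<close>
  depends on \<open>y\<close> only through \<open>\<pi> y\<close>, and if \<open>\<pi> y\<close> is such a sum, it depends on \<open>x\<close> only through \<open>\<pi> x\<close>:
  at most one source end is attached to the vertex to be replaced, and summing over the roots of \<open>y\<close>
  lets it range over all vertices.
\<close>

section \<open>Reconnection choices\<close>

lemma image_mset_Sum: "image_mset h (\<Sum>y\<in>#A. g y) = (\<Sum>y\<in>#A. image_mset h (g y))"
  by (induction A) auto

lemma Sum_mset_bind: "(\<Sum>w\<in>#(\<Sum>y\<in>#A. g y). f w) = (\<Sum>y\<in>#A. \<Sum>w\<in>#g y. f w)"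
  by (induction A) auto

lemma Sum_mset_Sum: "\<Sum>\<^sub># (\<Sum>y\<in>#A. g y) = (\<Sum>y\<in>#A. \<Sum>\<^sub># (g y))"
  by (induction A) auto

lemma Sum_mset_image: "(\<Sum>w\<in>#image_mset g A. f w) = (\<Sum>y\<in>#A. f (g y))"
  by (simp add: multiset.map_comp comp_def)

lemma Sum_mset_cong: "(\<And>x. x \<in># M \<Longrightarrow> f x = g x) \<Longrightarrow> (\<Sum>x\<in>#M. f x) = (\<Sum>x\<in>#M. g x)"
  by (metis (mono_tags, lifting) image_mset_cong)

lemma choices_union:
  fixes R :: "'a \<Rightarrow> 'b multiset"
  shows "choices R (A + B) = (\<Sum>a\<in>#choices R A. image_mset ((+) a) (choices R B))"
proof (induction A)
  case empty
  have "image_mset ((+) {#}) M = M" for M :: "'b multiset multiset"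
    by (induction M) auto
  then show ?case by simp
next
  case (add x A)
  have "(+) (add_mset y a) = (\<lambda>M. add_mset y (a + M))" for y and a :: "'b multiset"
    by auto
  with add show ?case
    by (simp add: image_mset_Sum Sum_mset_bind Sum_mset_Sum multiset.map_comp comp_def)
qed

lemma choices_bind:
  "(\<Sum>h\<in>#choices R g. choices S h) = choices (\<lambda>x. \<Sum>y\<in>#R x. S y) g"
proof (induction g)
  case empty
  show ?case by simp
next
  case (add x g)
  have "(\<Sum>h\<in>#choices R (add_mset x g). choices S h) =
      (\<Sum>y\<in>#R x. \<Sum>h\<in>#choices R g. \<Sum>z\<in>#S y. image_mset (add_mset z) (choices S h))"
    by (simp add: Sum_mset_bind multiset.map_comp comp_def)
  also have "\<dots> = (\<Sum>y\<in>#R x. \<Sum>z\<in>#S y. \<Sum>h\<in>#choices R g. image_mset (add_mset z) (choices S h))"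
    by (subst sum_mset.swap) (rule refl)
  also have "\<dots> = (\<Sum>y\<in>#R x. \<Sum>z\<in>#S y. image_mset (add_mset z) (\<Sum>h\<in>#choices R g. choices S h))"
    by (simp add: image_mset_Sum)
  also have "\<dots> = choices (\<lambda>x. \<Sum>y\<in>#R x. S y) (add_mset x g)"
    by (simp add: add.IH Sum_mset_bind)
  finally show ?case .
qed

lemma choices_singleton: "choices (\<lambda>x. {#f x#}) g = {#image_mset f g#}"
  by (induction g) auto

lemma choices_choices_singleton:
  "choices (choices (\<lambda>x. {#f x#})) g = {#image_mset (image_mset f) g#}"
proof -
  have "choices (\<lambda>x. {#f x#}) = (\<lambda>h. {#image_mset f h#})"
    by (rule ext) (rule choices_singleton)
  then show ?thesis by (simp add: choices_singleton)
qed

lemma choices_image: "choices R (image_mset f g) = choices (\<lambda>x. R (f x)) g"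
  by (induction g) auto

lemma choices_cong: "(\<And>x. x \<in># g \<Longrightarrow> R x = S x) \<Longrightarrow> choices R g = choices S g"
  by (induction g) auto

lemma image_choices: "image_mset (image_mset f) (choices R g) = choices (\<lambda>x. image_mset f (R x)) g"
proof (induction g)
  case (add x g)
  show ?case
    by (simp add: image_mset_Sum multiset.map_comp comp_def flip: add.IH)
qed simp

lemma choices_choices_bind:
  "(\<Sum>h\<in>#choices (choices R) g. choices (choices S) h) =
     choices (choices (\<lambda>x. \<Sum>y\<in>#R x. S y)) g"
  by (simp add: choices_bind)

lemma choices_choices_cong:
  "(\<And>e x. e \<in># g \<Longrightarrow> x \<in># e \<Longrightarrow> R x = S x) \<Longrightarrow> choices (choices R) g = choices (choices S) g"
  by (intro choices_cong) auto

lemma in_choices_set: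
  "h \<in># choices R g \<Longrightarrow> y \<in># h \<Longrightarrow> \<exists>x\<in>#g. y \<in># R x"
  by (induction g arbitrary: h) fastforce+

lemma in_choices_image:
  "h \<in># choices R g \<Longrightarrow> (\<And>x y. x \<in># g \<Longrightarrow> y \<in># R x \<Longrightarrow> q y = x) \<Longrightarrow> image_mset q h = g"
  by (induction g arbitrary: h) fastforce+

lemma in_choices_size: "h \<in># choices R g \<Longrightarrow> size h = size g"
  by (induction g arbitrary: h) fastforce+

lemma in_choices_ends:
  assumes "h \<in># choices (choices R) g" "e \<in># h" "y \<in># e"
  shows "\<exists>e'\<in>#g. \<exists>x\<in>#e'. y \<in># R x"
  using in_choices_set[OF assms(1,2)] in_choices_set[OF _ assms(3)] by blast

lemma in_choices_choices_image:
  assumes "h \<in># choices (choices R) g"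
    and "\<And>e x y. e \<in># g \<Longrightarrow> x \<in># e \<Longrightarrow> y \<in># R x \<Longrightarrow> q y = x"
  shows "image_mset (image_mset q) h = g"
  by (rule in_choices_image[OF assms(1)]) (rule in_choices_image, assumption, rule assms(2))

lemma choices_mset_set:
  fixes F :: "'a \<Rightarrow> 'c \<Rightarrow> 'b"
  assumes "finite C"
  shows "choices (\<lambda>c. image_mset (F c) (mset_set A)) (mset_set C) =
    image_mset (\<lambda>f. image_mset (\<lambda>c. F c (f c)) (mset_set C)) (mset_set (C \<rightarrow>\<^sub>E A))"
  using assms
proof (induction C rule: finite_induct)
  case empty
  show ?case by simp
next
  case (insert c C)
  let ?upd = "\<lambda>(y, g). g(c := y)"
  have inj: "inj_on ?upd (A \<times> (C \<rightarrow>\<^sub>E A))"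
  proof (rule inj_onI, clarsimp)
    fix y y' g g'
    assume *: "g \<in> C \<rightarrow>\<^sub>E A" "g' \<in> C \<rightarrow>\<^sub>E A" "g(c := y) = g'(c := y')"
    have "g x = g' x" for x
      using fun_cong[OF *(3), of x] PiE_arb[OF *(1) insert.hyps(2)] PiE_arb[OF *(2) insert.hyps(2)]
      by (cases "x = c") simp_all
    then show "y = y' \<and> g = g'" using fun_cong[OF *(3), of c] by auto
  qed
  have sumset: "(\<Sum>y\<in>#mset_set A. image_mset (\<lambda>g. k y g) (mset_set (C \<rightarrow>\<^sub>E A))) =
      image_mset (\<lambda>(y, g). k y g) (mset_set (A \<times> (C \<rightarrow>\<^sub>E A)))" for k :: "'c \<Rightarrow> ('a \<Rightarrow> 'c) \<Rightarrow> 'b multiset"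
  proof (cases "finite A")
    case True
    have "(\<Sum>y\<in>A. \<Sum>g\<in>C \<rightarrow>\<^sub>E A. {#k y g#}) = (\<Sum>p\<in>A \<times> (C \<rightarrow>\<^sub>E A). {#(case p of (y, g) \<Rightarrow> k y g)#})"
      by (simp add: sum.cartesian_product case_prod_beta')
    then show ?thesis
      by (simp add: sum_unfold_sum_mset)
  next
    case False
    then have "infinite (A \<times> (C \<rightarrow>\<^sub>E A))"
      by (metis PiE_eq_empty_iff empty_iff finite.emptyI finite_cartesian_productD1)
    then show ?thesis using False by simp
  qed
  have "choices (\<lambda>c. image_mset (F c) (mset_set A)) (mset_set (insert c C)) =
      (\<Sum>y\<in>#mset_set A. image_mset (\<lambda>g. add_mset (F c y) (image_mset (\<lambda>c. F c (g c)) (mset_set C)))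
        (mset_set (C \<rightarrow>\<^sub>E A)))"
    using insert by (simp add: multiset.map_comp comp_def)
  also have "\<dots> = image_mset (\<lambda>(y, g). add_mset (F c y) (image_mset (\<lambda>c. F c (g c)) (mset_set C)))
      (mset_set (A \<times> (C \<rightarrow>\<^sub>E A)))"
    by (rule sumset)
  also have "\<dots> = image_mset (\<lambda>p. image_mset (\<lambda>d. F d (?upd p d)) (mset_set (insert c C)))
      (mset_set (A \<times> (C \<rightarrow>\<^sub>E A)))"
  proof (rule image_mset_cong, clarsimp simp: insert.hyps)
    fix y g
    show "{#F x (g x). x \<in># mset_set C#} =
      {#F d (if d = c then y else g d). d \<in># mset_set C#}"
      using insert.hyps by (intro image_mset_cong) auto
  qed
  also have "\<dots> = image_mset (\<lambda>f. image_mset (\<lambda>d. F d (f d)) (mset_set (insert c C)))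
      (mset_set (?upd ` (A \<times> (C \<rightarrow>\<^sub>E A))))"
    by (simp add: image_mset_mset_set[OF inj, symmetric] multiset.map_comp comp_def)
  also have "?upd ` (A \<times> (C \<rightarrow>\<^sub>E A)) = insert c C \<rightarrow>\<^sub>E A"
    by (simp add: PiE_insert_eq)
  finally show ?case .
qed


section \<open>Linear maps and operads given on a basis\<close>

lemma linear_on_lin_ext: "linear_on UNIV f \<Longrightarrow> linear_on UNIV (\<lambda>x. lin_ext F (f x))"
  by (simp add: linear_on_def lin_ext_add lin_ext_scale)

lemma linear_on_bilin_ext_left: "linear_on UNIV f \<Longrightarrow> linear_on UNIV (\<lambda>x. bilin_ext F (f x) y)"
  by (simp add: linear_on_def bilin_ext_def lin_ext_add lin_ext_scale)

lemma linear_on_bilin_ext_right: "linear_on UNIV f \<Longrightarrow> linear_on UNIV (\<lambda>y. bilin_ext F x (f y))"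
  by (simp add: linear_on_def bilin_ext_def lin_ext_add lin_ext_scale
      lin_ext_fun_add lin_ext_fun_scale)

lemma linear_on_ident: "linear_on UNIV (\<lambda>x. x)"
  by (simp add: linear_on_def)

lemma linear_on_compose: "linear_on UNIV f \<Longrightarrow> linear_on UNIV g \<Longrightarrow> linear_on UNIV (\<lambda>x. f (g x))"
  unfolding linear_on_def by auto

lemmas linear_on_intros =
  linear_on_lin_ext linear_on_bilin_ext_left linear_on_bilin_ext_right linear_on_ident

lemma linear_on_subset: "linear_on T f \<Longrightarrow> S \<subseteq> T \<Longrightarrow> linear_on S f"
  unfolding linear_on_def by blast

lemma linear_on_zero: "linear_on UNIV f \<Longrightarrow> f 0 = 0"
  using linear_on_def[of UNIV f, THEN iffD1, THEN conjunct1, rule_format, of 0 0] by simp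

lemma linear_on_sum: "linear_on UNIV f \<Longrightarrow> f (\<Sum>i\<in>A. g i) = (\<Sum>i\<in>A. f (g i))"
  by (induction A rule: infinite_finite_induct) (auto simp: linear_on_zero linear_on_def)

lemma linear_eq_on_span:
  assumes "x \<in> fs.span S" "linear_on UNIV f" "linear_on UNIV g" "\<And>b. b \<in> S \<Longrightarrow> f b = g b"
  shows "f x = g x"
  using assms(1)
proof (induction rule: fs.span_induct_alt)
  case base
  show ?case using assms(2,3) by (simp add: linear_on_zero)
next
  case (step c x y)
  then show ?case using assms(2-4) by (simp add: linear_on_def)
qed

lemma bilinear_eq_on_span:
  assumes "x \<in> fs.span S" "y \<in> fs.span S'"
    and "\<And>y. linear_on UNIV (\<lambda>x. f x y)" "\<And>x. linear_on UNIV (\<lambda>y. f x y)"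
    and "\<And>y. linear_on UNIV (\<lambda>x. g x y)" "\<And>x. linear_on UNIV (\<lambda>y. g x y)"
    and "\<And>a b. a \<in> S \<Longrightarrow> b \<in> S' \<Longrightarrow> f a b = g a b"
  shows "f x y = g x y"
  using linear_eq_on_span[OF assms(1) assms(3)[of y] assms(5)[of y]]
    linear_eq_on_span[OF assms(2) assms(4) assms(6)] assms(7) by blast

lemma trilinear_eq_on_span:
  assumes "x \<in> fs.span S" "y \<in> fs.span S'" "z \<in> fs.span S''"
    and "\<And>y z. linear_on UNIV (\<lambda>x. f x y z)" "\<And>x z. linear_on UNIV (\<lambda>y. f x y z)"
      "\<And>x y. linear_on UNIV (\<lambda>z. f x y z)"
    and "\<And>y z. linear_on UNIV (\<lambda>x. g x y z)" "\<And>x z. linear_on UNIV (\<lambda>y. g x y z)"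
      "\<And>x y. linear_on UNIV (\<lambda>z. g x y z)"
    and "\<And>a b c. a \<in> S \<Longrightarrow> b \<in> S' \<Longrightarrow> c \<in> S'' \<Longrightarrow> f a b c = g a b c"
  shows "f x y z = g x y z"
proof -
  have "f a y z = g a y z" if "a \<in> S" for a
    by (rule bilinear_eq_on_span[OF assms(2,3), where f = "f a" and g = "g a"])
      (use that assms in auto)
  then show ?thesis
    using linear_eq_on_span[OF assms(1) assms(4)[of y z] assms(7)[of y z]] by blast
qed

lemma linear_image_span:
  assumes "x \<in> fs.span S" "linear_on UNIV f" "\<And>b. b \<in> S \<Longrightarrow> f b \<in> T" "fs.subspace T"
  shows "f x \<in> T"
  using assms(1)
proof (induction rule: fs.span_induct_alt)
  case base
  show ?case using assms(2,4) by (simp add: linear_on_zero fs.subspace_0)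
next
  case (step c x y)
  then show ?case using assms(2-4)
    by (simp add: linear_on_def fs.subspace_add fs.subspace_scale)
qed

lemma bilinear_image_span:
  assumes "x \<in> fs.span S" "y \<in> fs.span S'" "\<And>a b. a \<in> S \<Longrightarrow> b \<in> S' \<Longrightarrow> bilin_ext F a b \<in> T"
    and "fs.subspace T"
  shows "bilin_ext F x y \<in> T"
proof -
  have *: "bilin_ext F a y \<in> T" if "a \<in> S" for a
    by (rule linear_image_span[OF assms(2), where f = "bilin_ext F a"])
      (use assms that linear_on_bilin_ext_right[OF linear_on_ident] in auto)
  show ?thesis
    by (rule linear_image_span[OF assms(1), where f = "\<lambda>x. bilin_ext F x y"])
      (use * assms(4) linear_on_bilin_ext_left[OF linear_on_ident] in auto)
qed

lemma bilin_ext_basis [simp]: "bilin_ext F (basis a) (basis b) = F a b"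
  by (simp add: bilin_ext_def)

lemma lin_ext_sum_mset: "lin_ext F (\<Sum>b\<in>#M. g b) = (\<Sum>b\<in>#M. lin_ext F (g b))"
  by (induction M) (auto simp: lin_ext_add)

lemma lin_ext_formal_sum: "lin_ext F (formal_sum M) = (\<Sum>b\<in>#M. F b)"
  by (simp add: formal_sum_def lin_ext_sum_mset)

lemma formal_sum_empty [simp]: "formal_sum {#} = 0"
  by (simp add: formal_sum_def)

lemma formal_sum_add_mset [simp]: "formal_sum (add_mset x M) = basis x + formal_sum M"
  by (simp add: formal_sum_def)

lemma formal_sum_union [simp]: "formal_sum (A + B) = formal_sum A + formal_sum B"
  by (simp add: formal_sum_def)

lemma formal_sum_Sum: "formal_sum (\<Sum>x\<in>#M. f x) = (\<Sum>x\<in>#M. formal_sum (f x))"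
  by (induction M) auto

lemma lin_ext_basis_formal_sum:
  "lin_ext (\<lambda>b. basis (f b)) (formal_sum M) = formal_sum (image_mset f M)"
  by (induction M) (auto simp: lin_ext_add)

lemma bilin_ext_formal_sum_left:
  "bilin_ext (\<lambda>a b. formal_sum (F a b)) (formal_sum M) (basis b) = formal_sum (\<Sum>a\<in>#M. F a b)"
  by (simp add: bilin_ext_def lin_ext_formal_sum formal_sum_Sum)

lemma bilin_ext_formal_sum_right:
  "bilin_ext (\<lambda>a b. formal_sum (F a b)) (basis a) (formal_sum M) = formal_sum (\<Sum>b\<in>#M. F a b)"
  by (simp add: bilin_ext_def lin_ext_formal_sum formal_sum_Sum)

lemma formal_sum_in_span: "(\<And>b. b \<in># M \<Longrightarrow> b \<in> B) \<Longrightarrow> formal_sum M \<in> fs.span (basis ` B)"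
  by (induction M) (auto simp: fs.span_zero intro: fs.span_add fs.span_base)

definition basis_operad ::
  "('v set \<Rightarrow> 'b set) \<Rightarrow> (('v \<Rightarrow> 'v) \<Rightarrow> 'b \<Rightarrow> 'b) \<Rightarrow> ('v \<Rightarrow> 'b) \<Rightarrow>
   ('v set \<Rightarrow> 'v \<Rightarrow> 'v set \<Rightarrow> 'b \<Rightarrow> 'b \<Rightarrow> 'b multiset) \<Rightarrow> ('v, 'b, 'k::field) operad_data" where
  "basis_operad B T u C =
     \<lparr> space = (\<lambda>V. fs.span (basis ` B V)),
       transport = (\<lambda>V \<sigma>. lin_ext (\<lambda>b. basis (T \<sigma> b))),
       unit = (\<lambda>v. basis (u v)),
       pcomp = (\<lambda>V1 s V2. bilin_ext (\<lambda>a b. formal_sum (C V1 s V2 a b))) \<rparr>"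

locale operad_basis =
  fixes B :: "'v set \<Rightarrow> 'b set" and T :: "('v \<Rightarrow> 'v) \<Rightarrow> 'b \<Rightarrow> 'b" and u :: "'v \<Rightarrow> 'b"
    and C :: "'v set \<Rightarrow> 'v \<Rightarrow> 'v set \<Rightarrow> 'b \<Rightarrow> 'b \<Rightarrow> 'b multiset"
  assumes basis_empty: "B {} = {}"
    and transport_closed: "\<And>V \<sigma> b. finite V \<Longrightarrow> inj_on \<sigma> V \<Longrightarrow> b \<in> B V \<Longrightarrow> T \<sigma> b \<in> B (\<sigma> ` V)"
    and transport_cong: "\<And>V \<sigma> \<tau> b. finite V \<Longrightarrow> (\<forall>v\<in>V. \<sigma> v = \<tau> v) \<Longrightarrow> b \<in> B V \<Longrightarrow> T \<sigma> b = T \<tau> b"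
    and transport_id: "\<And>b. T id b = b"
    and transport_comp: "\<And>\<sigma> \<tau> b. T \<tau> (T \<sigma> b) = T (\<tau> \<circ> \<sigma>) b"
    and unit_closed: "\<And>v. u v \<in> B {v}"
    and unit_natural: "\<And>\<sigma> v. T \<sigma> (u v) = u (\<sigma> v)"
    and comp_closed: "\<And>V1 s V2 a b c. composable V1 s V2 \<Longrightarrow> a \<in> B (insert s V1) \<Longrightarrow> b \<in> B V2 \<Longrightarrow>
      c \<in># C V1 s V2 a b \<Longrightarrow> c \<in> B (V1 \<union> V2)"
    and comp_natural: "\<And>V1 s V2 \<sigma> \<tau> \<rho> a b. composable V1 s V2 \<Longrightarrow> inj_on \<sigma> (insert s V1) \<Longrightarrow>
      inj_on \<tau> V2 \<Longrightarrow> inj_on \<rho> (V1 \<union> V2) \<Longrightarrow> \<forall>v\<in>V1. \<rho> v = \<sigma> v \<Longrightarrow> \<forall>v\<in>V2. \<rho> v = \<tau> v \<Longrightarrow>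
      a \<in> B (insert s V1) \<Longrightarrow> b \<in> B V2 \<Longrightarrow>
      image_mset (T \<rho>) (C V1 s V2 a b) = C (\<sigma> ` V1) (\<sigma> s) (\<tau> ` V2) (T \<sigma> a) (T \<tau> b)"
    and unit_left: "\<And>V s b. finite V \<Longrightarrow> b \<in> B V \<Longrightarrow> C {} s V (u s) b = {#b#}"
    and unit_right: "\<And>V1 s v a. composable V1 s {v} \<Longrightarrow> a \<in> B (insert s V1) \<Longrightarrow>
      C V1 s {v} a (u v) = {#T (id(s := v)) a#}"
    and comp_parallel: "\<And>V1 V2 V3 s t a b c.
      finite V1 \<and> finite V2 \<and> finite V3 \<and> V1 \<inter> V2 = {} \<and> V1 \<inter> V3 = {} \<and> V2 \<inter> V3 = {} \<and>
      s \<noteq> t \<and> s \<notin> V1 \<union> V3 \<and> t \<notin> V1 \<union> V2 \<Longrightarrow>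
      a \<in> B (insert s (insert t V1)) \<Longrightarrow> b \<in> B V2 \<Longrightarrow> c \<in> B V3 \<Longrightarrow>
      (\<Sum>d\<in>#C (insert t V1) s V2 a b. C (V1 \<union> V2) t V3 d c) =
      (\<Sum>d\<in>#C (insert s V1) t V3 a c. C (V1 \<union> V3) s V2 d b)"
    and comp_sequential: "\<And>V1 V2 V3 s t a b c.
      finite V1 \<and> finite V2 \<and> finite V3 \<and> V1 \<inter> V2 = {} \<and> V1 \<inter> V3 = {} \<and> V2 \<inter> V3 = {} \<and>
      s \<notin> V1 \<and> t \<notin> V1 \<union> V2 \<Longrightarrow>
      a \<in> B (insert s V1) \<Longrightarrow> b \<in> B (insert t V2) \<Longrightarrow> c \<in> B V3 \<Longrightarrow>
      (\<Sum>d\<in>#C V1 s (insert t V2) a b. C (V1 \<union> V2) t V3 d c) =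
      (\<Sum>d\<in>#C V2 t V3 b c. C V1 s (V2 \<union> V3) a d)"
begin

lemma operad: "operad (basis_operad B T u C :: ('v, 'b, 'k::field) operad_data)"
  (is "operad ?Q")
proof -
  have sp: "space ?Q V = fs.span (basis ` B V)" for V by (simp add: basis_operad_def)
  have tr: "transport ?Q V \<sigma> = lin_ext (\<lambda>b. basis (T \<sigma> b))" for V \<sigma> by (simp add: basis_operad_def)
  have un: "unit ?Q v = basis (u v)" for v by (simp add: basis_operad_def)
  have pc: "pcomp ?Q V1 s V2 = bilin_ext (\<lambda>a b. formal_sum (C V1 s V2 a b))" for V1 s V2
    by (simp add: basis_operad_def)
  have spec: "species ?Q"
    unfolding species_def sp tr
  proof (intro conjI allI impI ballI, goal_cases)
    case (1 V) show ?case by simp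
  next
    case (2 V \<sigma>) show ?case by (rule lin_ext_linear_on)
  next
    case (3 V \<sigma>)
    have "lin_ext (\<lambda>b. basis (T \<sigma> b)) x \<in> fs.span (basis ` B (\<sigma> ` V))"
      if "x \<in> fs.span (basis ` B V)" for x :: "'b \<Rightarrow>\<^sub>0 'k"
      by (rule linear_image_span[OF that linear_on_lin_ext[OF linear_on_ident]])
        (use 3 transport_closed in \<open>auto intro: fs.span_base\<close>)
    then show ?case by blast
  next
    case (4 V \<sigma> \<tau> x)
    then show ?case
      by (intro linear_eq_on_span[OF 4(2) lin_ext_linear_on lin_ext_linear_on])
        (auto dest: transport_cong)
  next
    case (5 V x) then show ?case by (simp add: transport_id basis_expansion)
  next
    case (6 V \<sigma> \<tau> x) then show ?case by (simp add: lin_ext_comp transport_comp)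
  qed
  have lin: "linear_on UNIV (\<lambda>y. bilin_ext F x y)" "linear_on UNIV (\<lambda>x. bilin_ext F x y)"
    for F :: "'b \<Rightarrow> 'b \<Rightarrow> 'b \<Rightarrow>\<^sub>0 'k" and x y
    by (intro linear_on_intros)+
  show ?thesis
    unfolding operad_def
  proof (intro conjI allI impI ballI, unfold sp tr un pc, goal_cases)
    case 1 show ?case by (rule spec)
  next
    case 2 show ?case by (simp add: basis_empty)
  next
    case (3 v) show ?case by (intro fs.span_base imageI unit_closed)
  next
    case (4 V1 s V2 x y)
    show ?case
      by (rule bilinear_image_span[OF 4(2,3)])
        (auto intro!: formal_sum_in_span comp_closed[OF 4(1)])
  next
    case (5 V1 s V2 x)
    show ?case by (rule linear_on_subset[OF lin(1)]) simp
  next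
    case (6 V1 s V2 y)
    show ?case by (rule linear_on_subset[OF lin(2)]) simp
  next
    case (7 v \<sigma>) show ?case by (simp add: unit_natural)
  next
    case (8 V1 s V2 \<sigma> \<tau> \<rho> x y)
    show ?case
      by (rule bilinear_eq_on_span[OF 8(2,3), where
          f = "\<lambda>x y. lin_ext (\<lambda>b. basis (T \<rho> b)) (bilin_ext (\<lambda>a b. formal_sum (C V1 s V2 a b)) x y)" and
          g = "\<lambda>x y. bilin_ext (\<lambda>a b. formal_sum (C (\<sigma> ` V1) (\<sigma> s) (\<tau> ` V2) a b))
            (lin_ext (\<lambda>b. basis (T \<sigma> b)) x) (lin_ext (\<lambda>b. basis (T \<tau> b)) y)"];
        ((rule linear_on_intros)+)?)
        (use 8(1) in \<open>auto simp: lin_ext_basis_formal_sum comp_natural[of V1 s V2 \<sigma> \<tau> \<rho>]\<close>)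
  next
    case (9 V s y)
    show ?case
      by (rule linear_eq_on_span[OF 9(2) lin(1) linear_on_ident])
        (use 9(1) in \<open>auto simp: unit_left\<close>)
  next
    case (10 V1 s v x)
    show ?case
      by (rule linear_eq_on_span[OF 10(2) lin(2) linear_on_lin_ext[OF linear_on_ident]])
        (use 10(1) in \<open>auto simp: unit_right\<close>)
  next
    case (11 V1 V2 V3 s t x y z)
    let ?L = "\<lambda>x y z. bilin_ext (\<lambda>a b. formal_sum (C (V1 \<union> V2) t V3 a b))
       (bilin_ext (\<lambda>a b. formal_sum (C (insert t V1) s V2 a b)) x y) z :: 'b \<Rightarrow>\<^sub>0 'k"
    let ?R = "\<lambda>x y z. bilin_ext (\<lambda>a b. formal_sum (C (V1 \<union> V3) s V2 a b))
       (bilin_ext (\<lambda>a b. formal_sum (C (insert s V1) t V3 a b)) x z) y :: 'b \<Rightarrow>\<^sub>0 'k"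
    show ?case
      by (rule trilinear_eq_on_span[OF 11(2-4), where f = ?L and g = ?R];
        ((rule linear_on_intros)+)?)
        (use comp_parallel[OF 11(1)] in \<open>auto simp: bilin_ext_formal_sum_left\<close>)
  next
    case (12 V1 V2 V3 s t x y z)
    let ?L = "\<lambda>x y z. bilin_ext (\<lambda>a b. formal_sum (C (V1 \<union> V2) t V3 a b))
       (bilin_ext (\<lambda>a b. formal_sum (C V1 s (insert t V2) a b)) x y) z :: 'b \<Rightarrow>\<^sub>0 'k"
    let ?R = "\<lambda>x y z. bilin_ext (\<lambda>a b. formal_sum (C V1 s (V2 \<union> V3) a b)) x
       (bilin_ext (\<lambda>a b. formal_sum (C V2 t V3 a b)) y z) :: 'b \<Rightarrow>\<^sub>0 'k"
    show ?case
      by (rule trilinear_eq_on_span[OF 12(2-4), where f = ?L and g = ?R];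
        ((rule linear_on_intros)+)?)
        (use comp_sequential[OF 12(1)] in
          \<open>auto simp: bilin_ext_formal_sum_left bilin_ext_formal_sum_right\<close>)
  qed
qed

end

lemmas species_transport = species_def[THEN iffD1, THEN conjunct2, THEN conjunct1, rule_format]
lemmas species_transport_cong = species_def[THEN iffD1, THEN conjunct2, THEN conjunct2, THEN conjunct1, rule_format]
lemmas species_transport_id = species_def[THEN iffD1, THEN conjunct2, THEN conjunct2, THEN conjunct2, THEN conjunct1, rule_format]
lemmas species_transport_comp = species_def[THEN iffD1, THEN conjunct2, THEN conjunct2, THEN conjunct2, THEN conjunct2, rule_format]

lemmas operad_species = operad_def[THEN iffD1, THEN conjunct1]
lemmas operad_space_empty = operad_def[THEN iffD1, THEN conjunct2, THEN conjunct1]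
lemmas operad_unit_closed = operad_def[THEN iffD1, THEN conjunct2, THEN conjunct2, THEN conjunct1, rule_format]
lemmas operad_comp_closed = operad_def[THEN iffD1, THEN conjunct2, THEN conjunct2, THEN conjunct2, THEN conjunct1, rule_format, THEN conjunct1, rule_format]
lemmas operad_comp_linear = operad_def[THEN iffD1, THEN conjunct2, THEN conjunct2, THEN conjunct2, THEN conjunct1, rule_format, THEN conjunct2]
lemmas operad_unit_natural = operad_def[THEN iffD1, THEN conjunct2, THEN conjunct2, THEN conjunct2, THEN conjunct2, THEN conjunct1, rule_format]
lemmas operad_comp_natural = operad_def[THEN iffD1, THEN conjunct2, THEN conjunct2, THEN conjunct2, THEN conjunct2, THEN conjunct2, THEN conjunct1, rule_format]
lemmas operad_unit_left = operad_def[THEN iffD1, THEN conjunct2, THEN conjunct2, THEN conjunct2, THEN conjunct2, THEN conjunct2, THEN conjunct2, THEN conjunct1, rule_format]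
lemmas operad_unit_right = operad_def[THEN iffD1, THEN conjunct2, THEN conjunct2, THEN conjunct2, THEN conjunct2, THEN conjunct2, THEN conjunct2, THEN conjunct2, THEN conjunct1, rule_format]
lemmas operad_parallel = operad_def[THEN iffD1, THEN conjunct2, THEN conjunct2, THEN conjunct2, THEN conjunct2, THEN conjunct2, THEN conjunct2, THEN conjunct2, THEN conjunct2, THEN conjunct1, rule_format]
lemmas operad_sequential = operad_def[THEN iffD1, THEN conjunct2, THEN conjunct2, THEN conjunct2, THEN conjunct2, THEN conjunct2, THEN conjunct2, THEN conjunct2, THEN conjunct2, THEN conjunct2, rule_format]

lemma operad_restrict_suboperad:
  assumes "suboperad S Q"
  shows "operad (restrict_to Q S)"
proof -
  have Q: "operad Q" and S: "subspecies S Q" "\<And>v. unit Q v \<in> S {v}"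
    and c: "\<And>V1 s V2 x y. composable V1 s V2 \<Longrightarrow> x \<in> S (insert s V1) \<Longrightarrow> y \<in> S V2 \<Longrightarrow>
        pcomp Q V1 s V2 x y \<in> S (V1 \<union> V2)"
    using assms unfolding suboperad_def by auto
  have sub: "fs.subspace (S V)" "S V \<subseteq> space Q V" if "finite V" for V
    using S(1) that unfolding subspecies_def by auto
  have subD: "x \<in> space Q V" if "finite V" "x \<in> S V" for x V
    using sub that by blast
  have tr: "transport Q V \<sigma> x \<in> S (\<sigma> ` V)" if "finite V" "inj_on \<sigma> V" "x \<in> S V" for V \<sigma> x
    using S(1) that unfolding subspecies_def by blast
  note sp = operad_species[OF Q]
  have sp_restrict: "species (restrict_to Q S)"
    unfolding species_def
  proof (intro conjI allI impI ballI, simp_all, goal_cases)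
    case (1 V) then show ?case by (rule sub)
  next
    case (2 V \<sigma>) then show ?case
      using species_transport[OF sp, of V \<sigma>] sub(2)[of V]
      by (auto intro: linear_on_subset[of "space Q V"])
  next
    case (3 V \<sigma>) then show ?case by (auto intro: tr)
  next
    case (4 V \<sigma> \<tau> x) then show ?case
      by (intro species_transport_cong[OF sp, of V] subD) auto
  next
    case (5 V x) then show ?case
      by (intro species_transport_id[OF sp] subD)
  next
    case (6 V \<sigma> \<tau> x) then show ?case
      by (intro species_transport_comp[OF sp] subD) auto
  qed
  have fin: "finite V1" "finite V2" if "composable V1 s V2" for V1 V2 s
    using that by (auto simp: composable_def)
  have restr: "space (restrict_to Q S) = S" "transport (restrict_to Q S) = transport Q"
    "unit (restrict_to Q S) = unit Q" "pcomp (restrict_to Q S) = pcomp Q"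
    by simp_all
  show ?thesis
    unfolding operad_def
  proof (intro conjI allI impI ballI, unfold restr, goal_cases)
    case 1 show ?case by (rule sp_restrict)
  next
    case 2 show ?case
      using operad_space_empty[OF Q] sub(2)[of "{}"] fs.subspace_0[OF sub(1)[of "{}"]] by auto
  next
    case (3 v) show ?case by (rule S(2))
  next
    case (4 V1 s V2 x y) then show ?case by (rule c)
  next
    case (5 V1 s V2 x)
    then have "linear_on (space Q V2) (pcomp Q V1 s V2 x)"
      using operad_comp_linear[OF Q 5(1)] subD[of "insert s V1" x] fin[OF 5(1)] by auto
    then show ?case by (rule linear_on_subset) (use sub(2)[of V2] fin(2)[OF 5(1)] in simp)
  next
    case (6 V1 s V2 y)
    then have "linear_on (space Q (insert s V1)) (\<lambda>x. pcomp Q V1 s V2 x y)"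
      using operad_comp_linear[OF Q 6(1)] subD[of V2 y] fin[OF 6(1)] by auto
    then show ?case by (rule linear_on_subset) (use sub(2)[of "insert s V1"] fin(1)[OF 6(1)] in simp)
  next
    case (7 v \<sigma>) then show ?case by (rule operad_unit_natural[OF Q])
  next
    case (8 V1 s V2 \<sigma> \<tau> \<rho> x y)
    then show ?case by (intro operad_comp_natural[OF Q] subD) (auto intro: fin)
  next
    case (9 V s y) then show ?case by (intro operad_unit_left[OF Q] subD)
  next
    case (10 V1 s v x) then show ?case by (intro operad_unit_right[OF Q] subD) (auto intro: fin)
  next
    case (11 V1 V2 V3 s t x y z) then show ?case by (intro operad_parallel[OF Q] subD) auto
  next
    case (12 V1 V2 V3 s t x y z) then show ?case by (intro operad_sequential[OF Q] subD) auto
  qed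
qed

lemma operad_isomorphic_transfer:
  fixes P :: "('v, 'b, 'k::field) operad_data" and Q :: "('v, 'c, 'k) operad_data"
  assumes P: "operad P"
    and sub: "\<And>V. finite V \<Longrightarrow> fs.subspace (space Q V)"
    and lin_transport: "\<And>V \<sigma>. linear_on UNIV (transport Q V \<sigma>)"
    and lin_comp: "\<And>V1 s V2 x. linear_on UNIV (\<lambda>y. pcomp Q V1 s V2 x y)"
      "\<And>V1 s V2 y. linear_on UNIV (\<lambda>x. pcomp Q V1 s V2 x y)"
    and lin: "linear_on UNIV \<phi>"
    and bij: "\<And>V. finite V \<Longrightarrow> bij_betw \<phi> (space P V) (space Q V)"
    and tr: "\<And>V \<sigma> x. finite V \<Longrightarrow> inj_on \<sigma> V \<Longrightarrow> x \<in> space P V \<Longrightarrow>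
      \<phi> (transport P V \<sigma> x) = transport Q V \<sigma> (\<phi> x)"
    and un: "\<And>v. \<phi> (unit P v) = unit Q v"
    and pc: "\<And>V1 s V2 x y. composable V1 s V2 \<Longrightarrow> x \<in> space P (insert s V1) \<Longrightarrow> y \<in> space P V2 \<Longrightarrow>
      \<phi> (pcomp P V1 s V2 x y) = pcomp Q V1 s V2 (\<phi> x) (\<phi> y)"
  shows "operad_isomorphic P Q"
proof -
  note sp = operad_species[OF P]
  have img: "finite V \<Longrightarrow> space Q V = \<phi> ` space P V" for V
    using bij by (auto simp: bij_betw_def)
  have mem: "finite V \<Longrightarrow> x \<in> space P V \<Longrightarrow> \<phi> x \<in> space Q V" for V x
    by (simp add: img)
  have pre: "\<exists>x\<in>space P V. y = \<phi> x" if "finite V" "y \<in> space Q V" for V y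
    using that img by auto
  have trP: "transport P V \<sigma> x \<in> space P (\<sigma> ` V)" if "finite V" "inj_on \<sigma> V" "x \<in> space P V" for V \<sigma> x
    using species_transport[OF sp, of V \<sigma>] that by auto
  have fin: "finite V1" "finite V2" if "composable V1 s V2" for V1 V2 s
    using that by (auto simp: composable_def)
  have spQ: "species Q"
    unfolding species_def
  proof (intro conjI allI impI ballI, goal_cases)
    case (1 V) then show ?case by (rule sub)
  next
    case (2 V \<sigma>) show ?case by (rule linear_on_subset[OF lin_transport]) simp
  next
    case (3 V \<sigma>)
    then show ?case by (auto simp: img tr[symmetric] intro!: imageI trP)
  next
    case (4 V \<sigma> \<tau> x)
    then obtain y where y: "y \<in> space P V" "x = \<phi> y" using pre by blast
    have "inj_on \<tau> V" using 4(1) by (auto simp: inj_on_def)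
    then show ?case using 4 y species_transport_cong[OF sp 4(1) y(1)] by (simp add: tr[symmetric])
  next
    case (5 V x)
    then obtain y where "y \<in> space P V" "x = \<phi> y" using pre by blast
    then show ?case using 5(1) species_transport_id[OF sp 5(1)] by (simp add: tr[symmetric])
  next
    case (6 V \<sigma> \<tau> x)
    then obtain y where y: "y \<in> space P V" "x = \<phi> y" using pre by blast
    have "inj_on (\<tau> \<circ> \<sigma>) V" using 6(1) by (simp add: comp_inj_on)
    then show ?case using 6 y species_transport_comp[OF sp 6(1) y(1)]
      by (simp add: tr[symmetric] trP)
  qed
  have "operad Q"
    unfolding operad_def
  proof (intro conjI allI impI ballI, goal_cases)
    case 1 show ?case by (rule spQ)
  next
    case 2 show ?case using operad_space_empty[OF P] by (simp add: img linear_on_zero[OF lin])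
  next
    case (3 v) show ?case by (auto simp: un[symmetric] intro!: mem operad_unit_closed[OF P])
  next
    case (4 V1 s V2 x y)
    then obtain a b where ab: "a \<in> space P (insert s V1)" "x = \<phi> a" "b \<in> space P V2" "y = \<phi> b"
      using pre[of "insert s V1" x] pre[of V2 y] fin[OF 4(1)] by auto
    show ?case using operad_comp_closed[OF P 4(1) ab(1,3)] fin[OF 4(1)]
      unfolding ab(2,4) pc[OF 4(1) ab(1,3), symmetric] by (intro mem) auto
  next
    case (5 V1 s V2 x) show ?case by (rule linear_on_subset[OF lin_comp(1)]) simp
  next
    case (6 V1 s V2 y) show ?case by (rule linear_on_subset[OF lin_comp(2)]) simp
  next
    case (7 v \<sigma>)
    show ?case using operad_unit_natural[OF P, of v \<sigma>] operad_unit_closed[OF P, of v]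
      by (simp add: un[symmetric] tr[symmetric])
  next
    case (8 V1 s V2 \<sigma> \<tau> \<rho> x y)
    then have c: "composable V1 s V2" by simp
    obtain a b where ab: "a \<in> space P (insert s V1)" "x = \<phi> a" "b \<in> space P V2" "y = \<phi> b"
      using pre[of "insert s V1" x] pre[of V2 y] fin[OF c] 8 by auto
    have c': "composable (\<sigma> ` V1) (\<sigma> s) (\<tau> ` V2)"
    proof -
      have "\<sigma> ` V1 = \<rho> ` V1" "\<tau> ` V2 = \<rho> ` V2" using 8(1) by (auto simp: image_iff)
      moreover have "\<rho> ` V1 \<inter> \<rho> ` V2 = \<rho> ` (V1 \<inter> V2)"
        using 8(1) by (intro inj_on_image_Int[symmetric, of _ "V1 \<union> V2"]) auto
      moreover have "\<sigma> s \<notin> \<sigma> ` V1" using 8(1) by (auto simp: composable_def inj_on_def)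
      ultimately show ?thesis using c by (auto simp: composable_def)
    qed
    have tra: "transport P (insert s V1) \<sigma> a \<in> space P (insert (\<sigma> s) (\<sigma> ` V1))"
      using trP[OF _ _ ab(1), of \<sigma>] 8(1) fin[OF c] by simp
    have trb: "transport P V2 \<tau> b \<in> space P (\<tau> ` V2)"
      using trP[OF _ _ ab(3), of \<tau>] 8(1) fin[OF c] by simp
    have "transport Q (V1 \<union> V2) \<rho> (pcomp Q V1 s V2 x y) =
        \<phi> (transport P (V1 \<union> V2) \<rho> (pcomp P V1 s V2 a b))"
      unfolding ab(2,4) pc[OF c ab(1,3), symmetric]
      using 8(1) fin[OF c] operad_comp_closed[OF P c ab(1,3)] by (intro tr[symmetric]) auto
    also have "\<dots> = \<phi> (pcomp P (\<sigma> ` V1) (\<sigma> s) (\<tau> ` V2) (transport P (insert s V1) \<sigma> a) (transport P V2 \<tau> b))"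
      using operad_comp_natural[OF P 8(1) ab(1,3)] by simp
    also have "\<dots> = pcomp Q (\<sigma> ` V1) (\<sigma> s) (\<tau> ` V2) (transport Q (insert s V1) \<sigma> x) (transport Q V2 \<tau> y)"
      using 8(1) fin[OF c] ab by (simp add: pc[OF c' tra trb] tr)
    finally show ?case .
  next
    case (9 V s y)
    then obtain b where b: "b \<in> space P V" "y = \<phi> b" using pre by blast
    have "composable {} s V" using 9 by (simp add: composable_def)
    from pc[OF this operad_unit_closed[OF P] b(1)] show ?case
      using operad_unit_left[OF P 9(1) b(1), of s] by (simp add: un b)
  next
    case (10 V1 s v x)
    then obtain a where a: "a \<in> space P (insert s V1)" "x = \<phi> a"
      using pre[of "insert s V1" x] fin[OF 10(1)] by auto
    have "inj_on (id(s := v)) (insert s V1)" using 10(1) by (auto simp: composable_def inj_on_def)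
    then show ?case
      using pc[OF 10(1) a(1) operad_unit_closed[OF P]] operad_unit_right[OF P 10(1) a(1)] fin[OF 10(1)]
      by (simp add: un a tr[OF _ _ a(1)])
  next
    case (11 V1 V2 V3 s t x y z)
    obtain a where a: "a \<in> space P (insert s (insert t V1))" "x = \<phi> a"
      using pre[of "insert s (insert t V1)" x] 11 by auto
    obtain b where b: "b \<in> space P V2" "y = \<phi> b" using pre[of V2 y] 11 by auto
    obtain c where c: "c \<in> space P V3" "z = \<phi> c" using pre[of V3 z] 11 by auto
    have comps: "composable (insert t V1) s V2" "composable (insert s V1) t V3"
      "composable (V1 \<union> V2) t V3" "composable (V1 \<union> V3) s V2"
      using 11(1) by (auto simp: composable_def)
    have a': "a \<in> space P (insert t (insert s V1))" using a(1) by (simp add: insert_commute)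
    have ab: "pcomp P (insert t V1) s V2 a b \<in> space P (insert t (V1 \<union> V2))"
      using operad_comp_closed[OF P comps(1) a(1) b(1)] by simp
    have ac: "pcomp P (insert s V1) t V3 a c \<in> space P (insert s (V1 \<union> V3))"
      using operad_comp_closed[OF P comps(2) a' c(1)] by simp
    show ?case
      using operad_parallel[OF P 11(1) a(1) b(1) c(1)]
      unfolding a(2) b(2) c(2) pc[OF comps(1) a(1) b(1), symmetric] pc[OF comps(2) a' c(1), symmetric]
        pc[OF comps(3) ab c(1), symmetric] pc[OF comps(4) ac b(1), symmetric] by simp
  next
    case (12 V1 V2 V3 s t x y z)
    obtain a where a: "a \<in> space P (insert s V1)" "x = \<phi> a"
      using pre[of "insert s V1" x] 12 by auto
    obtain b where b: "b \<in> space P (insert t V2)" "y = \<phi> b" using pre[of "insert t V2" y] 12 by auto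
    obtain c where c: "c \<in> space P V3" "z = \<phi> c" using pre[of V3 z] 12 by auto
    have comps: "composable V1 s (insert t V2)" "composable V2 t V3"
      "composable (V1 \<union> V2) t V3" "composable V1 s (V2 \<union> V3)" if "t \<notin> V1"
      using 12(1) that by (auto simp: composable_def)
    have t: "t \<notin> V1" using 12(1) by simp
    have ab: "pcomp P V1 s (insert t V2) a b \<in> space P (insert t (V1 \<union> V2))"
      using operad_comp_closed[OF P comps(1)[OF t] a(1) b(1)] by simp
    have bc: "pcomp P V2 t V3 b c \<in> space P (V2 \<union> V3)"
      using operad_comp_closed[OF P comps(2)[OF t] b(1) c(1)] by simp
    show ?case
      using operad_sequential[OF P 12(1) a(1) b(1) c(1)]
      unfolding a(2) b(2) c(2) pc[OF comps(1)[OF t] a(1) b(1), symmetric]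
        pc[OF comps(2)[OF t] b(1) c(1), symmetric]
        pc[OF comps(3)[OF t] ab c(1), symmetric] pc[OF comps(4)[OF t] a(1) bc, symmetric] by simp
  qed
  then show ?thesis
    unfolding operad_isomorphic_def using P lin bij tr un pc
    by (auto intro!: exI[of _ "\<lambda>_. \<phi>"] intro: linear_on_subset)
qed

lemma suboperad_basis_operad:
  assumes Q: "operad (basis_operad B T u C :: ('v, 'b, 'k::field) operad_data)"
    and S: "\<And>V. finite V \<Longrightarrow> S V = fs.span (basis ` B' V)"
    and sub: "\<And>V. finite V \<Longrightarrow> B' V \<subseteq> B V"
    and tr: "\<And>V \<sigma> b. finite V \<Longrightarrow> inj_on \<sigma> V \<Longrightarrow> b \<in> B' V \<Longrightarrow> T \<sigma> b \<in> B' (\<sigma> ` V)"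
    and un: "\<And>v. u v \<in> B' {v}"
    and pc: "\<And>V1 s V2 a b c. composable V1 s V2 \<Longrightarrow> a \<in> B' (insert s V1) \<Longrightarrow> b \<in> B' V2 \<Longrightarrow>
      c \<in># C V1 s V2 a b \<Longrightarrow> c \<in> B' (V1 \<union> V2)"
  shows "suboperad S (basis_operad B T u C :: ('v, 'b, 'k) operad_data)"
proof -
  have "lin_ext (\<lambda>b. basis (T \<sigma> b)) x \<in> S (\<sigma> ` V)" if "finite V" "inj_on \<sigma> V" "x \<in> S V" for V \<sigma> x
    by (rule linear_image_span[OF that(3)[unfolded S[OF that(1)]] linear_on_lin_ext[OF linear_on_ident]])
      (use that in \<open>auto simp: S intro!: fs.span_base tr\<close>)
  then have "subspecies S (basis_operad B T u C :: ('v, 'b, 'k) operad_data)"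
    unfolding subspecies_def
    by (auto simp: basis_operad_def S intro: subsetD[OF fs.span_mono[OF image_mono[OF sub]]])
  moreover have "bilin_ext (\<lambda>a b. formal_sum (C V1 s V2 a b)) x y \<in> S (V1 \<union> V2)"
    if "composable V1 s V2" "x \<in> S (insert s V1)" "y \<in> S V2" for V1 s V2 x y
  proof -
    have fin: "finite V1" "finite V2" using that(1) by (auto simp: composable_def)
    show ?thesis
      by (rule bilinear_image_span[where S = "basis ` B' (insert s V1)" and S' = "basis ` B' V2"])
        (use that fin in \<open>auto simp: S intro!: formal_sum_in_span pc[OF that(1)]\<close>)
  qed
  ultimately show ?thesis
    using Q un unfolding suboperad_def by (auto simp: basis_operad_def S intro: fs.span_base)
qed

lemma bij_betw_span_basis:
  assumes "inj_on f B"
  shows "bij_betw (lin_ext (\<lambda>b. basis (f b)) :: _ \<Rightarrow> ('c \<Rightarrow>\<^sub>0 'k::field))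
    (fs.span (basis ` B)) (fs.span (basis ` f ` B))"
proof (rule bij_betw_byWitness[where f' = "lin_ext (\<lambda>c. basis (inv_into B f c))"])
  show "\<forall>x\<in>fs.span (basis ` B). lin_ext (\<lambda>c. basis (inv_into B f c)) (lin_ext (\<lambda>b. basis (f b)) x) = (x :: _ \<Rightarrow>\<^sub>0 'k)"
    by (intro ballI, rule linear_eq_on_span[OF _ _ linear_on_ident, where f = "\<lambda>x. lin_ext _ (lin_ext _ x)"])
      (use assms in \<open>auto intro!: linear_on_intros\<close>)
  show "\<forall>x\<in>fs.span (basis ` f ` B). lin_ext (\<lambda>b. basis (f b)) (lin_ext (\<lambda>c. basis (inv_into B f c)) x) = (x :: _ \<Rightarrow>\<^sub>0 'k)"
    by (intro ballI, rule linear_eq_on_span[OF _ _ linear_on_ident, where f = "\<lambda>x. lin_ext _ (lin_ext _ x)"])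
      (use assms in \<open>auto intro!: linear_on_intros simp: f_inv_into_f\<close>)
  show "lin_ext (\<lambda>b. basis (f b)) ` fs.span (basis ` B) \<subseteq> (fs.span (basis ` f ` B) :: ('c \<Rightarrow>\<^sub>0 'k) set)"
    by (intro image_subsetI, rule linear_image_span[OF _ linear_on_lin_ext[OF linear_on_ident]])
      (auto intro: fs.span_base)
  show "lin_ext (\<lambda>c. basis (inv_into B f c)) ` fs.span (basis ` f ` B) \<subseteq> (fs.span (basis ` B) :: (_ \<Rightarrow>\<^sub>0 'k) set)"
    by (intro image_subsetI, rule linear_image_span[OF _ linear_on_lin_ext[OF linear_on_ident]])
      (use assms in \<open>auto intro!: fs.span_base\<close>)
qed

lemma tensor_basis [simp]: "basis a \<otimes>\<^sub>v basis b = basis (a, b)"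
  by (simp add: tensor_def)

lemma tensor_formal_sum:
  "formal_sum A \<otimes>\<^sub>v formal_sum B = formal_sum (\<Sum>a\<in>#A. image_mset (Pair a) B)"
  by (simp add: tensor_def bilin_ext_def lin_ext_formal_sum formal_sum_Sum)
    (simp add: formal_sum_def multiset.map_comp comp_def)

lemma span_tensor_basis:
  "fs.span {x \<otimes>\<^sub>v y | x y. x \<in> fs.span (basis ` A) \<and> y \<in> fs.span (basis ` B)} =
     (fs.span (basis ` (A \<times> B)) :: (_ \<Rightarrow>\<^sub>0 'k::field) set)"
proof (rule antisym)
  have "x \<otimes>\<^sub>v y \<in> fs.span (basis ` (A \<times> B))"
    if "x \<in> fs.span (basis ` A)" "y \<in> fs.span (basis ` B)" for x y :: "_ \<Rightarrow>\<^sub>0 'k"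
    unfolding tensor_def
    by (rule bilinear_image_span[OF that]) (auto intro: fs.span_base)
  then show "fs.span {x \<otimes>\<^sub>v y | x y. x \<in> fs.span (basis ` A) \<and> y \<in> fs.span (basis ` B)} \<subseteq>
      (fs.span (basis ` (A \<times> B)) :: (_ \<Rightarrow>\<^sub>0 'k) set)"
    by (intro fs.span_minimal) auto
  show "(fs.span (basis ` (A \<times> B)) :: (_ \<Rightarrow>\<^sub>0 'k) set) \<subseteq>
      fs.span {x \<otimes>\<^sub>v y | x y. x \<in> fs.span (basis ` A) \<and> y \<in> fs.span (basis ` B)}"
  proof (intro fs.span_mono subsetI)
    fix z :: "_ \<Rightarrow>\<^sub>0 'k" assume "z \<in> basis ` (A \<times> B)"
    then obtain a b where "a \<in> A" "b \<in> B" "z = basis a \<otimes>\<^sub>v basis b" by auto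
    then show "z \<in> {x \<otimes>\<^sub>v y | x y. x \<in> fs.span (basis ` A) \<and> y \<in> fs.span (basis ` B)}"
      by (blast intro: fs.span_base)
  qed
qed

section \<open>The operad of rooted oriented connected multigraphs\<close>

definition reconnect :: "'v \<Rightarrow> 'v set \<Rightarrow> 'v \<Rightarrow> end_label \<times> 'v \<Rightarrow> (end_label \<times> 'v) multiset" where
  "reconnect s V r = (\<lambda>(l, v). if v \<noteq> s then {#(l, v)#}
     else case l of Source \<Rightarrow> {#(Source, r)#} | Target \<Rightarrow> {#(Target, u). u \<in># mset_set V#})"

lemma reconnect_Source:
  "reconnect s V r (Source, v) = (if v = s then {#(Source, r)#} else {#(Source, v)#})"
  by (simp add: reconnect_def)

lemma reconnect_Target:
  "reconnect s V r (Target, v) = (if v = s then {#(Target, u). u \<in># mset_set V#} else {#(Target, v)#})"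
  by (simp add: reconnect_def)

lemma reconnect_other: "snd x \<noteq> s \<Longrightarrow> reconnect s V r x = {#x#}"
  by (cases x) (simp add: reconnect_def)

definition reconnect_vertex :: "'v \<Rightarrow> 'v set \<Rightarrow> 'v \<Rightarrow> 'v multiset" where
  "reconnect_vertex s V = (\<lambda>v. if v = s then mset_set V else {#v#})"

definition graft ::
  "'v set \<Rightarrow> 'v \<Rightarrow> 'v set \<Rightarrow> 'v or_multigraph \<times> 'v \<Rightarrow> 'v or_multigraph \<times> 'v \<Rightarrow>
   ('v or_multigraph \<times> 'v) multiset" where
  "graft V1 s V2 = (\<lambda>(g1, v1) (g2, v2).
     {#(h + g2, if v1 = s then v2 else v1). h \<in># choices (choices (reconnect s V2 v2)) g1#})"

definition relabel :: "('v \<Rightarrow> 'v) \<Rightarrow> 'v or_multigraph \<times> 'v \<Rightarrow> 'v or_multigraph \<times> 'v" where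
  "relabel \<sigma> = (\<lambda>(g, v). (image_mset (image_mset (map_prod id \<sigma>)) g, \<sigma> v))"

definition orc_basis :: "'v set \<Rightarrow> ('v or_multigraph \<times> 'v) set" where
  "orc_basis V = {(g, v). g \<in> or_multigraphs V \<and> v \<in> V \<and> connected_on V (underlying g)}"

lemma MG_orc_eq_basis_operad:
  "(MG_orc :: ('v, _, 'k::field) operad_data) =
     basis_operad orc_basis relabel (\<lambda>v. ({#}, v)) graft"
proof -
  have "{basis (g, v) | g v. g \<in> or_multigraphs V \<and> v \<in> V \<and> connected_on V (underlying g)} =
      (basis ` orc_basis V :: ('v or_multigraph \<times> 'v \<Rightarrow>\<^sub>0 'k) set)" for V
    by (auto simp: orc_basis_def)
  then show ?thesis
    by (simp add: MG_orc_def MG_or_def basis_operad_def relabel_def graft_def reconnect_def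
        case_prod_beta' Let_def)
qed

lemma or_multigraphs_iff:
  "h \<in> or_multigraphs V \<longleftrightarrow> (\<forall>e\<in>#h. size e = 2 \<and> (\<forall>x\<in>#e. snd x \<in> V))"
  by (auto simp: or_multigraphs_def multigraphs_def underlying_def)

lemma underlying_union [simp]: "underlying (g + h) = underlying g + underlying h"
  by (simp add: underlying_def)

lemma underlying_empty [simp]: "underlying {#} = {#}"
  by (simp add: underlying_def)

lemma underlying_relabel:
  "underlying (image_mset (image_mset (map_prod id \<sigma>)) g) =
     image_mset (image_mset \<sigma>) (underlying g)"
  by (simp add: underlying_def multiset.map_comp comp_def)

lemma multigraphs_union: "g + h \<in> multigraphs V \<longleftrightarrow> g \<in> multigraphs V \<and> h \<in> multigraphs V"
  by (auto simp: multigraphs_def)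

lemma multigraphs_mono: "g \<in> multigraphs V \<Longrightarrow> V \<subseteq> W \<Longrightarrow> g \<in> multigraphs W"
  by (auto simp: multigraphs_def)

lemma multigraphs_image: "g \<in> multigraphs V \<Longrightarrow> image_mset (image_mset \<sigma>) g \<in> multigraphs (\<sigma> ` V)"
  by (auto simp: multigraphs_def)

lemma size_two_cases: "size M = 2 \<Longrightarrow> \<exists>a b. M = {#a, b#}"
  by (metis One_nat_def Suc_1 size_1_singleton_mset size_eq_Suc_imp_eq_union size_add_mset Suc_inject)

lemma image_mset_eq_pairD:
  assumes "image_mset f M = {#a, b#}"
  shows "\<exists>x y. M = {#x, y#} \<and> f x = a \<and> f y = b"
proof -
  have "size M = 2" using arg_cong[OF assms, of size] by simp
  then obtain x y where M: "M = {#x, y#}" using size_two_cases by blast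
  with assms have "f x = a \<and> f y = b \<or> f x = b \<and> f y = a"
    by (auto simp: add_mset_eq_single add_eq_conv_ex)
  with M show ?thesis by (metis add_mset_commute)
qed

lemma adjacency_sym: "(u, v) \<in> adjacency g \<longleftrightarrow> (v, u) \<in> adjacency g"
  by (simp add: adjacency_def add_mset_commute)

lemma adjacency_mono: "g \<subseteq># h \<Longrightarrow> adjacency g \<subseteq> adjacency h"
  by (auto simp: adjacency_def dest: mset_subset_eqD)

lemma adjacency_image:
  "(u, v) \<in> adjacency g \<Longrightarrow> (\<sigma> u, \<sigma> v) \<in> adjacency (image_mset (image_mset \<sigma>) g)"
  by (force simp: adjacency_def)

lemma connected_on_image:
  assumes "connected_on V g"
  shows "connected_on (\<sigma> ` V) (image_mset (image_mset \<sigma>) g)"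
proof -
  have "(\<sigma> u, \<sigma> v) \<in> (adjacency (image_mset (image_mset \<sigma>) g))\<^sup>*" if "(u, v) \<in> (adjacency g)\<^sup>*" for u v
    using that by (induction rule: rtrancl_induct) (auto intro: rtrancl_into_rtrancl adjacency_image)
  then show ?thesis
    using assms by (auto simp: connected_on_def multigraphs_image)
qed

lemma connected_on_insertion:
  assumes comp: "s \<notin> V1" "V1 \<inter> V2 = {}"
    and g1: "connected_on (insert s V1) g1" and g2: "connected_on V2 g2"
    and h: "h \<in> multigraphs (V1 \<union> V2)"
    and q: "image_mset (image_mset (\<lambda>v. if v \<in> V2 then s else v)) h = g1"
  shows "connected_on (V1 \<union> V2) (h + g2)"
proof -
  define q' where "q' = (\<lambda>v. if v \<in> V2 then s else v)"
  let ?A = "adjacency (h + g2)"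
  have fibre: "(u, w) \<in> ?A\<^sup>*" if "u \<in> V1 \<union> V2" "w \<in> V1 \<union> V2" "q' u = q' w" for u w
  proof (cases "u \<in> V2")
    case True
    then have "w \<in> V2" using that comp by (auto simp: q'_def split: if_splits)
    then have "(u, w) \<in> (adjacency g2)\<^sup>*" using g2 True by (simp add: connected_on_def)
    then show ?thesis
      by (meson adjacency_mono mset_subset_eq_add_right rtrancl_mono subsetD)
  next
    case False
    then show ?thesis using that comp by (auto simp: q'_def split: if_splits)
  qed
  have lift: "\<forall>u'\<in>V1 \<union> V2. \<forall>w'\<in>V1 \<union> V2. q' u' = u \<longrightarrow> q' w' = w \<longrightarrow> (u', w') \<in> ?A\<^sup>*"
    if "(u, w) \<in> (adjacency g1)\<^sup>*" for u w
    using that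
  proof (induction rule: rtrancl_induct)
    case base
    then show ?case using fibre by simp
  next
    case (step y z)
    from step(2) have "{#y, z#} \<in># image_mset (image_mset q') h"
      using q by (simp add: adjacency_def q'_def)
    then obtain e where e: "e \<in># h" "image_mset q' e = {#y, z#}" by auto
    then obtain a b where ab: "e = {#a, b#}" "q' a = y" "q' b = z"
      using image_mset_eq_pairD by metis
    have V: "a \<in> V1 \<union> V2" "b \<in> V1 \<union> V2" using h e(1) ab(1) by (auto simp: multigraphs_def)
    have "(a, b) \<in> ?A" using e(1) ab(1) by (simp add: adjacency_def)
    then show ?case using step.IH ab V fibre by (metis rtrancl.rtrancl_into_rtrancl rtrancl_trans)
  qed
  show ?thesis
    unfolding connected_on_def
  proof (intro conjI ballI)
    show "h + g2 \<in> multigraphs (V1 \<union> V2)"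
      using h g2 by (auto simp: multigraphs_union connected_on_def intro: multigraphs_mono)
    show "V1 \<union> V2 \<noteq> {}" using g2 by (auto simp: connected_on_def)
    fix u v assume "u \<in> V1 \<union> V2" "v \<in> V1 \<union> V2"
    moreover from this have "q' u \<in> insert s V1" "q' v \<in> insert s V1" by (auto simp: q'_def)
    then have "(q' u, q' v) \<in> (adjacency g1)\<^sup>*" using g1 unfolding connected_on_def by blast
    ultimately show "(u, v) \<in> ?A\<^sup>*" using lift by blast
  qed
qed

lemma in_reconnect_graph:
  assumes g: "\<forall>e\<in>#g. size e = 2 \<and> (\<forall>x\<in>#e. snd x \<in> insert s V1)" and s: "s \<notin> V1" "V1 \<inter> V2 = {}"
    and h: "h \<in># choices (choices R) g"
    and R: "\<And>x y. y \<in># R x \<Longrightarrow> if snd x = s then snd y \<in> V2 \<and> fst y = fst x else y = x"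
  shows "\<forall>e\<in>#h. size e = 2 \<and> (\<forall>x\<in>#e. snd x \<in> V1 \<union> V2)"
    and "image_mset (image_mset (\<lambda>v. if v \<in> V2 then s else v)) (underlying h) = underlying g"
proof -
  show "\<forall>e\<in>#h. size e = 2 \<and> (\<forall>x\<in>#e. snd x \<in> V1 \<union> V2)"
  proof (intro ballI conjI)
    fix e assume e: "e \<in># h"
    show "size e = 2" using in_choices_set[OF h e] g by (auto dest: in_choices_size)
    fix y assume "y \<in># e"
    from in_choices_ends[OF h e this] obtain e' x where "e' \<in># g" "x \<in># e'" "y \<in># R x" by blast
    with R[of y x] g show "snd y \<in> V1 \<union> V2" by (auto split: if_splits)
  qed
  have "image_mset (image_mset (\<lambda>(l, v). (l, if v \<in> V2 then s else v))) h = g"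
  proof (rule in_choices_choices_image[OF h])
    fix e x y assume "e \<in># g" "x \<in># e" "y \<in># R x"
    moreover from this have "snd x \<in> insert s V1" using g by blast
    ultimately show "(case y of (l, v) \<Rightarrow> (l, if v \<in> V2 then s else v)) = x"
      using R[of y x] s by (cases x; cases y) (auto split: if_splits)
  qed
  then have "underlying (image_mset (image_mset (\<lambda>(l, v). (l, if v \<in> V2 then s else v))) h) = underlying g"
    by simp
  then show "image_mset (image_mset (\<lambda>v. if v \<in> V2 then s else v)) (underlying h) = underlying g"
    by (simp add: underlying_def multiset.map_comp comp_def case_prod_beta')
qed

lemma reconnect_transport:
  assumes "inj_on \<sigma> (insert s V1)" "inj_on \<tau> V2" "\<forall>v\<in>V1. \<rho> v = \<sigma> v" "\<forall>v\<in>V2. \<rho> v = \<tau> v"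
    and "finite V2" "r \<in> V2" "snd x \<in> insert s V1"
  shows "image_mset (map_prod id \<rho>) (reconnect s V2 r x) =
    reconnect (\<sigma> s) (\<tau> ` V2) (\<tau> r) (map_prod id \<sigma> x)"
proof -
  obtain l v where x: "x = (l, v)" by (cases x)
  have "\<sigma> v = \<sigma> s \<longleftrightarrow> v = s" using assms(1,7) x by (auto simp: inj_on_def)
  moreover have "image_mset (\<lambda>v. (Target, \<rho> v)) (mset_set V2) = image_mset (Pair Target) (mset_set (\<tau> ` V2))"
    using assms by (auto simp: image_mset_mset_set[OF assms(2), symmetric] multiset.map_comp
        intro!: image_mset_cong)
  ultimately show ?thesis using assms x
    by (cases l) (auto simp: reconnect_def multiset.map_comp comp_def)
qed

lemma graft_natural:
  assumes "composable V1 s V2" "inj_on \<sigma> (insert s V1)" "inj_on \<tau> V2"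
    and "\<forall>v\<in>V1. \<rho> v = \<sigma> v" "\<forall>v\<in>V2. \<rho> v = \<tau> v"
    and g1: "g1 \<in> or_multigraphs (insert s V1)" "v1 \<in> insert s V1"
    and g2: "g2 \<in> or_multigraphs V2" "v2 \<in> V2"
  shows "image_mset (relabel \<rho>) (graft V1 s V2 (g1, v1) (g2, v2)) =
    graft (\<sigma> ` V1) (\<sigma> s) (\<tau> ` V2) (relabel \<sigma> (g1, v1)) (relabel \<tau> (g2, v2))"
proof -
  let ?f = "\<lambda>h. image_mset (image_mset (map_prod id \<rho>)) h"
  have g2': "?f g2 = image_mset (image_mset (map_prod id \<tau>)) g2"
    using g2 assms(5) by (intro image_mset_cong) (force simp: or_multigraphs_iff)
  have root: "\<rho> (if v1 = s then v2 else v1) = (if \<sigma> v1 = \<sigma> s then \<tau> v2 else \<sigma> v1)"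
    using assms by (auto simp: inj_on_def)
  have "image_mset ?f (choices (choices (reconnect s V2 v2)) g1) =
      choices (choices (\<lambda>x. image_mset (map_prod id \<rho>) (reconnect s V2 v2 x))) g1"
    by (simp add: image_choices)
  also have "\<dots> = choices (choices (\<lambda>x. reconnect (\<sigma> s) (\<tau> ` V2) (\<tau> v2) (map_prod id \<sigma> x))) g1"
    using assms
    by (intro choices_choices_cong reconnect_transport)
      (auto simp: or_multigraphs_iff composable_def)
  also have "\<dots> = choices (choices (reconnect (\<sigma> s) (\<tau> ` V2) (\<tau> v2)))
      (image_mset (image_mset (map_prod id \<sigma>)) g1)"
    by (simp add: choices_image)
  finally show ?thesis
    by (simp add: graft_def relabel_def multiset.map_comp comp_def g2' root
        flip: multiset.map_comp[unfolded comp_def, of "\<lambda>h. (h + _, _)" ?f])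
qed

lemma choices_reconnect_outside:
  assumes "\<forall>e\<in>#g. \<forall>x\<in>#e. snd x \<noteq> s"
  shows "choices (choices (reconnect s V r)) g = {#g#}"
proof -
  have "choices (choices (reconnect s V r)) g = choices (choices (\<lambda>x. {#x#})) g"
    using assms by (intro choices_choices_cong reconnect_other) blast
  then show ?thesis by (simp add: choices_choices_singleton[of "\<lambda>x. x"])
qed

lemma graft_sequential:
  assumes V: "finite V1 \<and> finite V2 \<and> finite V3 \<and> V1 \<inter> V2 = {} \<and> V1 \<inter> V3 = {} \<and> V2 \<inter> V3 = {} \<and>
      s \<notin> V1 \<and> t \<notin> V1 \<union> V2"
    and g1: "g1 \<in> or_multigraphs (insert s V1)" "v1 \<in> insert s V1"
    and g2: "g2 \<in> or_multigraphs (insert t V2)" "v2 \<in> insert t V2"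
  shows "(\<Sum>d\<in>#graft V1 s (insert t V2) (g1, v1) (g2, v2). graft (V1 \<union> V2) t V3 d (g3, v3)) =
    (\<Sum>d\<in>#graft V2 t V3 (g2, v2) (g3, v3). graft V1 s (V2 \<union> V3) (g1, v1) d)"
proof -
  let ?Rs = "reconnect s (insert t V2) v2" and ?Rt = "reconnect t V3 v3"
  let ?w = "if v2 = t then v3 else v2"
  let ?r = "if (if v1 = s then v2 else v1) = t then v3 else if v1 = s then v2 else v1"
  have r: "?r = (if v1 = s then ?w else v1)" using V g1 by auto
  have R: "(\<Sum>y\<in>#?Rs x. ?Rt y) = reconnect s (V2 \<union> V3) ?w x" if "snd x \<in> insert s V1" for x
  proof -
    have "(\<Sum>y\<in>#mset_set V2. reconnect t V3 v3 (Target, y)) = (\<Sum>y\<in>#mset_set V2. {#(Target, y)#})"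
      using V by (intro Sum_mset_cong) (auto simp: reconnect_Target)
    then have "(\<Sum>y\<in>#mset_set (insert t V2). reconnect t V3 v3 (Target, y)) =
        image_mset (Pair Target) (mset_set (V2 \<union> V3))"
      using V by (simp add: mset_set_Union reconnect_Target)
    then show ?thesis using that V
      by (cases x; cases "fst x") (auto simp: reconnect_Source reconnect_Target Sum_mset_image)
  qed
  have "(\<Sum>h\<in>#choices (choices ?Rs) g1. choices (choices ?Rt) h) =
      choices (choices (reconnect s (V2 \<union> V3) ?w)) g1"
    unfolding choices_choices_bind
    using g1 by (intro choices_choices_cong R) (auto simp: or_multigraphs_iff)
  then have "(\<Sum>h\<in>#choices (choices ?Rs) g1. \<Sum>a\<in>#choices (choices ?Rt) h. F a) =
      (\<Sum>a\<in>#choices (choices (reconnect s (V2 \<union> V3) ?w)) g1. F a)"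
    for F :: "'a or_multigraph \<Rightarrow> ('a or_multigraph \<times> 'a) multiset"
    by (metis Sum_mset_bind)
  then have "(\<Sum>d\<in>#graft V1 s (insert t V2) (g1, v1) (g2, v2). graft (V1 \<union> V2) t V3 d (g3, v3)) =
    (\<Sum>a\<in>#choices (choices (reconnect s (V2 \<union> V3) ?w)) g1.
       \<Sum>b\<in>#choices (choices ?Rt) g2. {#(a + b + g3, ?r)#})"
    by (simp add: graft_def choices_union Sum_mset_image image_mset_Sum multiset.map_comp comp_def)
  also have "\<dots> = (\<Sum>d\<in>#graft V2 t V3 (g2, v2) (g3, v3). graft V1 s (V2 \<union> V3) (g1, v1) d)"
    unfolding r
    by (subst sum_mset.swap) (simp add: graft_def Sum_mset_image multiset.map_comp comp_def add.assoc)
  finally show ?thesis .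
qed

lemma graft_parallel:
  assumes V: "finite V1 \<and> finite V2 \<and> finite V3 \<and> V1 \<inter> V2 = {} \<and> V1 \<inter> V3 = {} \<and> V2 \<inter> V3 = {} \<and>
      s \<noteq> t \<and> s \<notin> V1 \<union> V3 \<and> t \<notin> V1 \<union> V2"
    and g2: "g2 \<in> or_multigraphs V2" "v2 \<in> V2"
    and g3: "g3 \<in> or_multigraphs V3" "v3 \<in> V3"
  shows "(\<Sum>d\<in>#graft (insert t V1) s V2 (g1, v1) (g2, v2). graft (V1 \<union> V2) t V3 d (g3, v3)) =
    (\<Sum>d\<in>#graft (insert s V1) t V3 (g1, v1) (g3, v3). graft (V1 \<union> V3) s V2 d (g2, v2))"
proof -
  let ?Rs = "reconnect s V2 v2" and ?Rt = "reconnect t V3 v3"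
  have single: "(\<Sum>y\<in>#mset_set A. reconnect u B w (Target, y)) = image_mset (Pair Target) (mset_set A)"
    if "finite A" "u \<notin> A" for A B u w
  proof -
    have "(\<Sum>y\<in>#mset_set A. reconnect u B w (Target, y)) = (\<Sum>y\<in>#mset_set A. {#(Target, y)#})"
      using that by (intro Sum_mset_cong) (auto simp: reconnect_Target)
    then show ?thesis by simp
  qed
  have R: "(\<Sum>y\<in>#?Rs x. ?Rt y) = (\<Sum>y\<in>#?Rt x. ?Rs y)" for x
  proof -
    obtain l v where x: "x = (l, v)" by (cases x)
    have "reconnect t V3 v3 (Source, v2) = {#(Source, v2)#}" "reconnect s V2 v2 (Source, v3) = {#(Source, v3)#}"
      using V g2 g3 by (auto simp: reconnect_Source)
    then show ?thesis using V x single[of V2 t V3 v3] single[of V3 s V2 v2]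
      by (cases l) (auto simp: reconnect_Source reconnect_Target Sum_mset_image)
  qed
  have "(\<Sum>h\<in>#choices (choices ?Rs) g1. choices (choices ?Rt) h) =
      (\<Sum>h\<in>#choices (choices ?Rt) g1. choices (choices ?Rs) h)"
    unfolding choices_choices_bind R ..
  then have swap: "(\<Sum>h\<in>#choices (choices ?Rs) g1. image_mset F (choices (choices ?Rt) h)) =
      (\<Sum>h\<in>#choices (choices ?Rt) g1. image_mset F (choices (choices ?Rs) h))"
    for F :: "'a or_multigraph \<Rightarrow> 'a or_multigraph \<times> 'a"
    by (metis image_mset_Sum)
  have out: "choices (choices ?Rt) g2 = {#g2#}" "choices (choices ?Rs) g3 = {#g3#}"
    using V g2 g3 by (auto simp: or_multigraphs_iff intro!: choices_reconnect_outside)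
  let ?r = "if (if v1 = s then v2 else v1) = t then v3 else if v1 = s then v2 else v1"
  have r: "(if (if v1 = t then v3 else v1) = s then v2 else if v1 = t then v3 else v1) = ?r"
    using V g2 g3 by auto
  have "(\<Sum>d\<in>#graft (insert t V1) s V2 (g1, v1) (g2, v2). graft (V1 \<union> V2) t V3 d (g3, v3)) =
      (\<Sum>h\<in>#choices (choices ?Rs) g1. image_mset (\<lambda>a. (a + (g2 + g3), ?r)) (choices (choices ?Rt) h))"
    by (simp add: graft_def choices_union Sum_mset_image image_mset_Sum multiset.map_comp comp_def
        out add_ac split del: if_split)
  also have "\<dots> = (\<Sum>h\<in>#choices (choices ?Rt) g1. image_mset (\<lambda>a. (a + (g2 + g3), ?r)) (choices (choices ?Rs) h))"
    by (rule swap)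
  also have "\<dots> = (\<Sum>d\<in>#graft (insert s V1) t V3 (g1, v1) (g3, v3). graft (V1 \<union> V3) s V2 d (g2, v2))"
    by (simp add: graft_def choices_union Sum_mset_image image_mset_Sum multiset.map_comp comp_def
        out r add_ac split del: if_split)
  finally show ?thesis .
qed

lemma operad_basis_orc: "operad_basis orc_basis relabel (\<lambda>v. ({#}, v)) graft"
proof
  show "orc_basis {} = {}" by (simp add: orc_basis_def)
next
  fix V :: "'a set" and \<sigma> :: "'a \<Rightarrow> 'a" and b assume "finite V" "inj_on \<sigma> V" "b \<in> orc_basis V"
  then show "relabel \<sigma> b \<in> orc_basis (\<sigma> ` V)"
    by (auto simp: orc_basis_def relabel_def or_multigraphs_def underlying_relabel
        intro: connected_on_image multigraphs_image)
next
  fix V :: "'a set" and \<sigma> \<tau> :: "'a \<Rightarrow> 'a" and b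
  assume "finite V" and *: "\<forall>v\<in>V. \<sigma> v = \<tau> v" and "b \<in> orc_basis V"
  then show "relabel \<sigma> b = relabel \<tau> b"
    by (auto simp: orc_basis_def relabel_def or_multigraphs_iff intro!: image_mset_cong) force
next
  fix b :: "'a or_multigraph \<times> 'a"
  show "relabel id b = b" by (simp add: relabel_def prod.map_id0 case_prod_beta)
next
  fix \<sigma> \<tau> :: "'a \<Rightarrow> 'a" and b
  show "relabel \<tau> (relabel \<sigma> b) = relabel (\<tau> \<circ> \<sigma>) b"
    by (simp add: relabel_def case_prod_beta multiset.map_comp comp_def prod.map_comp id_def)
next
  fix v :: 'a
  show "({#}, v) \<in> orc_basis {v}"
    by (simp add: orc_basis_def or_multigraphs_iff connected_on_def multigraphs_def)
next
  fix \<sigma> :: "'a \<Rightarrow> 'a" and v :: 'a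
  show "relabel \<sigma> ({#}, v) = ({#}, \<sigma> v)" by (simp add: relabel_def)
next
  fix V1 V2 :: "'a set" and s a b c
  assume *: "composable V1 s V2" "a \<in> orc_basis (insert s V1)" "b \<in> orc_basis V2" "c \<in># graft V1 s V2 a b"
  obtain g1 v1 g2 v2 where ab: "a = (g1, v1)" "b = (g2, v2)" by (cases a; cases b)
  from *(4) ab obtain h where h: "h \<in># choices (choices (reconnect s V2 v2)) g1"
    and c: "c = (h + g2, if v1 = s then v2 else v1)" by (auto simp: graft_def)
  have g1: "g1 \<in> or_multigraphs (insert s V1)" "connected_on (insert s V1) (underlying g1)"
    and g2: "g2 \<in> or_multigraphs V2" "connected_on V2 (underlying g2)"
    and v: "v1 \<in> insert s V1" "v2 \<in> V2" and s: "s \<notin> V1" "V1 \<inter> V2 = {}" "finite V2"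
    using * ab by (auto simp: orc_basis_def composable_def)
  have R: "if snd x = s then snd y \<in> V2 \<and> fst y = fst x else y = x"
    if "y \<in># reconnect s V2 v2 x" for x y
    using that v s by (cases x) (auto simp: reconnect_def split: if_splits end_label.splits)
  note h' = in_reconnect_graph[OF g1(1)[unfolded or_multigraphs_iff] s(1,2) h R]
  have h_mg: "h \<in> or_multigraphs (V1 \<union> V2)" using h'(1) by (simp add: or_multigraphs_iff)
  have "connected_on (V1 \<union> V2) (underlying h + underlying g2)"
    using connected_on_insertion[OF s(1,2) g1(2) g2(2) _ h'(2)] h_mg by (simp add: or_multigraphs_def)
  then show "c \<in> orc_basis (V1 \<union> V2)"
    using h_mg g2(1) v c
    by (auto simp: orc_basis_def or_multigraphs_def multigraphs_union intro: multigraphs_mono)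
next
  fix V1 V2 :: "'a set" and s a b and \<sigma> \<tau> \<rho> :: "'a \<Rightarrow> 'a"
  assume *: "composable V1 s V2" "inj_on \<sigma> (insert s V1)" "inj_on \<tau> V2" "inj_on \<rho> (V1 \<union> V2)"
    "\<forall>v\<in>V1. \<rho> v = \<sigma> v" "\<forall>v\<in>V2. \<rho> v = \<tau> v" "a \<in> orc_basis (insert s V1)" "b \<in> orc_basis V2"
  obtain g1 v1 g2 v2 where ab: "a = (g1, v1)" "b = (g2, v2)" by (cases a; cases b)
  show "image_mset (relabel \<rho>) (graft V1 s V2 a b) =
      graft (\<sigma> ` V1) (\<sigma> s) (\<tau> ` V2) (relabel \<sigma> a) (relabel \<tau> b)"
    unfolding ab using * by (intro graft_natural) (auto simp: orc_basis_def ab)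
next
  fix V :: "'a set" and s b
  show "graft {} s V ({#}, s) b = {#b#}" by (cases b) (simp add: graft_def)
next
  fix V1 :: "'a set" and s v a
  assume *: "composable V1 s {v}" "a \<in> orc_basis (insert s V1)"
  have "reconnect s {v} v = (\<lambda>x. {#map_prod id (id(s := v)) x#})"
    by (auto simp: reconnect_def fun_eq_iff split: end_label.splits)
  then show "graft V1 s {v} a ({#}, v) = {#relabel (id(s := v)) a#}"
    by (simp add: graft_def relabel_def choices_choices_singleton case_prod_beta)
next
  fix V1 V2 V3 :: "'a set" and s t a b c
  assume *: "finite V1 \<and> finite V2 \<and> finite V3 \<and> V1 \<inter> V2 = {} \<and> V1 \<inter> V3 = {} \<and> V2 \<inter> V3 = {} \<and>
      s \<noteq> t \<and> s \<notin> V1 \<union> V3 \<and> t \<notin> V1 \<union> V2"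
    "a \<in> orc_basis (insert s (insert t V1))" "b \<in> orc_basis V2" "c \<in> orc_basis V3"
  obtain g1 v1 g2 v2 g3 v3 where abc: "a = (g1, v1)" "b = (g2, v2)" "c = (g3, v3)"
    by (cases a; cases b; cases c)
  show "(\<Sum>d\<in>#graft (insert t V1) s V2 a b. graft (V1 \<union> V2) t V3 d c) =
      (\<Sum>d\<in>#graft (insert s V1) t V3 a c. graft (V1 \<union> V3) s V2 d b)"
    unfolding abc by (rule graft_parallel[OF *(1)]) (use *(2-) in \<open>auto simp: abc orc_basis_def\<close>)
next
  fix V1 V2 V3 :: "'a set" and s t a b c
  assume *: "finite V1 \<and> finite V2 \<and> finite V3 \<and> V1 \<inter> V2 = {} \<and> V1 \<inter> V3 = {} \<and> V2 \<inter> V3 = {} \<and>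
      s \<notin> V1 \<and> t \<notin> V1 \<union> V2"
    "a \<in> orc_basis (insert s V1)" "b \<in> orc_basis (insert t V2)" "c \<in> orc_basis V3"
  obtain g1 v1 g2 v2 g3 v3 where abc: "a = (g1, v1)" "b = (g2, v2)" "c = (g3, v3)"
    by (cases a; cases b; cases c)
  show "(\<Sum>d\<in>#graft V1 s (insert t V2) a b. graft (V1 \<union> V2) t V3 d c) =
      (\<Sum>d\<in>#graft V2 t V3 b c. graft V1 s (V2 \<union> V3) a d)"
    unfolding abc by (rule graft_sequential[OF *(1)]) (use *(2-) in \<open>auto simp: abc orc_basis_def\<close>)
qed

lemma operad_MG_orc: "operad (MG_orc :: ('v, 'v or_multigraph \<times> 'v, 'k::field) operad_data)"
  unfolding MG_orc_eq_basis_operad by (rule operad_basis.operad[OF operad_basis_orc])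

section \<open>Rooted trees as parent functions\<close>

definition rooted :: "'v set \<Rightarrow> ('v \<Rightarrow> 'v) \<Rightarrow> 'v \<Rightarrow> bool" where
  "rooted V p r \<longleftrightarrow> finite V \<and> r \<in> V \<and> (\<exists>d :: 'v \<Rightarrow> nat. \<forall>v\<in>V - {r}. p v \<in> V \<and> d (p v) < d v)"

definition parent_tree :: "'v set \<Rightarrow> ('v \<Rightarrow> 'v) \<Rightarrow> 'v \<Rightarrow> 'v multigraph" where
  "parent_tree V p r = {#{#p v, v#}. v \<in># mset_set (V - {r})#}"

definition parent_orientation :: "'v set \<Rightarrow> ('v \<Rightarrow> 'v) \<Rightarrow> 'v \<Rightarrow> 'v or_multigraph" where
  "parent_orientation V p r = {#{#(Target, p v), (Source, v)#}. v \<in># mset_set (V - {r})#}"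

lemma pair_mset_eq: "{#a, b#} = {#c, d#} \<longleftrightarrow> a = c \<and> b = d \<or> a = d \<and> b = c"
  by (auto simp: add_eq_conv_ex)

lemma in_parent_tree:
  assumes "rooted V p r"
  shows "e \<in># parent_tree V p r \<longleftrightarrow> (\<exists>v\<in>V - {r}. e = {#p v, v#})"
  using assms by (auto simp: parent_tree_def rooted_def)

lemma rooted_edges_inj:
  assumes "rooted V p r"
  shows "inj_on (\<lambda>v. {#p v, v#}) (V - {r})"
proof -
  obtain d :: "'a \<Rightarrow> nat" where d: "\<forall>v\<in>V - {r}. d (p v) < d v" using assms unfolding rooted_def by blast
  show ?thesis
  proof (rule inj_onI)
    fix v w assume vw: "v \<in> V - {r}" "w \<in> V - {r}" and "{#p v, v#} = {#p w, w#}"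
    then show "v = w" using d[rule_format, OF vw(1)] d[rule_format, OF vw(2)]
      by (auto simp: pair_mset_eq)
  qed
qed

lemma parent_tree_eq_mset_set:
  assumes "rooted V p r"
  shows "parent_tree V p r = mset_set ((\<lambda>v. {#p v, v#}) ` (V - {r}))"
  by (simp add: parent_tree_def image_mset_mset_set[OF rooted_edges_inj[OF assms]])

lemma count_parent_tree: "rooted V p r \<Longrightarrow> count (parent_tree V p r) e \<le> 1"
  by (simp add: parent_tree_eq_mset_set count_mset_set')

lemma rtrancl_adjacency_sym: "(u, v) \<in> (adjacency g)\<^sup>* \<Longrightarrow> (v, u) \<in> (adjacency g)\<^sup>*"
  using sym_rtrancl[of "adjacency g"] adjacency_sym by (metis symD symI)

lemma connected_on_parent_tree:
  assumes "rooted V p r"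
  shows "connected_on V (parent_tree V p r)"
proof -
  obtain d :: "'a \<Rightarrow> nat" where d: "\<forall>v\<in>V - {r}. p v \<in> V \<and> d (p v) < d v"
    using assms unfolding rooted_def by blast
  let ?A = "adjacency (parent_tree V p r)"
  have root: "v \<in> V \<Longrightarrow> (r, v) \<in> ?A\<^sup>*" for v
  proof (induction "d v" arbitrary: v rule: less_induct)
    case less
    show ?case
    proof (cases "v = r")
      case False
      with less.prems have v: "v \<in> V - {r}" by simp
      then have "(p v, v) \<in> ?A" using assms by (auto simp: adjacency_def in_parent_tree)
      then show ?thesis using less.hyps[of "p v"] d v by (meson rtrancl.rtrancl_into_rtrancl)
    qed simp
  qed
  have "parent_tree V p r \<in> multigraphs V"
    using d in_parent_tree[OF assms] by (auto simp: multigraphs_def) blast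
  moreover have "(u, v) \<in> ?A\<^sup>*" if "u \<in> V" "v \<in> V" for u v
    using root[OF that(1)] root[OF that(2)] rtrancl_adjacency_sym by (metis rtrancl_trans)
  ultimately show ?thesis using assms by (auto simp: connected_on_def rooted_def)
qed

fun path_edges :: "'v list \<Rightarrow> 'v multigraph" where
  "path_edges (x # y # zs) = add_mset {#x, y#} (path_edges (y # zs))"
| "path_edges _ = {#}"

lemma path_edges_append:
  "xs \<noteq> [] \<Longrightarrow> ys \<noteq> [] \<Longrightarrow>
   path_edges (xs @ ys) = add_mset {#last xs, hd ys#} (path_edges xs + path_edges ys)"
proof (induction xs rule: path_edges.induct)
  case ("2_2" v)
  then show ?case by (cases ys) auto
qed auto

lemma path_edges_vertices: "e \<in># path_edges vs \<Longrightarrow> set_mset e \<subseteq> set vs"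
  by (induction vs rule: path_edges.induct) auto

lemma cycle_edges_Cons: "cycle_edges (x # xs) = add_mset {#last (x # xs), x#} (path_edges (x # xs))"
proof -
  have "mset (map2 (\<lambda>u v. {#u, v#}) (x # xs) (xs @ [z])) =
      add_mset {#last (x # xs), z#} (path_edges (x # xs))" for z
    by (induction xs arbitrary: x) auto
  then show ?thesis by (simp add: cycle_edges_def)
qed

lemma cycle_edges_rotate: "cycle_edges (as @ v # bs) = cycle_edges (v # bs @ as)"
proof (cases as)
  case (Cons a as')
  have "cycle_edges (as @ v # bs) =
      add_mset {#last (v # bs), a#} (add_mset {#last as, v#} (path_edges as + path_edges (v # bs)))"
    using Cons by (simp add: cycle_edges_Cons path_edges_append[of "a # as'", simplified])
  also have "\<dots> = add_mset {#last as, v#} (path_edges ((v # bs) @ as))"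
    using Cons by (subst path_edges_append) (auto simp: add_ac)
  also have "\<dots> = cycle_edges (v # bs @ as)"
    using Cons by (simp add: cycle_edges_Cons)
  finally show ?thesis .
qed simp

lemma count_path_edges: "distinct vs \<Longrightarrow> count (path_edges vs) e \<le> 1"
proof (induction vs rule: path_edges.induct)
  case (1 x y zs)
  have "count (path_edges (y # zs)) {#x, y#} = 0"
    using path_edges_vertices[of "{#x, y#}" "y # zs"] 1(2) by (auto simp: count_eq_zero_iff)
  then show ?case using 1 by auto
qed auto

lemma path_edges_subset:
  assumes "distinct vs" "set_mset (path_edges vs) \<subseteq> set_mset g"
  shows "path_edges vs \<subseteq># g"
proof (rule mset_subset_eqI)
  fix e
  show "count (path_edges vs) e \<le> count g e"
  proof (cases "e \<in># path_edges vs")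
    case True
    then have "count g e \<ge> 1" using assms(2) by (auto simp: Suc_le_eq)
    then show ?thesis using count_path_edges[OF assms(1), of e] by linarith
  qed (simp add: not_in_iff)
qed

text \<open>At a vertex of maximal rank, the two edges of a cycle would both lead to its parent.\<close>

lemma parent_tree_acyclic:
  assumes rooted: "rooted V p r" and "vs \<noteq> []" "distinct vs"
  shows "\<not> cycle_edges vs \<subseteq># parent_tree V p r"
proof
  assume sub: "cycle_edges vs \<subseteq># parent_tree V p r"
  obtain d :: "'a \<Rightarrow> nat" where d: "\<forall>v\<in>V - {r}. p v \<in> V \<and> d (p v) < d v"
    using rooted unfolding rooted_def by blast
  have "Max (d ` set vs) \<in> d ` set vs" using assms(2) by (intro Max_in) auto
  then obtain v where v: "v \<in> set vs" "Max (d ` set vs) = d v" by auto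
  have max: "d w \<le> d v" if "w \<in> set vs" for w
    using that by (simp flip: v(2))
  obtain as bs where vs: "vs = as @ v # bs" using v(1) by (meson split_list)
  define ws where "ws = bs @ as"
  have sub': "cycle_edges (v # ws) \<subseteq># parent_tree V p r"
    using sub cycle_edges_rotate[of as v bs] by (simp only: vs ws_def)
  have ws: "set ws \<subseteq> set vs" unfolding ws_def vs by auto
  have par: "e = {#p v, v#} \<and> w = p v"
    if e: "e \<in># parent_tree V p r" "e = {#w, v#}" and w: "w \<in> set vs" for e w
  proof -
    obtain x where x: "x \<in> V - {r}" "e = {#p x, x#}"
      using e(1) unfolding in_parent_tree[OF rooted] by (elim bexE)
    have "d (p x) < d x" using d x(1) by blast
    moreover have "p x = w \<and> x = v \<or> p x = v \<and> x = w"
      using e(2) unfolding x(2) pair_mset_eq .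
    moreover have "\<not> d v < d w" using max[OF w] by simp
    ultimately show ?thesis using x(2) by metis
  qed
  show False
  proof (cases "ws = []")
    case True
    then have "{#v, v#} \<in># parent_tree V p r"
      by (intro mset_subset_eqD[OF sub']) (simp add: cycle_edges_Cons)
    then obtain x where x: "x \<in> V - {r}" "{#v, v#} = {#p x, x#}" using in_parent_tree[OF rooted] by blast
    then have "d (p x) < d x" using d by blast
    with x(2) show False by (auto simp: pair_mset_eq)
  next
    case False
    have "cycle_edges (v # ws) = add_mset {#last ws, v#} (add_mset {#v, hd ws#} (path_edges ws))"
      using False path_edges_append[of "[v]" ws] by (simp add: cycle_edges_Cons)
    with sub' have two: "add_mset {#last ws, v#} (add_mset {#v, hd ws#} (path_edges ws)) \<subseteq># parent_tree V p r"
      by simp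
    have edges: "{#last ws, v#} \<in># parent_tree V p r" "{#v, hd ws#} \<in># parent_tree V p r"
      by (rule mset_subset_eqD[OF two], simp)+
    have "last ws = p v" "hd ws = p v"
      using par[OF edges(1) refl] par[OF edges(2) add_mset_commute]
        subsetD[OF ws last_in_set[OF False]] subsetD[OF ws hd_in_set[OF False]] by auto
    moreover have "{#v, p v#} = {#p v, v#}" by (rule add_mset_commute)
    ultimately have "count (add_mset {#last ws, v#} (add_mset {#v, hd ws#} (path_edges ws))) {#p v, v#} \<ge> 2"
      by simp
    then show False using two count_parent_tree[OF rooted, of "{#p v, v#}"]
        mset_subset_eq_count[OF two, of "{#p v, v#}"] by linarith
  qed
qed

lemma tree_on_parent_tree: "rooted V p r \<Longrightarrow> tree_on V (parent_tree V p r)"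
  by (auto simp: tree_on_def connected_on_parent_tree dest: parent_tree_acyclic)

lemma connected_on_nearer_neighbour:
  assumes "connected_on V g" "r \<in> V" "v \<in> V - {r}"
  shows "\<exists>p\<in>V. {#p, v#} \<in># g \<and> graph_dist g r p < graph_dist g r v"
proof -
  have "(r, v) \<in> (adjacency g)\<^sup>*" using assms by (simp add: connected_on_def)
  then have "\<exists>n. (r, v) \<in> adjacency g ^^ n" by (simp add: rtrancl_is_UN_relpow)
  then have n: "(r, v) \<in> adjacency g ^^ graph_dist g r v"
    unfolding graph_dist_def by (rule LeastI_ex)
  show ?thesis
  proof (cases "graph_dist g r v")
    case 0
    then show ?thesis using n assms by simp
  next
    case (Suc m)
    then obtain p where p: "(r, p) \<in> adjacency g ^^ m" "(p, v) \<in> adjacency g" using n by auto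
    have "graph_dist g r p \<le> m" unfolding graph_dist_def by (rule Least_le) (rule p(1))
    moreover have "p \<in> V" using p(2) assms(1)
      by (auto simp: adjacency_def connected_on_def multigraphs_def)
    ultimately show ?thesis using p(2) Suc by (auto simp: adjacency_def)
  qed
qed

lemma connected_on_parents:
  assumes "connected_on V g" "finite V" "r \<in> V"
  shows "\<exists>p. rooted V p r \<and> parent_tree V p r \<subseteq># g \<and>
    (\<forall>v\<in>V - {r}. graph_dist g r (p v) < graph_dist g r v)"
proof -
  obtain p where p: "\<forall>v\<in>V - {r}. p v \<in> V \<and> {#p v, v#} \<in># g \<and> graph_dist g r (p v) < graph_dist g r v"
    using connected_on_nearer_neighbour[OF assms(1,3)] by metis
  have rooted: "rooted V p r"
    unfolding rooted_def using p assms by blast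
  have "mset_set ((\<lambda>v. {#p v, v#}) ` (V - {r})) \<subseteq># mset_set (set_mset g)"
    using p by (intro subset_imp_msubset_mset_set) auto
  then have "parent_tree V p r \<subseteq># g"
    unfolding parent_tree_eq_mset_set[OF rooted]
    using mset_set_set_mset_msubset subset_mset.order_trans by blast
  then show ?thesis using rooted p by blast
qed

lemma simple_path:
  assumes "(a, b) \<in> (adjacency g)\<^sup>*"
  shows "\<exists>vs. vs \<noteq> [] \<and> distinct vs \<and> hd vs = a \<and> last vs = b \<and> set_mset (path_edges vs) \<subseteq> set_mset g"
  using assms
proof (induction rule: converse_rtrancl_induct)
  case base
  show ?case by (rule exI[of _ "[b]"]) simp
next
  case (step a a')
  then obtain vs where vs: "vs \<noteq> []" "distinct vs" "hd vs = a'" "last vs = b"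
    "set_mset (path_edges vs) \<subseteq> set_mset g" by blast
  show ?case
  proof (cases "a \<in> set vs")
    case True
    then obtain xs ys where xy: "vs = xs @ a # ys" by (meson split_list)
    have "set_mset (path_edges (a # ys)) \<subseteq> set_mset (path_edges vs)"
      unfolding xy by (cases "xs = []") (auto simp: path_edges_append)
    then show ?thesis using vs xy by (intro exI[of _ "a # ys"]) auto
  next
    case False
    have "path_edges (a # vs) = add_mset {#a, a'#} (path_edges vs)"
      using path_edges_append[of "[a]" vs] vs by simp
    then show ?thesis using vs False step(1) by (intro exI[of _ "a # vs"]) (auto simp: adjacency_def)
  qed
qed

lemma tree_on_parents:
  assumes t: "tree_on V t" and V: "finite V" "r \<in> V"
  shows "\<exists>p. rooted V p r \<and> t = parent_tree V p r \<and>
    (\<forall>v\<in>V - {r}. graph_dist t r (p v) < graph_dist t r v)"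
proof -
  have conn: "connected_on V t" using t by (simp add: tree_on_def)
  obtain p where p: "rooted V p r" "parent_tree V p r \<subseteq># t"
    "\<forall>v\<in>V - {r}. graph_dist t r (p v) < graph_dist t r v"
    using connected_on_parents[OF conn V] by blast
  have "t - parent_tree V p r = {#}"
  proof (rule ccontr)
    assume "t - parent_tree V p r \<noteq> {#}"
    then obtain e where e: "e \<in># t - parent_tree V p r" by blast
    then have e_t: "add_mset e (parent_tree V p r) \<subseteq># t"
    proof (intro mset_subset_eqI)
      fix x
      show "count (add_mset e (parent_tree V p r)) x \<le> count t x"
        using e mset_subset_eq_count[OF p(2), of x] by (cases "x = e") (simp_all add: in_diff_count)
    qed
    have "e \<in># t" using e by (meson in_diffD)
    then have "size e = 2" "set_mset e \<subseteq> V" using conn by (auto simp: connected_on_def multigraphs_def)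
    moreover from this(1) obtain a b where "e = {#a, b#}" using size_two_cases by blast
    ultimately have ab: "e = {#a, b#}" "a \<in> V" "b \<in> V" by auto
    have "(a, b) \<in> (adjacency (parent_tree V p r))\<^sup>*"
      using connected_on_parent_tree[OF p(1)] ab by (simp add: connected_on_def)
    then obtain vs where vs: "vs \<noteq> []" "distinct vs" "hd vs = a" "last vs = b"
      "set_mset (path_edges vs) \<subseteq> set_mset (parent_tree V p r)"
      using simple_path by metis
    have "cycle_edges vs = add_mset e (path_edges vs)"
      using vs(1,3,4) ab(1) by (cases vs) (auto simp: cycle_edges_Cons add_mset_commute)
    also have "\<dots> \<subseteq># add_mset e (parent_tree V p r)"
      using path_edges_subset[OF vs(2,5)] by simp
    finally have "cycle_edges vs \<subseteq># t" using e_t by (rule subset_mset.order_trans)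
    then show False using t vs(1,2) by (auto simp: tree_on_def)
  qed
  then have "t = parent_tree V p r" using p(2)
    by (simp add: Diff_eq_empty_iff_mset subset_mset.antisym)
  then show ?thesis using p by blast
qed

lemma parent_tree_parents_unique:
  assumes p: "rooted V p r" and p': "rooted V p' r" and eq: "parent_tree V p r = parent_tree V p' r"
    and "v \<in> V - {r}"
  shows "p v = p' v"
proof -
  obtain d :: "'a \<Rightarrow> nat" where d: "\<forall>v\<in>V - {r}. p v \<in> V \<and> d (p v) < d v"
    using p unfolding rooted_def by blast
  show ?thesis
    using assms(4)
  proof (induction "d v" arbitrary: v rule: less_induct)
    case less
    have "{#p v, v#} \<in># parent_tree V p' r"
      using less.prems in_parent_tree[OF p] by (auto simp flip: eq)
    then obtain w where w: "w \<in> V - {r}" "{#p v, v#} = {#p' w, w#}"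
      using in_parent_tree[OF p'] by blast
    show ?case
    proof (rule ccontr)
      assume "p v \<noteq> p' v"
      with w(2) have *: "w = p v" "p' w = v" by (auto simp: pair_mset_eq)
      then have "p w = v" using less.hyps[of w] d less.prems w(1) by simp
      then show False using d[rule_format, OF less.prems] d[rule_format, OF w(1)] * by simp
    qed
  qed
qed

lemma graph_dist_parent_tree:
  assumes "rooted V p r" "v \<in> V - {r}"
  shows "graph_dist (parent_tree V p r) r (p v) < graph_dist (parent_tree V p r) r v"
proof -
  have "finite V" "r \<in> V" using assms(1) by (auto simp: rooted_def)
  from tree_on_parents[OF tree_on_parent_tree[OF assms(1)] this]
  obtain p' where "rooted V p' r" "parent_tree V p r = parent_tree V p' r"
    "\<forall>v\<in>V - {r}. graph_dist (parent_tree V p r) r (p' v) < graph_dist (parent_tree V p r) r v"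
    by blast
  then show ?thesis using parent_tree_parents_unique[OF assms(1) _ _ assms(2)] assms(2) by metis
qed

lemma orient_tree_edge_parent_tree:
  assumes "rooted V p r" "v \<in> V - {r}"
  shows "orient_tree_edge (parent_tree V p r) r {#p v, v#} = {#(Target, p v), (Source, v)#}"
  using graph_dist_parent_tree[OF assms] by (simp add: orient_tree_edge_def)

lemma orient_parent_tree:
  assumes "rooted V p r"
  shows "orient (parent_tree V p r + h) (parent_tree V p r) r =
    parent_orientation V p r + image_mset (image_mset (Pair Target)) h"
proof -
  have "image_mset f (parent_tree V p r) = parent_orientation V p r"
    if "\<And>v. v \<in> V - {r} \<Longrightarrow> f {#p v, v#} = {#(Target, p v), (Source, v)#}" for f
    using that assms unfolding parent_orientation_def parent_tree_def multiset.map_comp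
    by (intro image_mset_cong) (auto simp: rooted_def)
  from this[OF orient_tree_edge_parent_tree[OF assms]] show ?thesis by (simp add: orient_def)
qed

lemma parent_parent_tree:
  assumes "rooted V p r" "v \<in> V - {r}"
  shows "parent (parent_tree V p r) r v = p v"
  unfolding parent_def
proof (rule the_equality)
  show "{#p v, v#} \<in># parent_tree V p r \<and>
      graph_dist (parent_tree V p r) r (p v) < graph_dist (parent_tree V p r) r v"
    using assms graph_dist_parent_tree[OF assms] by (auto simp: in_parent_tree)
next
  fix q assume q: "{#q, v#} \<in># parent_tree V p r \<and>
      graph_dist (parent_tree V p r) r q < graph_dist (parent_tree V p r) r v"
  then obtain x where x: "x \<in> V - {r}" "{#q, v#} = {#p x, x#}" using in_parent_tree[OF assms(1)] by blast
  then show "q = p v" using graph_dist_parent_tree[OF assms(1) x(1)] q by (auto simp: pair_mset_eq)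
qed

lemma children_parent_tree:
  assumes "rooted V p r"
  shows "children (parent_tree V p r) r s = {c \<in> V - {r}. p c = s}"
proof (intro equalityI subsetI)
  fix c assume c: "c \<in> children (parent_tree V p r) r s"
  then obtain x where x: "x \<in> V - {r}" "{#c, s#} = {#p x, x#}"
    using in_parent_tree[OF assms] by (auto simp: children_def)
  then show "c \<in> {c \<in> V - {r}. p c = s}"
    using graph_dist_parent_tree[OF assms x(1)] c by (auto simp: pair_mset_eq children_def)
next
  fix c assume "c \<in> {c \<in> V - {r}. p c = s}"
  then show "c \<in> children (parent_tree V p r) r s"
    using graph_dist_parent_tree[OF assms, of c] assms
    by (auto simp: children_def in_parent_tree pair_mset_eq)
qed

lemma rooted_image:
  assumes "rooted V p r" "inj_on \<sigma> V"
  defines "p' \<equiv> \<lambda>w. \<sigma> (p (inv_into V \<sigma> w))"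
  shows "rooted (\<sigma> ` V) p' (\<sigma> r)"
    and "parent_orientation (\<sigma> ` V) p' (\<sigma> r) =
      image_mset (image_mset (map_prod id \<sigma>)) (parent_orientation V p r)"
    and "parent_tree (\<sigma> ` V) p' (\<sigma> r) = image_mset (image_mset \<sigma>) (parent_tree V p r)"
proof -
  have r: "r \<in> V" and fin: "finite V" using assms(1) by (auto simp: rooted_def)
  have V: "\<sigma> ` V - {\<sigma> r} = \<sigma> ` (V - {r})" using assms(2) r by (auto simp: inj_on_def)
  have inj: "inj_on \<sigma> (V - {r})" using assms(2) by (rule inj_on_subset) auto
  have p': "v \<in> V \<Longrightarrow> p' (\<sigma> v) = \<sigma> (p v)" for v using assms(2) by (simp add: p'_def)
  obtain d :: "'a \<Rightarrow> nat" where d: "\<forall>v\<in>V - {r}. p v \<in> V \<and> d (p v) < d v"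
    using assms(1) unfolding rooted_def by blast
  show "rooted (\<sigma> ` V) p' (\<sigma> r)"
    unfolding rooted_def V
  proof (intro conjI exI[of _ "\<lambda>w. d (inv_into V \<sigma> w)"] ballI)
    fix w assume "w \<in> \<sigma> ` (V - {r})"
    then obtain v where v: "v \<in> V - {r}" "w = \<sigma> v" by blast
    then show "p' w \<in> \<sigma> ` V" "d (inv_into V \<sigma> (p' w)) < d (inv_into V \<sigma> w)"
      using d[rule_format, OF v(1)] assms(2) by (auto simp: p')
  qed (use r fin in auto)
  show "parent_orientation (\<sigma> ` V) p' (\<sigma> r) =
      image_mset (image_mset (map_prod id \<sigma>)) (parent_orientation V p r)"
    unfolding parent_orientation_def V image_mset_mset_set[OF inj, symmetric] multiset.map_comp
    using fin by (intro image_mset_cong) (auto simp: p')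
  show "parent_tree (\<sigma> ` V) p' (\<sigma> r) = image_mset (image_mset \<sigma>) (parent_tree V p r)"
    unfolding parent_tree_def V image_mset_mset_set[OF inj, symmetric] multiset.map_comp
    using fin by (intro image_mset_cong) (auto simp: p')
qed

section \<open>Orientations from spanning trees and the Hadamard product\<close>

abbreviation targets :: "'v multigraph \<Rightarrow> 'v or_multigraph" where
  "targets h \<equiv> image_mset (image_mset (Pair Target)) h"

definition st_basis :: "'v set \<Rightarrow> ('v or_multigraph \<times> 'v) set" where
  "st_basis V = {(parent_orientation V p r + targets h, r) | p r h. rooted V p r \<and> h \<in> multigraphs V}"

lemma connected_on_add:
  assumes "connected_on V t" "h \<in> multigraphs V"
  shows "connected_on V (t + h)"
proof -
  have "(adjacency t)\<^sup>* \<subseteq> (adjacency (t + h))\<^sup>*" by (intro rtrancl_mono adjacency_mono) simp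
  then show ?thesis using assms by (auto simp: connected_on_def multigraphs_union)
qed

lemma ST_eq_span:
  assumes "finite V"
  shows "(ST V :: (_ \<Rightarrow>\<^sub>0 'k::field) set) = fs.span (basis ` st_basis V)"
proof -
  have "basis (orient g t r, r) \<in> (basis ` st_basis V :: (_ \<Rightarrow>\<^sub>0 'k) set)"
    if g: "connected_on V g" "r \<in> V" "spanning_tree V g t" for g t r
  proof -
    have t: "t \<subseteq># g" "tree_on V t" using g(3) by (auto simp: spanning_tree_def)
    obtain p where p: "rooted V p r" "t = parent_tree V p r"
      using tree_on_parents[OF t(2) assms g(2)] by blast
    have g': "g = t + (g - t)" using t(1) by (simp add: subset_mset.add_diff_inverse)
    then have "g - t \<in> multigraphs V" using g(1) by (metis connected_on_def multigraphs_union)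
    moreover have "orient g t r = parent_orientation V p r + targets (g - t)"
      using orient_parent_tree[OF p(1), of "g - t"] g' p(2) by simp
    ultimately show ?thesis using p(1) by (auto simp: st_basis_def)
  qed
  moreover have "\<exists>g t. b = (orient g t r, r) \<and> connected_on V g \<and> r \<in> V \<and> spanning_tree V g t"
    if "rooted V p r" "h \<in> multigraphs V" "b = (parent_orientation V p r + targets h, r)" for b p r h
  proof -
    have "connected_on V (parent_tree V p r + h)"
      using connected_on_add[OF connected_on_parent_tree[OF that(1)] that(2)] .
    then show ?thesis
      using that orient_parent_tree[OF that(1), of h] tree_on_parent_tree[OF that(1)]
      by (intro exI[of _ "parent_tree V p r + h"] exI[of _ "parent_tree V p r"])
        (auto simp: spanning_tree_def rooted_def)
  qed
  ultimately have "{basis (orient g t r, r) | g t r. connected_on V g \<and> r \<in> V \<and> spanning_tree V g t} =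
      (basis ` st_basis V :: (_ \<Rightarrow>\<^sub>0 'k) set)"
  proof (intro equalityI subsetI, goal_cases)
    case (1 x)
    from this(3) obtain g t r where "x = basis (orient g t r, r)" "connected_on V g" "r \<in> V" "spanning_tree V g t"
      by blast
    with 1(1)[of g r t] show ?case by simp
  next
    case (2 x)
    from this(3) obtain b where b: "x = basis b" "b \<in> st_basis V" by (rule imageE)
    then obtain p r h where "rooted V p r" "h \<in> multigraphs V" "b = (parent_orientation V p r + targets h, r)"
      unfolding st_basis_def by blast
    from 2(2)[OF this] obtain g t where
      "b = (orient g t r, r)" "connected_on V g" "r \<in> V" "spanning_tree V g t" by blast
    with b(1) show ?case by blast
  qed
  then show ?thesis by (simp add: ST_def)
qed

lemma underlying_parent_orientation [simp]: "underlying (parent_orientation V p r) = parent_tree V p r"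
  by (simp add: underlying_def parent_orientation_def parent_tree_def multiset.map_comp comp_def)

lemma underlying_targets [simp]: "underlying (targets h) = h"
  by (simp add: underlying_def multiset.map_comp comp_def)

lemma st_basis_subset: "st_basis V \<subseteq> orc_basis V"
proof
  fix b assume "b \<in> st_basis V"
  then obtain p r h where b: "rooted V p r" "h \<in> multigraphs V" "b = (parent_orientation V p r + targets h, r)"
    unfolding st_basis_def by blast
  have "connected_on V (parent_tree V p r + h)"
    using connected_on_add[OF connected_on_parent_tree[OF b(1)] b(2)] .
  moreover from this have "parent_tree V p r + h \<in> multigraphs V" by (simp add: connected_on_def)
  ultimately show "b \<in> orc_basis V"
    using b(1) by (simp add: b(3) orc_basis_def or_multigraphs_def rooted_def)
qed

lemma st_basis_relabel:
  assumes "finite V" "inj_on \<sigma> V" "b \<in> st_basis V"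
  shows "relabel \<sigma> b \<in> st_basis (\<sigma> ` V)"
proof -
  obtain p r h where b: "rooted V p r" "h \<in> multigraphs V" "b = (parent_orientation V p r + targets h, r)"
    using assms(3) by (auto simp: st_basis_def)
  have "relabel \<sigma> b = (parent_orientation (\<sigma> ` V) (\<lambda>w. \<sigma> (p (inv_into V \<sigma> w))) (\<sigma> r) +
      targets (image_mset (image_mset \<sigma>) h), \<sigma> r)"
    unfolding b(3) by (simp add: relabel_def rooted_image(2)[OF b(1) assms(2)] multiset.map_comp comp_def)
  then show ?thesis
    using rooted_image(1)[OF b(1) assms(2)] multigraphs_image[OF b(2)] by (auto simp: st_basis_def)
qed

lemma multigraphs_reconnect_vertex:
  assumes "finite V2" "h \<in> multigraphs (insert s V1)" "k \<in># choices (choices (reconnect_vertex s V2)) h"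
  shows "k \<in> multigraphs (V1 \<union> V2)"
  unfolding multigraphs_def
proof (intro CollectI ballI conjI subsetI)
  fix e assume e: "e \<in># k"
  then show "size e = 2" using in_choices_set[OF assms(3) e] assms(2)
    by (auto simp: multigraphs_def dest: in_choices_size)
  fix y assume "y \<in># e"
  from in_choices_ends[OF assms(3) e this] obtain e' x
    where "e' \<in># h" "x \<in># e'" "y \<in># reconnect_vertex s V2 x" by blast
  then show "y \<in> V1 \<union> V2" using assms(1,2)
    by (auto simp: multigraphs_def reconnect_vertex_def split: if_splits)
qed

text \<open>
  Parent functions of the trees in a composite: \<open>f\<close> attaches each child of \<open>s\<close> to a vertex of \<open>V\<^sub>2\<close>.
  If \<open>s\<close> was the root, the value at \<open>r\<^sub>2\<close> is irrelevant.
\<close>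

definition graft_parents ::
  "'v set \<Rightarrow> ('v \<Rightarrow> 'v) \<Rightarrow> 'v \<Rightarrow> ('v \<Rightarrow> 'v) \<Rightarrow> 'v \<Rightarrow> ('v \<Rightarrow> 'v) \<Rightarrow> 'v \<Rightarrow> 'v" where
  "graft_parents V2 p1 s p2 r2 f v =
     (if v \<in> V2 then if v = r2 then p1 s else p2 v else if p1 v = s then f v else p1 v)"

context
  fixes V1 V2 :: "'v set" and s r1 r2 :: 'v and p1 p2 :: "'v \<Rightarrow> 'v"
  assumes comp: "composable V1 s V2" and p1: "rooted (insert s V1) p1 r1" and p2: "rooted V2 p2 r2"
begin

definition "heirs = {c \<in> insert s V1 - {r1}. p1 c = s}"
definition "graft_root = (if r1 = s then r2 else r1)"

lemma s_notin: "s \<notin> V1" "V1 \<inter> V2 = {}" "finite V1" "finite V2"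
  using comp by (auto simp: composable_def)

lemma p1_s:
  assumes "r1 \<noteq> s"
  shows "p1 s \<noteq> s"
proof -
  obtain d :: "'v \<Rightarrow> nat" where "\<forall>v\<in>insert s V1 - {r1}. d (p1 v) < d v"
    using p1 unfolding rooted_def by blast
  then have "d (p1 s) < d s" using assms by blast
  then show ?thesis by auto
qed

lemma heirs_subset: "heirs \<subseteq> V1 - {r1}"
  using p1_s by (auto simp: heirs_def)

lemma finite_heirs: "finite heirs"
  using heirs_subset s_notin(3) by (meson finite_Diff finite_subset)

lemma rooted_graft:
  assumes f: "f \<in> heirs \<rightarrow>\<^sub>E V2"
  shows "rooted (V1 \<union> V2) (graft_parents V2 p1 s p2 r2 f) graft_root"
proof -
  obtain d1 :: "'v \<Rightarrow> nat" where d1: "\<forall>v\<in>insert s V1 - {r1}. p1 v \<in> insert s V1 \<and> d1 (p1 v) < d1 v"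
    using p1 unfolding rooted_def by blast
  obtain d2 :: "'v \<Rightarrow> nat" where d2: "\<forall>v\<in>V2 - {r2}. p2 v \<in> V2 \<and> d2 (p2 v) < d2 v"
    using p2 unfolding rooted_def by blast
  define N where "N = Suc (Max (d2 ` V2))"
  have N: "d2 v < N" if "v \<in> V2" for v
    using that s_notin(4) by (simp add: N_def less_Suc_eq_le)
  have step: "a * N + x < b * N" if "a < b" "x < N" for a b x
  proof -
    have "a * N + x < Suc a * N" using that(2) by simp
    also have "\<dots> \<le> b * N" using that(1) by (intro mult_right_mono) auto
    finally show ?thesis .
  qed
  let ?q = "graft_parents V2 p1 s p2 r2 f"
  let ?d = "\<lambda>v. if v \<in> V2 then d1 s * N + d2 v else d1 v * N"
  have "?q v \<in> V1 \<union> V2 \<and> ?d (?q v) < ?d v" if v: "v \<in> V1 \<union> V2 - {graft_root}" for v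
  proof (cases "v \<in> V2")
    case True
    show ?thesis
    proof (cases "v = r2")
      case True
      then have "s \<noteq> r1" using v by (auto simp: graft_root_def)
      then have "p1 s \<in> insert s V1 \<and> d1 (p1 s) < d1 s" using d1 by auto
      then have "p1 s \<in> V1" "p1 s \<notin> V2" "d1 (p1 s) < d1 s" using s_notin by auto
      moreover have "d1 (p1 s) * N < d1 s * N"
        using calculation(3) by (intro mult_strict_right_mono) (simp_all add: N_def)
      then have "d1 (p1 s) * N < d1 s * N + d2 v" by (rule trans_less_add1)
      moreover have "?q v = p1 s" using True \<open>v \<in> V2\<close> by (simp add: graft_parents_def)
      ultimately show ?thesis using \<open>v \<in> V2\<close> by simp
    next
      case False
      then show ?thesis using True d2 by (auto simp: graft_parents_def)
    qed
  next
    case False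
    then have v1: "v \<in> insert s V1 - {r1}" "v \<in> V1" using v s_notin by (auto simp: graft_root_def split: if_splits)
    show ?thesis
    proof (cases "p1 v = s")
      case True
      then have "f v \<in> V2" using f v1 by (auto simp: heirs_def)
      moreover have "d1 (p1 v) < d1 v" using d1 v1 by blast
      then have "d1 s < d1 v" using True by simp
      moreover have "?q v = f v" using False True by (simp add: graft_parents_def)
      ultimately show ?thesis using False step[of "d1 s" "d1 v" "d2 (f v)"] N[of "f v"] by simp
    next
      case p: False
      then have "p1 v \<in> V1" "d1 (p1 v) < d1 v" using d1 v1 by blast+
      moreover have "p1 v \<notin> V2" using calculation s_notin by auto
      moreover have "N > 0" by (simp add: N_def)
      moreover have "?q v = p1 v" using False p by (simp add: graft_parents_def)
      ultimately show ?thesis using False by simp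
    qed
  qed
  moreover have "graft_root \<in> V1 \<union> V2" using p1 p2 by (auto simp: graft_root_def rooted_def)
  ultimately show ?thesis
    unfolding rooted_def using s_notin by (intro conjI exI[of _ ?d] ballI) simp_all
qed

lemma image_graft_vertices:
  "image_mset g (mset_set (V1 \<union> V2 - {graft_root})) =
     image_mset g (mset_set heirs) + image_mset g (mset_set {c \<in> V1 - {r1}. p1 c \<noteq> s}) +
     image_mset g (mset_set (V2 - {r2})) + (if r1 = s then {#} else {#g r2#})"
proof -
  have r: "r1 \<in> insert s V1" "r2 \<in> V2" using p1 p2 by (auto simp: rooted_def)
  let ?E = "{c \<in> V1 - {r1}. p1 c \<noteq> s}" and ?S = "if r1 = s then {} else {r2}"
  have "V1 \<union> V2 - {graft_root} = heirs \<union> ?E \<union> (V2 - {r2}) \<union> ?S"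
    using r s_notin heirs_subset by (auto simp: graft_root_def heirs_def)
  moreover have "mset_set (heirs \<union> ?E) = mset_set heirs + mset_set ?E"
    using s_notin finite_heirs by (intro mset_set_Union) (auto simp: heirs_def)
  moreover have "mset_set (heirs \<union> ?E \<union> (V2 - {r2})) = mset_set (heirs \<union> ?E) + mset_set (V2 - {r2})"
    using s_notin finite_heirs heirs_subset by (intro mset_set_Union) auto
  moreover have "mset_set (heirs \<union> ?E \<union> (V2 - {r2}) \<union> ?S) =
      mset_set (heirs \<union> ?E \<union> (V2 - {r2})) + mset_set ?S"
    using s_notin finite_heirs heirs_subset r by (intro mset_set_Union) auto
  ultimately show ?thesis by (simp only: image_mset_union) simp
qed

lemma image_old_vertices:
  "image_mset g (mset_set (insert s V1 - {r1})) =
     image_mset g (mset_set heirs) + image_mset g (mset_set {c \<in> V1 - {r1}. p1 c \<noteq> s}) +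
     (if r1 = s then {#} else {#g s#})"
proof -
  let ?E = "{c \<in> V1 - {r1}. p1 c \<noteq> s}" and ?S = "if r1 = s then {} else {s}"
  have "insert s V1 - {r1} = heirs \<union> ?E \<union> ?S"
    using s_notin heirs_subset by (auto simp: heirs_def)
  moreover have "mset_set (heirs \<union> ?E) = mset_set heirs + mset_set ?E"
    using s_notin finite_heirs by (intro mset_set_Union) (auto simp: heirs_def)
  moreover have "mset_set (heirs \<union> ?E \<union> ?S) = mset_set (heirs \<union> ?E) + mset_set ?S"
    using s_notin finite_heirs heirs_subset by (intro mset_set_Union) auto
  ultimately show ?thesis by (simp only: image_mset_union) simp
qed

lemma parent_orientation_graft:
  "parent_orientation (V1 \<union> V2) (graft_parents V2 p1 s p2 r2 f) graft_root =
     {#{#(Target, f c), (Source, c)#}. c \<in># mset_set heirs#} +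
     {#{#(Target, p1 c), (Source, c)#}. c \<in># mset_set {c \<in> V1 - {r1}. p1 c \<noteq> s}#} +
     parent_orientation V2 p2 r2 + (if r1 = s then {#} else {#{#(Target, p1 s), (Source, r2)#}#})"
proof -
  have r2: "r2 \<in> V2" using p2 by (simp add: rooted_def)
  let ?g = "\<lambda>v. {#(Target, graft_parents V2 p1 s p2 r2 f v), (Source, v)#}"
  let ?E = "{c \<in> V1 - {r1}. p1 c \<noteq> s}"
  have "image_mset ?g (mset_set heirs) = {#{#(Target, f c), (Source, c)#}. c \<in># mset_set heirs#}"
  proof (rule image_mset_cong)
    fix c assume "c \<in># mset_set heirs"
    then have "c \<in> heirs" using finite_heirs by simp
    then have "p1 c = s" "c \<notin> V2" using heirs_subset s_notin by (auto simp: heirs_def)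
    then show "?g c = {#(Target, f c), (Source, c)#}" by (simp add: graft_parents_def)
  qed
  moreover have "image_mset ?g (mset_set ?E) = {#{#(Target, p1 c), (Source, c)#}. c \<in># mset_set ?E#}"
  proof (rule image_mset_cong)
    fix c assume "c \<in># mset_set ?E"
    then have "p1 c \<noteq> s" "c \<notin> V2" using s_notin by auto
    then show "?g c = {#(Target, p1 c), (Source, c)#}" by (simp add: graft_parents_def)
  qed
  moreover have "image_mset ?g (mset_set (V2 - {r2})) = {#{#(Target, p2 c), (Source, c)#}. c \<in># mset_set (V2 - {r2})#}"
    using s_notin by (intro image_mset_cong) (auto simp: graft_parents_def)
  moreover have "?g r2 = {#(Target, p1 s), (Source, r2)#}"
    using r2 by (simp add: graft_parents_def)
  ultimately show ?thesis
    unfolding parent_orientation_def image_graft_vertices by (simp only:)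
qed

lemma parent_tree_graft:
  "parent_tree (V1 \<union> V2) (graft_parents V2 p1 s p2 r2 f) graft_root =
     {#{#f c, c#}. c \<in># mset_set heirs#} +
     {#{#p1 c, c#}. c \<in># mset_set {c \<in> V1 - {r1}. p1 c \<noteq> s}#} +
     parent_tree V2 p2 r2 + (if r1 = s then {#} else {#{#p1 s, r2#}#})"
  using arg_cong[OF parent_orientation_graft, of underlying]
  by (simp add: underlying_def[of "image_mset _ _"] underlying_def[of "add_mset _ _"] multiset.map_comp comp_def
      split: if_splits)

lemma choices_parent_orientation:
  "choices (choices (reconnect s V2 r2)) (parent_orientation (insert s V1) p1 r1) =
     {#{#{#(Target, f c), (Source, c)#}. c \<in># mset_set heirs#} +
       ({#{#(Target, p1 c), (Source, c)#}. c \<in># mset_set {c \<in> V1 - {r1}. p1 c \<noteq> s}#} +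
        (if r1 = s then {#} else {#{#(Target, p1 s), (Source, r2)#}#})).
      f \<in># mset_set (heirs \<rightarrow>\<^sub>E V2)#}"
proof -
  let ?R = "choices (reconnect s V2 r2)"
  let ?e = "\<lambda>c. {#(Target, p1 c), (Source, c)#}"
  have D: "choices (\<lambda>c. ?R (?e c)) (mset_set heirs) =
      {#{#{#(Target, f c), (Source, c)#}. c \<in># mset_set heirs#}. f \<in># mset_set (heirs \<rightarrow>\<^sub>E V2)#}"
  proof -
    have "choices (\<lambda>c. ?R (?e c)) (mset_set heirs) =
        choices (\<lambda>c. {#{#(Target, u), (Source, c)#}. u \<in># mset_set V2#}) (mset_set heirs)"
    proof (rule choices_cong)
      fix c assume "c \<in># mset_set heirs"
      then have "p1 c = s" "c \<noteq> s" using finite_heirs heirs_subset s_notin by (auto simp: heirs_def)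
      then show "?R (?e c) = {#{#(Target, u), (Source, c)#}. u \<in># mset_set V2#}"
        by (simp add: reconnect_Source reconnect_Target Sum_mset_image multiset.map_comp comp_def)
    qed
    then show ?thesis using choices_mset_set[OF finite_heirs, of "\<lambda>c u. {#(Target, u), (Source, c)#}" V2] by simp
  qed
  have E: "choices (\<lambda>c. ?R (?e c)) (mset_set {c \<in> V1 - {r1}. p1 c \<noteq> s}) =
      {#image_mset ?e (mset_set {c \<in> V1 - {r1}. p1 c \<noteq> s})#}"
    unfolding choices_singleton[symmetric]
    using s_notin by (intro choices_cong) (auto simp: reconnect_Source reconnect_Target)
  have S: "choices ?R (if r1 = s then {#} else {#?e s#}) =
      {#if r1 = s then {#} else {#{#(Target, p1 s), (Source, r2)#}#}#}"
    using p1_s by (simp add: reconnect_Source reconnect_Target)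
  show ?thesis
    unfolding parent_orientation_def image_old_vertices choices_union choices_image D E S
    by (simp only: image_mset_single Sum_mset_image multiset.map_comp comp_def sum_mset_singleton_mset add.assoc)
qed

lemma choices_targets:
  "choices (choices (reconnect s V2 r2)) (targets h) =
     image_mset (\<lambda>k. targets k) (choices (choices (reconnect_vertex s V2)) h)"
proof -
  have "reconnect s V2 r2 (Target, v) = image_mset (Pair Target) (reconnect_vertex s V2 v)" for v
    by (simp add: reconnect_Target reconnect_vertex_def)
  then show ?thesis by (simp add: choices_image image_choices)
qed

lemma graft_tree:
  "graft V1 s V2 (parent_orientation (insert s V1) p1 r1 + targets h1, r1)
     (parent_orientation V2 p2 r2 + targets h2, r2) =
   (\<Sum>k\<in>#choices (choices (reconnect_vertex s V2)) h1.
     {#(parent_orientation (V1 \<union> V2) (graft_parents V2 p1 s p2 r2 f) graft_root + targets (k + h2),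
        graft_root). f \<in># mset_set (heirs \<rightarrow>\<^sub>E V2)#})"
proof -
  have "graft V1 s V2 (targets h1 + parent_orientation (insert s V1) p1 r1, r1)
     (parent_orientation V2 p2 r2 + targets h2, r2) =
   (\<Sum>k\<in>#choices (choices (reconnect_vertex s V2)) h1.
     {#(parent_orientation (V1 \<union> V2) (graft_parents V2 p1 s p2 r2 f) graft_root + targets (k + h2),
        graft_root). f \<in># mset_set (heirs \<rightarrow>\<^sub>E V2)#})"
    unfolding parent_orientation_graft graft_root_def[symmetric]
    by (simp only: graft_def prod.case choices_union choices_parent_orientation choices_targets
        graft_root_def[symmetric] Sum_mset_image image_mset_Sum multiset.map_comp comp_def image_mset_union add_ac)
  then show ?thesis by (simp add: add.commute)
qed

lemma graft_tree_closed:
  assumes "h1 \<in> multigraphs (insert s V1)" "h2 \<in> multigraphs V2"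
    and "c \<in># graft V1 s V2 (parent_orientation (insert s V1) p1 r1 + targets h1, r1)
     (parent_orientation V2 p2 r2 + targets h2, r2)"
  shows "c \<in> st_basis (V1 \<union> V2)"
proof -
  obtain k f where k: "k \<in># choices (choices (reconnect_vertex s V2)) h1" and
    f: "f \<in># mset_set (heirs \<rightarrow>\<^sub>E V2)" and
    c: "c = (parent_orientation (V1 \<union> V2) (graft_parents V2 p1 s p2 r2 f) graft_root + targets (k + h2), graft_root)"
    using assms(3) unfolding graft_tree by auto
  have f': "f \<in> heirs \<rightarrow>\<^sub>E V2" using f by (metis elem_mset_set empty_iff mset_set.infinite set_mset_empty)
  have kh: "k + h2 \<in> multigraphs (V1 \<union> V2)"
    using multigraphs_reconnect_vertex[OF s_notin(4) assms(1) k] multigraphs_mono[OF assms(2)]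
    by (simp add: multigraphs_union)
  show ?thesis
    unfolding st_basis_def c using rooted_graft[OF f'] kh by blast
qed

lemma PLie_comp:
  "pcomp (PLie :: ('v, _, 'k::field) operad_data) V1 s V2
     (basis (parent_tree (insert s V1) p1 r1, r1)) (basis (parent_tree V2 p2 r2, r2)) =
   formal_sum {#(parent_tree (V1 \<union> V2) (graft_parents V2 p1 s p2 r2 f) graft_root, graft_root).
     f \<in># mset_set (heirs \<rightarrow>\<^sub>E V2)#}"
proof -
  let ?t1 = "parent_tree (insert s V1) p1 r1"
  have ch: "children ?t1 r1 s = heirs" by (simp add: children_parent_tree[OF p1] heirs_def)
  have par: "parent ?t1 r1 s = p1 s" if "r1 \<noteq> s"
    using that by (intro parent_parent_tree[OF p1]) auto
  have "filter_mset (\<lambda>e. s \<notin># e) (image_mset (\<lambda>v. {#p1 v, v#}) (mset_set heirs)) = {#}"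
    using finite_heirs by (auto simp: filter_mset_eq_conv heirs_def)
  moreover have "filter_mset (\<lambda>e. s \<notin># e)
      (image_mset (\<lambda>v. {#p1 v, v#}) (mset_set {c \<in> V1 - {r1}. p1 c \<noteq> s})) =
      image_mset (\<lambda>v. {#p1 v, v#}) (mset_set {c \<in> V1 - {r1}. p1 c \<noteq> s})"
    using s_notin by (auto simp: filter_mset_eq_conv)
  ultimately have rest: "{#e \<in># ?t1. s \<notin># e#} =
      {#{#p1 c, c#}. c \<in># mset_set {c \<in> V1 - {r1}. p1 c \<noteq> s}#}"
    unfolding parent_tree_def image_old_vertices by auto
  have "{#e \<in># ?t1. s \<notin># e#} + parent_tree V2 p2 r2 + (if r1 = s then {#} else {#{#parent ?t1 r1 s, r2#}#})
      + {#{#c, f c#}. c \<in># mset_set heirs#} =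
      parent_tree (V1 \<union> V2) (graft_parents V2 p1 s p2 r2 f) graft_root" for f
    unfolding rest parent_tree_graft using par by (auto simp: add_ac add_mset_commute)
  then show ?thesis
    by (simp add: PLie_def ch formal_sum_def sum_unfold_sum_mset multiset.map_comp comp_def graft_root_def)
qed

end

lemma graft_st_basis:
  assumes "composable V1 s V2" "a \<in> st_basis (insert s V1)" "b \<in> st_basis V2" "c \<in># graft V1 s V2 a b"
  shows "c \<in> st_basis (V1 \<union> V2)"
  using assms graft_tree_closed[OF assms(1)] unfolding st_basis_def[of "insert s V1"] st_basis_def[of V2]
  by blast

lemma suboperad_ST: "suboperad ST (MG_orc :: ('v, 'v or_multigraph \<times> 'v, 'k::field) operad_data)"
  unfolding MG_orc_eq_basis_operad
proof (rule suboperad_basis_operad)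
  show "operad (basis_operad orc_basis relabel (\<lambda>v. ({#}, v)) graft :: ('v, 'v or_multigraph \<times> 'v, 'k) operad_data)"
    using operad_MG_orc unfolding MG_orc_eq_basis_operad .
  show "({#}, v) \<in> st_basis {v}" for v :: 'v
    by (auto simp: st_basis_def parent_orientation_def rooted_def multigraphs_def intro!: exI[of _ "{#}"])
qed ((rule ST_eq_span st_basis_subset st_basis_relabel graft_st_basis; assumption)+)

definition split_st :: "'v or_multigraph \<times> 'v \<Rightarrow> 'v multigraph \<times> 'v multigraph \<times> 'v" where
  "split_st = (\<lambda>(g, r). (underlying {#e \<in># g. Source \<notin># image_mset fst e#},
     underlying {#e \<in># g. Source \<in># image_mset fst e#}, r))"

lemma split_st:
  "split_st (parent_orientation V p r + targets h, r) = (h, parent_tree V p r, r)"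
proof -
  have "{#e \<in># parent_orientation V p r. Source \<in># image_mset fst e#} = parent_orientation V p r"
    "{#e \<in># parent_orientation V p r. Source \<notin># image_mset fst e#} = {#}"
    by (auto simp: filter_mset_eq_conv parent_orientation_def)
  moreover have "filter_mset (\<lambda>e. Source \<in># image_mset fst e) (targets h) = {#}"
    "filter_mset (\<lambda>e. Source \<notin># image_mset fst e) (targets h) = targets h"
    by (auto simp: filter_mset_eq_conv)
  ultimately show ?thesis
    by (simp only: split_st_def prod.case filter_union_mset underlying_parent_orientation underlying_targets
        add_0_left add_0_right underlying_union underlying_empty)
qed

lemma parent_orientation_eqI:
  assumes "rooted V p r" "rooted V p' r" "parent_tree V p r = parent_tree V p' r"
  shows "parent_orientation V p r = parent_orientation V p' r"
  unfolding parent_orientation_def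
  using parent_tree_parents_unique[OF assms] assms(1)
  by (intro image_mset_cong) (auto simp: rooted_def)

lemma split_st_inj: "inj_on split_st (st_basis V)"
  by (rule inj_onI) (auto simp: st_basis_def split_st intro: parent_orientation_eqI)

lemma split_st_image:
  assumes "finite V"
  shows "split_st ` st_basis V = multigraphs V \<times> {(t, r). tree_on V t \<and> r \<in> V}"
proof (intro equalityI subsetI)
  fix x assume "x \<in> split_st ` st_basis V"
  then show "x \<in> multigraphs V \<times> {(t, r). tree_on V t \<and> r \<in> V}"
    by (auto simp: st_basis_def split_st tree_on_parent_tree) (auto simp: rooted_def)
next
  fix x assume "x \<in> multigraphs V \<times> {(t, r). tree_on V t \<and> r \<in> V}"
  then obtain h t r where x: "x = (h, t, r)" "h \<in> multigraphs V" "tree_on V t" "r \<in> V" by auto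
  obtain p where p: "rooted V p r" "t = parent_tree V p r"
    using tree_on_parents[OF x(3) assms x(4)] by blast
  then have "x = split_st (parent_orientation V p r + targets h, r)" using x by (simp add: split_st)
  then show "x \<in> split_st ` st_basis V" using p x by (auto simp: st_basis_def)
qed

lemma space_hadamard_MG_PLie:
  assumes "finite V"
  shows "space (hadamard MG PLie :: ('v, _, 'k::field) operad_data) V = fs.span (basis ` split_st ` st_basis V)"
proof -
  have mg: "{basis g | g. g \<in> multigraphs V \<and> V \<noteq> {}} =
      (basis ` {g \<in> multigraphs V. V \<noteq> {}} :: ('v multigraph \<Rightarrow>\<^sub>0 'k) set)" by auto
  have pl: "{basis (t, r) | t r. tree_on V t \<and> r \<in> V} =
      (basis ` {(t, r). tree_on V t \<and> r \<in> V} :: ('v multigraph \<times> 'v \<Rightarrow>\<^sub>0 'k) set)" by auto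
  have "{g \<in> multigraphs V. V \<noteq> {}} \<times> {(t, r). tree_on V t \<and> r \<in> V} = split_st ` st_basis V"
    unfolding split_st_image[OF assms] by auto
  then show ?thesis
    by (simp add: hadamard_def MG_def PLie_def mg pl span_tensor_basis)
qed

lemma split_st_relabel:
  assumes "finite V" "inj_on \<sigma> V" "b \<in> st_basis V" "split_st b = (h, t, r)"
  shows "split_st (relabel \<sigma> b) = (image_mset (image_mset \<sigma>) h, image_mset (image_mset \<sigma>) t, \<sigma> r)"
proof -
  obtain p r' h' where b: "rooted V p r'" "h' \<in> multigraphs V" "b = (parent_orientation V p r' + targets h', r')"
    using assms(3) by (auto simp: st_basis_def)
  have hr: "h = h'" "t = parent_tree V p r'" "r = r'"
    using assms(4) unfolding b(3) split_st by blast+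
  have "relabel \<sigma> b = (parent_orientation (\<sigma> ` V) (\<lambda>w. \<sigma> (p (inv_into V \<sigma> w))) (\<sigma> r') +
      targets (image_mset (image_mset \<sigma>) h'), \<sigma> r')"
    unfolding b(3) by (simp add: relabel_def rooted_image(2)[OF b(1) assms(2)] multiset.map_comp comp_def)
  then show ?thesis by (simp add: split_st hr rooted_image(3)[OF b(1) assms(2)])
qed

lemma hadamard_comp_graft:
  assumes "composable V1 s V2" "a \<in> st_basis (insert s V1)" "b \<in> st_basis V2"
  shows "pcomp (hadamard MG PLie :: ('v, _, 'k::field) operad_data) V1 s V2
      (basis (split_st a)) (basis (split_st b)) =
    formal_sum (image_mset split_st (graft V1 s V2 a b))"
proof -
  obtain p1 r1 h1 where a: "rooted (insert s V1) p1 r1"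
    "a = (parent_orientation (insert s V1) p1 r1 + targets h1, r1)"
    using assms(2) by (auto simp: st_basis_def)
  obtain p2 r2 h2 where b: "rooted V2 p2 r2" "b = (parent_orientation V2 p2 r2 + targets h2, r2)"
    using assms(3) by (auto simp: st_basis_def)
  note ctxt = assms(1) a(1) b(1)
  have "pcomp (MG :: ('v, _, 'k) operad_data) V1 s V2 (basis h1) (basis h2) =
      formal_sum {#k + h2. k \<in># choices (choices (reconnect_vertex s V2)) h1#}"
    by (simp add: MG_def reconnect_vertex_def[abs_def])
  moreover have "image_mset split_st (graft V1 s V2 a b) =
      (\<Sum>k\<in>#choices (choices (reconnect_vertex s V2)) h1.
        {#(k + h2, parent_tree (V1 \<union> V2) (graft_parents V2 p1 s p2 r2 f) (graft_root s r1 r2),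
           graft_root s r1 r2). f \<in># mset_set (heirs V1 s r1 p1 \<rightarrow>\<^sub>E V2)#})"
    unfolding a(2) b(2) graft_tree[OF ctxt]
    by (simp add: image_mset_Sum multiset.map_comp comp_def split_st del: image_mset_union)
  ultimately show ?thesis
    unfolding a(2) b(2) split_st
    by (simp add: hadamard_def PLie_comp[OF ctxt] tensor_formal_sum Sum_mset_image multiset.map_comp comp_def)
qed

lemma operad_isomorphic_ST:
  "operad_isomorphic (restrict_to MG_orc ST)
     (hadamard MG PLie :: ('v, 'v multigraph \<times> 'v multigraph \<times> 'v, 'k::field) operad_data)"
proof (rule operad_isomorphic_transfer[where \<phi> = "lin_ext (\<lambda>b. basis (split_st b))"])
  let ?Q = "hadamard MG PLie :: ('v, 'v multigraph \<times> 'v multigraph \<times> 'v, 'k) operad_data"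
  have tr_MG: "transport (MG_orc :: ('v, _, 'k) operad_data) V \<sigma> = lin_ext (\<lambda>b. basis (relabel \<sigma> b))" for V \<sigma>
    by (simp add: MG_orc_eq_basis_operad basis_operad_def)
  have pc_MG: "pcomp (MG_orc :: ('v, _, 'k) operad_data) V1 s V2 =
      bilin_ext (\<lambda>a b. formal_sum (graft V1 s V2 a b))" for V1 s V2
    by (simp add: MG_orc_eq_basis_operad basis_operad_def)
  show "operad (restrict_to MG_orc ST :: ('v, _, 'k) operad_data)"
    by (rule operad_restrict_suboperad[OF suboperad_ST])
  show "finite V \<Longrightarrow> fs.subspace (space ?Q V)" for V by (simp add: space_hadamard_MG_PLie)
  show lin_tr: "linear_on UNIV (transport ?Q V \<sigma>)" for V \<sigma>
    by (simp add: hadamard_def lin_ext_linear_on)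
  show lin_comp: "linear_on UNIV (\<lambda>y. pcomp ?Q V1 s V2 x y)" "linear_on UNIV (\<lambda>x. pcomp ?Q V1 s V2 x y)"
    for V1 s V2 x y
    by (simp_all add: hadamard_def linear_on_bilin_ext_left[OF linear_on_ident]
        linear_on_bilin_ext_right[OF linear_on_ident])
  show lin: "linear_on UNIV (lin_ext (\<lambda>b. basis (split_st b)) :: _ \<Rightarrow> (_ \<Rightarrow>\<^sub>0 'k))" by (rule lin_ext_linear_on)
  show "finite V \<Longrightarrow> bij_betw (lin_ext (\<lambda>b. basis (split_st b)))
      (space (restrict_to MG_orc ST) V) (space ?Q V)" for V
    using bij_betw_span_basis[OF split_st_inj[of V]]
    by (simp add: space_hadamard_MG_PLie ST_eq_span)
  show "lin_ext (\<lambda>b. basis (split_st b)) (unit (restrict_to MG_orc ST) v) = unit ?Q v" for v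
    by (simp add: MG_orc_def MG_or_def hadamard_def MG_def PLie_def split_st_def del: single_one)
  show "lin_ext (\<lambda>b. basis (split_st b)) (transport (restrict_to MG_orc ST) V \<sigma> x) =
      transport ?Q V \<sigma> (lin_ext (\<lambda>b. basis (split_st b)) x)"
    if "finite V" "inj_on \<sigma> V" "x \<in> space (restrict_to MG_orc ST) V" for V \<sigma> x
  proof (rule linear_eq_on_span[where S = "basis ` st_basis V" and
        f = "\<lambda>x. lin_ext (\<lambda>b. basis (split_st b)) (transport (restrict_to MG_orc ST) V \<sigma> x)" and
        g = "\<lambda>x. transport ?Q V \<sigma> (lin_ext (\<lambda>b. basis (split_st b)) x)"])
    show "x \<in> fs.span (basis ` st_basis V)" using that by (simp add: ST_eq_span)
    show "linear_on UNIV (\<lambda>x. lin_ext (\<lambda>b. basis (split_st b) :: _ \<Rightarrow>\<^sub>0 'k) (transport (restrict_to MG_orc ST) V \<sigma> x))"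
      by (simp add: tr_MG) (intro linear_on_intros)
    show "linear_on UNIV (\<lambda>x. transport ?Q V \<sigma> (lin_ext (\<lambda>b. basis (split_st b)) x))"
      by (rule linear_on_compose[OF lin_tr lin])
    fix b :: "_ \<Rightarrow>\<^sub>0 'k" assume "b \<in> basis ` st_basis V"
    then obtain c where c: "c \<in> st_basis V" "b = basis c" by blast
    obtain h t r where s: "split_st c = (h, t, r)" by (cases "split_st c")
    show "lin_ext (\<lambda>b. basis (split_st b)) (transport (restrict_to MG_orc ST) V \<sigma> b) =
        transport ?Q V \<sigma> (lin_ext (\<lambda>b. basis (split_st b)) b)"
      using split_st_relabel[OF that(1,2) c(1) s] s
      by (simp add: c(2) tr_MG hadamard_def MG_def PLie_def)
  qed
  show "lin_ext (\<lambda>b. basis (split_st b)) (pcomp (restrict_to MG_orc ST) V1 s V2 x y) =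
      pcomp ?Q V1 s V2 (lin_ext (\<lambda>b. basis (split_st b)) x) (lin_ext (\<lambda>b. basis (split_st b)) y)"
    if comp: "composable V1 s V2" and x: "x \<in> space (restrict_to MG_orc ST) (insert s V1)"
      and y: "y \<in> space (restrict_to MG_orc ST) V2" for V1 s V2 x y
  proof (rule bilinear_eq_on_span[where S = "basis ` st_basis (insert s V1)" and S' = "basis ` st_basis V2" and
        f = "\<lambda>x y. lin_ext (\<lambda>b. basis (split_st b)) (pcomp (restrict_to MG_orc ST) V1 s V2 x y)" and
        g = "\<lambda>x y. pcomp ?Q V1 s V2 (lin_ext (\<lambda>b. basis (split_st b)) x) (lin_ext (\<lambda>b. basis (split_st b)) y)"])
    have fin: "finite V1" "finite V2" using comp by (auto simp: composable_def)
    show "x \<in> fs.span (basis ` st_basis (insert s V1))" "y \<in> fs.span (basis ` st_basis V2)"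
      using x y fin by (auto simp: ST_eq_span)
    show "linear_on UNIV (\<lambda>x. lin_ext (\<lambda>b. basis (split_st b) :: _ \<Rightarrow>\<^sub>0 'k) (pcomp (restrict_to MG_orc ST) V1 s V2 x y))"
      "linear_on UNIV (\<lambda>y. lin_ext (\<lambda>b. basis (split_st b) :: _ \<Rightarrow>\<^sub>0 'k) (pcomp (restrict_to MG_orc ST) V1 s V2 x y))"
      for x y by (simp_all add: pc_MG) (intro linear_on_intros)+
    show "linear_on UNIV (\<lambda>x. pcomp ?Q V1 s V2 (lin_ext (\<lambda>b. basis (split_st b)) x) (lin_ext (\<lambda>b. basis (split_st b)) y))"
      "linear_on UNIV (\<lambda>y. pcomp ?Q V1 s V2 (lin_ext (\<lambda>b. basis (split_st b)) x) (lin_ext (\<lambda>b. basis (split_st b)) y))"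
      for x y by (rule linear_on_compose[OF _ lin], rule lin_comp)+
    fix a b :: "_ \<Rightarrow>\<^sub>0 'k"
    assume "a \<in> basis ` st_basis (insert s V1)" "b \<in> basis ` st_basis V2"
    then obtain a' b' where "a' \<in> st_basis (insert s V1)" "a = basis a'" "b' \<in> st_basis V2" "b = basis b'"
      by blast
    then show "lin_ext (\<lambda>b. basis (split_st b)) (pcomp (restrict_to MG_orc ST) V1 s V2 a b) =
        pcomp ?Q V1 s V2 (lin_ext (\<lambda>b. basis (split_st b)) a) (lin_ext (\<lambda>b. basis (split_st b)) b)"
      using comp by (simp add: pc_MG lin_ext_basis_formal_sum hadamard_comp_graft)
  qed
qed

section \<open>Forgetting the orientation\<close>

definition rooted_graph :: "'v or_multigraph \<times> 'v \<Rightarrow> 'v multigraph \<times> 'v" where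
  "rooted_graph b = (underlying (fst b), snd b)"

definition forget :: "('v or_multigraph \<times> 'v \<Rightarrow>\<^sub>0 'k::field) \<Rightarrow> ('v multigraph \<times> 'v \<Rightarrow>\<^sub>0 'k)" where
  "forget = lin_ext (\<lambda>b. basis (rooted_graph b))"

definition root_sums :: "'v set \<Rightarrow> ('v multigraph \<times> 'v \<Rightarrow>\<^sub>0 'k::field) set" where
  "root_sums V = fs.span {(\<Sum>r\<in>V. basis (g, r)) | g. connected_on V g}"

definition some_tree :: "'v set \<Rightarrow> 'v multigraph \<Rightarrow> 'v multigraph" where
  "some_tree V g = (SOME t. spanning_tree V g t)"

definition orient_somehow ::
  "'v set \<Rightarrow> ('v multigraph \<times> 'v \<Rightarrow>\<^sub>0 'k::field) \<Rightarrow> ('v or_multigraph \<times> 'v \<Rightarrow>\<^sub>0 'k)" where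
  "orient_somehow V = lin_ext (\<lambda>(g, r). basis (orient g (some_tree V g) r, r))"

lemma linear_on_forget: "linear_on UNIV forget"
  unfolding forget_def by (rule lin_ext_linear_on)

lemma linear_on_orient_somehow: "linear_on UNIV (orient_somehow V)"
  unfolding orient_somehow_def by (rule lin_ext_linear_on)

lemma forget_basis [simp]: "forget (basis b) = basis (rooted_graph b)"
  by (simp add: forget_def)

lemma forget_add: "forget (x + y) = forget x + forget y"
  by (simp add: forget_def lin_ext_add)

lemma forget_scale: "forget (scale c x) = scale c (forget x)"
  by (simp add: forget_def lin_ext_scale)

lemma forget_zero [simp]: "forget 0 = 0"
  by (simp add: forget_def)

lemma forget_diff: "forget (x - y) = forget x - forget y"
  by (metis add_diff_cancel_right' diff_add_cancel forget_add)

lemma orient_somehow_zero [simp]: "orient_somehow V 0 = 0"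
  by (simp add: orient_somehow_def)

lemma spanning_tree_some_tree:
  assumes "connected_on V g" "finite V"
  shows "spanning_tree V g (some_tree V g)"
proof -
  obtain r where "r \<in> V" using assms(1) by (auto simp: connected_on_def)
  then obtain p where "rooted V p r" "parent_tree V p r \<subseteq># g"
    using connected_on_parents[OF assms] by blast
  then have "spanning_tree V g (parent_tree V p r)"
    by (simp add: spanning_tree_def tree_on_parent_tree)
  then show ?thesis unfolding some_tree_def by (rule someI)
qed

lemma underlying_orient:
  assumes "t \<subseteq># g"
  shows "underlying (orient g t r) = g"
proof -
  have "image_mset snd (orient_tree_edge t r e) = e" for e
    by (simp add: orient_tree_edge_def multiset.map_comp comp_def)
  then have "underlying (orient g t r) = t + (g - t)"
    by (simp add: underlying_def orient_def multiset.map_comp comp_def)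
  then show ?thesis using assms by (simp add: subset_mset.add_diff_inverse)
qed

lemma rooted_graph_orient: "spanning_tree V g t \<Longrightarrow> rooted_graph (orient g t r, r) = (g, r)"
  by (simp add: rooted_graph_def underlying_orient spanning_tree_def)

lemma linear_on_diff: "linear_on UNIV f \<Longrightarrow> linear_on UNIV g \<Longrightarrow> linear_on UNIV (\<lambda>x. f x - g x)"
  by (simp add: linear_on_def fs.scale_right_diff_distrib)

lemma subspace_ST_vimage:
  fixes V :: "'v set" and T :: "('v multigraph \<times> 'v \<Rightarrow>\<^sub>0 'k::field) set"
  assumes "fs.subspace T"
  shows "fs.subspace {x \<in> ST V. forget x \<in> T}"
proof -
  have "fs.subspace (ST V :: ('v or_multigraph \<times> 'v \<Rightarrow>\<^sub>0 'k) set)" by (simp add: ST_def)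
  then show ?thesis
    using assms by (auto simp: fs.subspace_def forget_add forget_scale)
qed

lemma diff_orient_somehow_in_IST:
  fixes x :: "'v or_multigraph \<times> 'v \<Rightarrow>\<^sub>0 'k::field"
  assumes "finite V" "x \<in> ST V"
  shows "x - orient_somehow V (forget x) \<in> IST V"
proof (rule linear_image_span[OF assms(2)[unfolded ST_def], where f = "\<lambda>x. x - orient_somehow V (forget x)"])
  show "linear_on UNIV (\<lambda>x. x - orient_somehow V (forget x))"
    by (intro linear_on_diff linear_on_ident linear_on_compose[OF linear_on_orient_somehow linear_on_forget])
  show "fs.subspace (IST V)" by (simp add: IST_def)
  fix b :: "'v or_multigraph \<times> 'v \<Rightarrow>\<^sub>0 'k"
  assume "b \<in> {basis (orient g t r, r) | g t r. connected_on V g \<and> r \<in> V \<and> spanning_tree V g t}"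
  then obtain g t r where b: "b = basis (orient g t r, r)" "connected_on V g" "r \<in> V" "spanning_tree V g t"
    by blast
  have "b - orient_somehow V (forget b) = basis (orient g t r, r) - basis (orient g (some_tree V g) r, r)"
    by (simp add: b(1) rooted_graph_orient[OF b(4)] orient_somehow_def)
  then show "b - orient_somehow V (forget b) \<in> IST V"
    unfolding IST_def using b spanning_tree_some_tree[OF b(2) assms(1)] by (intro fs.span_base) blast
qed

lemma IST_iff:
  fixes x :: "'v or_multigraph \<times> 'v \<Rightarrow>\<^sub>0 'k::field"
  assumes "finite V"
  shows "x \<in> IST V \<longleftrightarrow> x \<in> ST V \<and> forget x = 0"
proof
  assume "x \<in> ST V \<and> forget x = 0"
  then show "x \<in> IST V"
    using diff_orient_somehow_in_IST[OF assms, of x] by simp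
next
  have "IST V \<subseteq> {x :: 'v or_multigraph \<times> 'v \<Rightarrow>\<^sub>0 'k. x \<in> ST V \<and> forget x \<in> {0}}"
    unfolding IST_def
  proof (rule fs.span_minimal)
    show "fs.subspace {x :: 'v or_multigraph \<times> 'v \<Rightarrow>\<^sub>0 'k. x \<in> ST V \<and> forget x \<in> {0}}" by (rule subspace_ST_vimage) simp
    show "{basis (orient g t1 r, r) - basis (orient g t2 r, r) | g t1 t2 r. connected_on V g \<and> r \<in> V \<and>
        spanning_tree V g t1 \<and> spanning_tree V g t2} \<subseteq> {x :: 'v or_multigraph \<times> 'v \<Rightarrow>\<^sub>0 'k. x \<in> ST V \<and> forget x \<in> {0}}"
    proof clarify
      fix g t1 t2 r
      assume *: "connected_on V g" "r \<in> V" "spanning_tree V g t1" "spanning_tree V g t2"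
      let ?b = "basis (orient g t1 r, r) - basis (orient g t2 r, r) :: 'v or_multigraph \<times> 'v \<Rightarrow>\<^sub>0 'k"
      have "?b \<in> ST V"
        unfolding ST_def using * by (intro fs.span_diff fs.span_base) blast+
      moreover have "forget ?b = 0"
        using * by (simp add: forget_diff rooted_graph_orient)
      ultimately show "?b \<in> ST V \<and> forget ?b \<in> {0}" by simp
    qed
  qed
  then show "x \<in> IST V \<Longrightarrow> x \<in> ST V \<and> forget x = 0" by blast
qed

lemma IST_subset_OST:
  assumes "finite V"
  shows "(IST V :: ('v or_multigraph \<times> 'v \<Rightarrow>\<^sub>0 'k::field) set) \<subseteq> OST V"
  unfolding IST_def
proof (rule fs.span_minimal)
  show "fs.subspace (OST V :: ('v or_multigraph \<times> 'v \<Rightarrow>\<^sub>0 'k) set)" by (simp add: OST_def)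
  show "{basis (orient g t1 r, r) - basis (orient g t2 r, r) | g t1 t2 r. connected_on V g \<and> r \<in> V \<and>
      spanning_tree V g t1 \<and> spanning_tree V g t2} \<subseteq> (OST V :: ('v or_multigraph \<times> 'v \<Rightarrow>\<^sub>0 'k) set)"
  proof clarify
    fix g t1 t2 r
    assume *: "connected_on V g" "r \<in> V" "spanning_tree V g t1" "spanning_tree V g t2"
    let ?s = "\<lambda>t. \<Sum>r'\<in>V. basis (orient g (if r' = r then t else some_tree V g) r', r') :: 'v or_multigraph \<times> 'v \<Rightarrow>\<^sub>0 'k"
    have mem: "?s t \<in> OST V" if "spanning_tree V g t" for t
      unfolding OST_def using that *(1) spanning_tree_some_tree[OF *(1) assms]
      by (intro fs.span_base CollectI exI[of _ g] exI[of _ "\<lambda>r'. if r' = r then t else some_tree V g"]) simp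
    have "?s t1 - ?s t2 = (\<Sum>r'\<in>V. if r' = r then basis (orient g t1 r, r) - basis (orient g t2 r, r) else 0)"
      unfolding sum_subtractf[symmetric] by (intro sum.cong) auto
    also have "\<dots> = basis (orient g t1 r, r) - basis (orient g t2 r, r)"
      using assms *(2) by (simp add: sum.delta')
    finally have eq: "?s t1 - ?s t2 = basis (orient g t1 r, r) - basis (orient g t2 r, r)" .
    have "?s t1 - ?s t2 \<in> OST V"
      using mem[OF *(3)] mem[OF *(4)] unfolding OST_def by (rule fs.span_diff)
    then show "basis (orient g t1 r, r) - basis (orient g t2 r, r) \<in> (OST V :: ('v or_multigraph \<times> 'v \<Rightarrow>\<^sub>0 'k) set)"
      unfolding eq .
  qed
qed

lemma OST_iff:
  fixes x :: "'v or_multigraph \<times> 'v \<Rightarrow>\<^sub>0 'k::field"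
  assumes "finite V"
  shows "x \<in> OST V \<longleftrightarrow> x \<in> ST V \<and> forget x \<in> root_sums V"
proof
  assume x: "x \<in> ST V \<and> forget x \<in> root_sums V"
  have "orient_somehow V (forget x) \<in> OST V"
  proof (rule linear_image_span[OF _ linear_on_orient_somehow])
    show "forget x \<in> fs.span {(\<Sum>r\<in>V. basis (g, r)) | g. connected_on V g}"
      using x unfolding root_sums_def by blast
    show "fs.subspace (OST V)" by (simp add: OST_def)
    fix b :: "'v multigraph \<times> 'v \<Rightarrow>\<^sub>0 'k" assume "b \<in> {(\<Sum>r\<in>V. basis (g, r)) | g. connected_on V g}"
    then obtain g where g: "b = (\<Sum>r\<in>V. basis (g, r))" "connected_on V g" by blast
    have "orient_somehow V b = (\<Sum>r\<in>V. basis (orient g (some_tree V g) r, r))"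
      by (simp add: g(1) orient_somehow_def lin_ext_sum)
    then show "orient_somehow V b \<in> OST V"
      unfolding OST_def using g(2) spanning_tree_some_tree[OF g(2) assms]
      by (intro fs.span_base CollectI exI[of _ g] exI[of _ "\<lambda>_. some_tree V g"]) simp
  qed
  moreover have "x - orient_somehow V (forget x) \<in> OST V"
    using diff_orient_somehow_in_IST[OF assms] IST_subset_OST[OF assms] x by blast
  ultimately have "(x - orient_somehow V (forget x)) + orient_somehow V (forget x) \<in> OST V"
    unfolding OST_def by (intro fs.span_add)
  then show "x \<in> OST V" by simp
next
  have "OST V \<subseteq> {x :: 'v or_multigraph \<times> 'v \<Rightarrow>\<^sub>0 'k. x \<in> ST V \<and> forget x \<in> root_sums V}"
    unfolding OST_def
  proof (rule fs.span_minimal)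
    show "fs.subspace {x :: 'v or_multigraph \<times> 'v \<Rightarrow>\<^sub>0 'k. x \<in> ST V \<and> forget x \<in> root_sums V}"
      by (rule subspace_ST_vimage) (simp add: root_sums_def)
    show "{(\<Sum>r\<in>V. basis (orient g (t r) r, r)) | g t. connected_on V g \<and> (\<forall>r\<in>V. spanning_tree V g (t r))}
        \<subseteq> {x :: 'v or_multigraph \<times> 'v \<Rightarrow>\<^sub>0 'k. x \<in> ST V \<and> forget x \<in> root_sums V}"
    proof clarify
      fix g t
      assume *: "connected_on V g" "\<forall>r\<in>V. spanning_tree V g (t r)"
      let ?b = "\<Sum>r\<in>V. basis (orient g (t r) r, r) :: 'v or_multigraph \<times> 'v \<Rightarrow>\<^sub>0 'k"
      have "?b \<in> ST V"
        unfolding ST_def using * by (intro fs.span_sum fs.span_base) blast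
      moreover have "forget ?b = (\<Sum>r\<in>V. basis (g, r))"
        unfolding linear_on_sum[OF linear_on_forget]
        using * by (intro sum.cong) (auto simp: rooted_graph_orient)
      moreover have "(\<Sum>r\<in>V. basis (g, r) :: 'v multigraph \<times> 'v \<Rightarrow>\<^sub>0 'k) \<in> root_sums V"
        unfolding root_sums_def using * by (intro fs.span_base) blast
      ultimately show "?b \<in> ST V \<and> forget ?b \<in> root_sums V" by simp
    qed
  qed
  then show "x \<in> OST V \<Longrightarrow> x \<in> ST V \<and> forget x \<in> root_sums V" by blast
qed

lemma forget_transport:
  "forget (transport MG_orc V \<sigma> x) =
     lin_ext (\<lambda>(g, r). basis (image_mset (image_mset \<sigma>) g, \<sigma> r)) (forget x)"
proof -
  have "rooted_graph (relabel \<sigma> b) = (image_mset (image_mset \<sigma>) (underlying (fst b)), \<sigma> (snd b))" for b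
    by (simp add: rooted_graph_def relabel_def underlying_relabel case_prod_beta)
  then show ?thesis
    by (simp add: forget_def MG_orc_eq_basis_operad basis_operad_def lin_ext_comp)
      (simp add: rooted_graph_def)
qed

lemma root_sums_transport:
  fixes x :: "'v multigraph \<times> 'v \<Rightarrow>\<^sub>0 'k::field"
  assumes "inj_on \<sigma> V" "x \<in> root_sums V"
  shows "lin_ext (\<lambda>(g, r). basis (image_mset (image_mset \<sigma>) g, \<sigma> r)) x \<in> root_sums (\<sigma> ` V)"
proof (rule linear_image_span[OF assms(2)[unfolded root_sums_def] linear_on_lin_ext[OF linear_on_ident]])
  show "fs.subspace (root_sums (\<sigma> ` V))" by (simp add: root_sums_def)
  fix b :: "'v multigraph \<times> 'v \<Rightarrow>\<^sub>0 'k" assume "b \<in> {(\<Sum>r\<in>V. basis (g, r)) | g. connected_on V g}"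
  then obtain g where g: "b = (\<Sum>r\<in>V. basis (g, r))" "connected_on V g" by blast
  have "lin_ext (\<lambda>(g, r). basis (image_mset (image_mset \<sigma>) g, \<sigma> r)) b =
      (\<Sum>r\<in>\<sigma> ` V. basis (image_mset (image_mset \<sigma>) g, r))"
    by (simp add: g(1) lin_ext_sum sum.reindex[OF assms(1)])
  then show "lin_ext (\<lambda>(g, r). basis (image_mset (image_mset \<sigma>) g, \<sigma> r)) b \<in> root_sums (\<sigma> ` V)"
    unfolding root_sums_def using connected_on_image[OF g(2)] by (intro fs.span_base) blast
qed

definition half_forgotten_comp ::
  "'v \<Rightarrow> 'v set \<Rightarrow> 'v or_multigraph \<times> 'v \<Rightarrow> 'v multigraph \<times> 'v \<Rightarrow> ('v multigraph \<times> 'v \<Rightarrow>\<^sub>0 'k::field)" where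
  "half_forgotten_comp s V2 a c = formal_sum {#(h + fst c, if snd a = s then snd c else snd a).
     h \<in># image_mset underlying (choices (choices (reconnect s V2 (snd c))) (fst a))#}"

text \<open>The composite of a rooted graph with the sum of all rootings of \<open>g\<^sub>2\<close>.\<close>

definition comp_root_sum ::
  "'v \<Rightarrow> 'v set \<Rightarrow> 'v multigraph \<Rightarrow> 'v multigraph \<times> 'v \<Rightarrow> ('v multigraph \<times> 'v \<Rightarrow>\<^sub>0 'k::field)" where
  "comp_root_sum s V2 g2 c =
     (let K = choices (choices (reconnect_vertex s V2)) (fst c)
      in if snd c = s then \<Sum>r\<in>V2. formal_sum {#(h + g2, r). h \<in># K#}
         else formal_sum {#(h + g2, snd c). h \<in># K#})"

lemma forget_comp:
  fixes x y :: "'v or_multigraph \<times> 'v \<Rightarrow>\<^sub>0 'k::field"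
  shows "forget (pcomp MG_orc V1 s V2 x y) = bilin_ext (half_forgotten_comp s V2) x (forget y)"
proof -
  have "lin_ext (\<lambda>b. basis (rooted_graph b)) (formal_sum (graft V1 s V2 a b)) =
      (half_forgotten_comp s V2 a (rooted_graph b) :: _ \<Rightarrow>\<^sub>0 'k)" for a b
    by (simp add: lin_ext_basis_formal_sum half_forgotten_comp_def graft_def rooted_graph_def case_prod_beta
        multiset.map_comp comp_def)
  then show ?thesis
    by (simp add: MG_orc_eq_basis_operad basis_operad_def bilin_ext_def forget_def lin_ext_comp)
qed

lemma underlying_choices_reconnect:
  assumes "\<forall>e\<in>#g. (Source, s) \<notin># e"
  shows "image_mset underlying (choices (choices (reconnect s V r)) g) =
    choices (choices (reconnect_vertex s V)) (underlying g)"
proof -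
  have "image_mset (image_mset (image_mset snd)) (choices (choices (reconnect s V r)) g) =
      choices (choices (\<lambda>x. image_mset snd (reconnect s V r x))) g"
    by (simp add: image_choices)
  also have "\<dots> = choices (choices (\<lambda>x. reconnect_vertex s V (snd x))) g"
  proof (rule choices_choices_cong)
    fix e x assume "e \<in># g" "x \<in># e"
    then have "x \<noteq> (Source, s)" using assms by auto
    then show "image_mset snd (reconnect s V r x) = reconnect_vertex s V (snd x)"
      by (cases x; cases "fst x")
        (auto simp: reconnect_Source reconnect_Target reconnect_vertex_def multiset.map_comp comp_def)
  qed
  also have "\<dots> = choices (choices (reconnect_vertex s V)) (underlying g)"
    by (simp add: underlying_def choices_image)
  finally show ?thesis by (simp add: underlying_def[abs_def])
qed

text \<open>
  If \<open>s\<close> is not the root, exactly one source end is attached to it, so letting the root of the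
  grafted graph vary reconnects that end to all of \<open>V\<^sub>2\<close>, as for a target end. If \<open>s\<close> is the root, there is
  no source end at \<open>s\<close>.
\<close>

lemma sum_half_forgotten_comp:
  fixes a :: "'v or_multigraph \<times> 'v"
  assumes comp: "composable V1 s V2" and a: "a \<in> st_basis (insert s V1)"
  shows "(\<Sum>r\<in>V2. half_forgotten_comp s V2 a (g2, r)) =
    (comp_root_sum s V2 g2 (rooted_graph a) :: _ \<Rightarrow>\<^sub>0 'k::field)"
proof -
  obtain p r1 h where p: "rooted (insert s V1) p r1" and
    ah: "a = (parent_orientation (insert s V1) p r1 + targets h, r1)"
    using a by (auto simp: st_basis_def)
  have fin: "finite (insert s V1)" "finite V2" using comp by (auto simp: composable_def)
  show ?thesis
  proof (cases "r1 = s")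
    case True
    have "\<forall>e\<in>#fst a. (Source, s) \<notin># e"
      using fin True by (auto simp: ah parent_orientation_def)
    then show ?thesis
      using underlying_choices_reconnect[of "fst a" s V2] True
      by (simp add: half_forgotten_comp_def comp_root_sum_def rooted_graph_def ah)
  next
    case False
    let ?E = "{#{#(Target, p v), (Source, v)#}. v \<in># mset_set (insert s V1 - {r1} - {s})#} + targets h"
    let ?e = "{#(Target, p s), (Source, s)#}"
    let ?K = "choices (choices (reconnect_vertex s V2)) (underlying ?E)"
    obtain d :: "'v \<Rightarrow> nat" where "\<forall>v\<in>insert s V1 - {r1}. d (p v) < d v"
      using p unfolding rooted_def by blast
    then have "d (p s) < d s" using False by blast
    then have ps: "p s \<noteq> s" by auto
    have "mset_set (insert s V1 - {r1}) = add_mset s (mset_set (insert s V1 - {r1} - {s}))"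
      using fin(1) False by (intro mset_set.remove) auto
    then have fa: "fst a = add_mset ?e ?E"
      by (simp add: ah parent_orientation_def)
    have E: "\<forall>e\<in>#?E. (Source, s) \<notin># e" using fin by auto
    have e: "choices (reconnect s V2 r) ?e = {#{#(Target, p s), (Source, r)#}#}" for r
      using ps by (simp add: reconnect_Source reconnect_Target)
    have one: "image_mset underlying (choices (choices (reconnect s V2 r)) (fst a)) =
        image_mset (add_mset {#p s, r#}) ?K" for r
    proof -
      have "image_mset underlying (choices (choices (reconnect s V2 r)) (fst a)) =
          image_mset (\<lambda>h. add_mset {#p s, r#} (underlying h)) (choices (choices (reconnect s V2 r)) ?E)"
        unfolding fa choices_add_mset[of "choices (reconnect s V2 r)"] e
        by (simp add: multiset.map_comp comp_def underlying_def)
      also have "\<dots> = image_mset (add_mset {#p s, r#}) (image_mset underlying (choices (choices (reconnect s V2 r)) ?E))"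
        by (simp add: multiset.map_comp comp_def)
      finally show ?thesis unfolding underlying_choices_reconnect[OF E] .
    qed
    have e': "choices (reconnect_vertex s V2) {#p s, s#} = {#{#p s, u#}. u \<in># mset_set V2#}"
      using ps by (simp add: reconnect_vertex_def multiset.map_comp comp_def)
    have "underlying (fst a) = add_mset {#p s, s#} (underlying ?E)"
      unfolding fa by (simp add: underlying_def)
    then have all: "choices (choices (reconnect_vertex s V2)) (underlying (fst a)) =
        (\<Sum>r\<in>#mset_set V2. image_mset (add_mset {#p s, r#}) ?K)"
      by (simp only: choices_add_mset[of "choices (reconnect_vertex s V2)"] e' Sum_mset_image)
    have "(\<Sum>r\<in>V2. half_forgotten_comp s V2 a (g2, r) :: _ \<Rightarrow>\<^sub>0 'k) =
        (\<Sum>r\<in>#mset_set V2. formal_sum (image_mset (\<lambda>h. (h + g2, r1)) (image_mset (add_mset {#p s, r#}) ?K)))"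
      unfolding half_forgotten_comp_def fst_conv snd_conv one sum_unfold_sum_mset
      using False by (simp add: ah)
    also have "\<dots> = formal_sum (image_mset (\<lambda>h. (h + g2, r1)) (choices (choices (reconnect_vertex s V2)) (underlying (fst a))))"
      unfolding all image_mset_Sum formal_sum_Sum ..
    also have "\<dots> = comp_root_sum s V2 g2 (rooted_graph a)"
      using False by (simp add: comp_root_sum_def rooted_graph_def ah)
    finally show ?thesis .
  qed
qed

lemma bilin_ext_root_sum:
  fixes x :: "'v or_multigraph \<times> 'v \<Rightarrow>\<^sub>0 'k::field"
  assumes comp: "composable V1 s V2" and x: "x \<in> ST (insert s V1)"
  shows "bilin_ext (half_forgotten_comp s V2) x (\<Sum>r\<in>V2. basis (g2, r)) =
    lin_ext (comp_root_sum s V2 g2) (forget x)"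
proof -
  have fin: "finite (insert s V1)" using comp by (auto simp: composable_def)
  show ?thesis
  proof (rule linear_eq_on_span[OF x[unfolded ST_eq_span[OF fin]],
        where f = "\<lambda>x. bilin_ext (half_forgotten_comp s V2) x (\<Sum>r\<in>V2. basis (g2, r))" and
          g = "\<lambda>x. lin_ext (comp_root_sum s V2 g2) (forget x)"])
    show "linear_on UNIV (\<lambda>x. bilin_ext (half_forgotten_comp s V2) x (\<Sum>r\<in>V2. basis (g2, r)))"
      by (rule linear_on_bilin_ext_left[OF linear_on_ident])
    show "linear_on UNIV (\<lambda>x. lin_ext (comp_root_sum s V2 g2) (forget x))"
      by (rule linear_on_lin_ext[OF linear_on_forget])
    fix b :: "'v or_multigraph \<times> 'v \<Rightarrow>\<^sub>0 'k" assume "b \<in> basis ` st_basis (insert s V1)"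
    then obtain a where a: "b = basis a" "a \<in> st_basis (insert s V1)" by blast
    then show "bilin_ext (half_forgotten_comp s V2) b (\<Sum>r\<in>V2. basis (g2, r)) =
        lin_ext (comp_root_sum s V2 g2) (forget b)"
      by (simp add: sum_half_forgotten_comp[OF comp a(2), symmetric]
          linear_on_sum[OF linear_on_bilin_ext_right[OF linear_on_ident]])
  qed
qed

lemma span_sum_mset: "(\<And>x. x \<in># M \<Longrightarrow> f x \<in> fs.span S) \<Longrightarrow> (\<Sum>x\<in>#M. f x) \<in> fs.span S"
  by (induction M) (auto simp: fs.span_zero intro: fs.span_add)

lemma comp_root_sums:
  fixes z :: "'v multigraph \<times> 'v \<Rightarrow>\<^sub>0 'k::field"
  assumes comp: "composable V1 s V2" and g2: "connected_on V2 g2" and z: "z \<in> root_sums (insert s V1)"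
  shows "lin_ext (comp_root_sum s V2 g2) z \<in> root_sums (V1 \<union> V2)"
proof (rule linear_image_span[OF z[unfolded root_sums_def] linear_on_lin_ext[OF linear_on_ident]])
  have V: "finite V1" "finite V2" "s \<notin> V1" "V1 \<inter> V2 = {}" using comp by (auto simp: composable_def)
  show "fs.subspace (root_sums (V1 \<union> V2))" by (simp add: root_sums_def)
  fix b :: "'v multigraph \<times> 'v \<Rightarrow>\<^sub>0 'k" assume "b \<in> {(\<Sum>r\<in>insert s V1. basis (g, r)) | g. connected_on (insert s V1) g}"
  then obtain g where g: "b = (\<Sum>r\<in>insert s V1. basis (g, r))" "connected_on (insert s V1) g" by blast
  let ?K = "choices (choices (reconnect_vertex s V2)) g"
  have "lin_ext (comp_root_sum s V2 g2) b = (\<Sum>r\<in>insert s V1. comp_root_sum s V2 g2 (g, r))"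
    by (simp only: g(1) lin_ext_sum lin_ext_basis)
  also have "\<dots> = (\<Sum>r\<in>V2. formal_sum {#(h + g2, r). h \<in># ?K#}) + (\<Sum>r\<in>V1. comp_root_sum s V2 g2 (g, r))"
    using V by (simp add: comp_root_sum_def)
  also have "(\<Sum>r\<in>V1. comp_root_sum s V2 g2 (g, r)) = (\<Sum>r\<in>V1. formal_sum {#(h + g2, r). h \<in># ?K#})"
    using V by (intro sum.cong) (auto simp: comp_root_sum_def Let_def)
  also have "(\<Sum>r\<in>V2. formal_sum {#(h + g2, r). h \<in># ?K#}) + \<dots> =
      (\<Sum>r\<in>V1 \<union> V2. formal_sum {#(h + g2, r). h \<in># ?K#})"
    using V by (simp add: sum.union_disjoint add.commute)
  also have "\<dots> = (\<Sum>h\<in>#?K. \<Sum>r\<in>V1 \<union> V2. basis (h + g2, r))"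
    unfolding sum_unfold_sum_mset formal_sum_def Sum_mset_image by (rule sum_mset.swap)
  also have "\<dots> \<in> root_sums (V1 \<union> V2)"
    unfolding root_sums_def
  proof (rule span_sum_mset, rule fs.span_base)
    fix h assume h: "h \<in># ?K"
    have mg: "g \<in> multigraphs (insert s V1)" using g(2) by (simp add: connected_on_def)
    have "image_mset (image_mset (\<lambda>v. if v \<in> V2 then s else v)) h = g"
    proof (rule in_choices_choices_image[OF h])
      fix e x y assume "e \<in># g" "x \<in># e" "y \<in># reconnect_vertex s V2 x"
      moreover from this have "x \<in> insert s V1" using mg by (auto simp: multigraphs_def)
      ultimately show "(if y \<in> V2 then s else y) = x"
        using V by (auto simp: reconnect_vertex_def split: if_splits)
    qed
    from connected_on_insertion[OF V(3,4) g(2) g2 multigraphs_reconnect_vertex[OF V(2) mg h] this]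
    show "(\<Sum>r\<in>V1 \<union> V2. basis (h + g2, r)) \<in> {(\<Sum>r\<in>V1 \<union> V2. basis (g, r)) | g. connected_on (V1 \<union> V2) g}"
      by blast
  qed
  finally show "lin_ext (comp_root_sum s V2 g2) b \<in> root_sums (V1 \<union> V2)" .
qed

lemma ST_comp_closed:
  fixes x y :: "'v or_multigraph \<times> 'v \<Rightarrow>\<^sub>0 'k::field"
  assumes "composable V1 s V2" "x \<in> ST (insert s V1)" "y \<in> ST V2"
  shows "pcomp MG_orc V1 s V2 x y \<in> ST (V1 \<union> V2)"
  using suboperad_ST[where 'k = 'k and 'v = 'v] assms unfolding suboperad_def by blast

lemma OST_comp_closed:
  fixes x y :: "'v or_multigraph \<times> 'v \<Rightarrow>\<^sub>0 'k::field"
  assumes comp: "composable V1 s V2" and x: "x \<in> OST (insert s V1)" and y: "y \<in> OST V2"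
  shows "pcomp MG_orc V1 s V2 x y \<in> OST (V1 \<union> V2)"
proof -
  have fin: "finite V2" "finite (insert s V1)" "finite (V1 \<union> V2)" using comp by (auto simp: composable_def)
  have x': "x \<in> ST (insert s V1)" "forget x \<in> root_sums (insert s V1)"
    and y': "y \<in> ST V2" "forget y \<in> root_sums V2"
    using x y fin by (auto simp: OST_iff)
  have "bilin_ext (half_forgotten_comp s V2) x (forget y) \<in> root_sums (V1 \<union> V2)"
  proof (rule linear_image_span[OF y'(2)[unfolded root_sums_def] linear_on_bilin_ext_right[OF linear_on_ident]])
    show "fs.subspace (root_sums (V1 \<union> V2))" by (simp add: root_sums_def)
    fix b :: "'v multigraph \<times> 'v \<Rightarrow>\<^sub>0 'k" assume "b \<in> {(\<Sum>r\<in>V2. basis (g, r)) | g. connected_on V2 g}"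
    then obtain g where g: "b = (\<Sum>r\<in>V2. basis (g, r))" "connected_on V2 g" by blast
    show "bilin_ext (half_forgotten_comp s V2) x b \<in> root_sums (V1 \<union> V2)"
      unfolding g(1) bilin_ext_root_sum[OF comp x'(1)] by (rule comp_root_sums[OF comp g(2) x'(2)])
  qed
  then show ?thesis
    unfolding OST_iff[OF fin(3)] forget_comp using ST_comp_closed[OF comp x'(1) y'(1)] by blast
qed

lemma IST_comp_left:
  fixes x y :: "'v or_multigraph \<times> 'v \<Rightarrow>\<^sub>0 'k::field"
  assumes comp: "composable V1 s V2" and x: "x \<in> IST (insert s V1)" and y: "y \<in> OST V2"
  shows "pcomp MG_orc V1 s V2 x y \<in> IST (V1 \<union> V2)"
proof -
  have fin: "finite V2" "finite (insert s V1)" "finite (V1 \<union> V2)" using comp by (auto simp: composable_def)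
  have x': "x \<in> ST (insert s V1)" "forget x = 0"
    and y': "y \<in> ST V2" "forget y \<in> root_sums V2"
    using x y fin by (auto simp: OST_iff IST_iff)
  have "bilin_ext (half_forgotten_comp s V2) x (forget y) \<in> {0}"
  proof (rule linear_image_span[OF y'(2)[unfolded root_sums_def] linear_on_bilin_ext_right[OF linear_on_ident]])
    show "fs.subspace {0}" by simp
    fix b :: "'v multigraph \<times> 'v \<Rightarrow>\<^sub>0 'k" assume "b \<in> {(\<Sum>r\<in>V2. basis (g, r)) | g. connected_on V2 g}"
    then obtain g where g: "b = (\<Sum>r\<in>V2. basis (g, r))" by blast
    show "bilin_ext (half_forgotten_comp s V2) x b \<in> {0}"
      unfolding g bilin_ext_root_sum[OF comp x'(1)] x'(2) by simp
  qed
  then show ?thesis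
    unfolding IST_iff[OF fin(3)] forget_comp using ST_comp_closed[OF comp x'(1) y'(1)] by blast
qed

lemma IST_comp_right:
  fixes x y :: "'v or_multigraph \<times> 'v \<Rightarrow>\<^sub>0 'k::field"
  assumes comp: "composable V1 s V2" and x: "x \<in> OST (insert s V1)" and y: "y \<in> IST V2"
  shows "pcomp MG_orc V1 s V2 x y \<in> IST (V1 \<union> V2)"
proof -
  have fin: "finite V2" "finite (insert s V1)" "finite (V1 \<union> V2)" using comp by (auto simp: composable_def)
  have x': "x \<in> ST (insert s V1)" and y': "y \<in> ST V2" "forget y = 0"
    using x y fin by (auto simp: OST_iff IST_iff)
  have "bilin_ext (half_forgotten_comp s V2) x (forget y) = 0"
    unfolding y'(2) by (simp add: bilin_ext_def lin_ext_def)
  then show ?thesis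
    unfolding IST_iff[OF fin(3)] forget_comp using ST_comp_closed[OF comp x' y'(1)] by blast
qed

lemma ST_transport:
  fixes x :: "'v or_multigraph \<times> 'v \<Rightarrow>\<^sub>0 'k::field"
  assumes "finite V" "inj_on \<sigma> V" "x \<in> ST V"
  shows "transport MG_orc V \<sigma> x \<in> ST (\<sigma> ` V)"
  using suboperad_ST[where 'k = 'k and 'v = 'v] assms unfolding suboperad_def subspecies_def by blast

lemma OST_transport:
  fixes x :: "'v or_multigraph \<times> 'v \<Rightarrow>\<^sub>0 'k::field"
  assumes "finite V" "inj_on \<sigma> V" "x \<in> OST V"
  shows "transport MG_orc V \<sigma> x \<in> OST (\<sigma> ` V)"
proof -
  have x: "x \<in> ST V" "forget x \<in> root_sums V" using assms by (simp_all add: OST_iff)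
  show ?thesis
    using assms(1) ST_transport[OF assms(1,2) x(1)] root_sums_transport[OF assms(2) x(2)]
    by (simp add: OST_iff forget_transport)
qed

lemma IST_transport:
  fixes x :: "'v or_multigraph \<times> 'v \<Rightarrow>\<^sub>0 'k::field"
  assumes "finite V" "inj_on \<sigma> V" "x \<in> IST V"
  shows "transport MG_orc V \<sigma> x \<in> IST (\<sigma> ` V)"
proof -
  have x: "x \<in> ST V" "forget x = 0" using assms by (simp_all add: IST_iff)
  show ?thesis
    using assms(1) ST_transport[OF assms(1,2) x(1)] by (simp add: IST_iff forget_transport x(2))
qed

lemma OST_unit: "(unit MG_orc v :: 'v or_multigraph \<times> 'v \<Rightarrow>\<^sub>0 'k::field) \<in> OST {v}"
proof -
  have un: "(unit MG_orc v :: 'v or_multigraph \<times> 'v \<Rightarrow>\<^sub>0 'k) = basis ({#}, v)"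
    by (simp add: MG_orc_def MG_or_def)
  have "connected_on {v} {#}" by (simp add: connected_on_def multigraphs_def)
  then have "(\<Sum>r\<in>{v}. basis ({#}, r) :: 'v multigraph \<times> 'v \<Rightarrow>\<^sub>0 'k) \<in> root_sums {v}"
    unfolding root_sums_def by (intro fs.span_base) blast
  then have "forget (unit MG_orc v :: 'v or_multigraph \<times> 'v \<Rightarrow>\<^sub>0 'k) \<in> root_sums {v}"
    by (simp add: un rooted_graph_def)
  moreover have "(unit MG_orc v :: 'v or_multigraph \<times> 'v \<Rightarrow>\<^sub>0 'k) \<in> ST {v}"
    using suboperad_ST[where 'k = 'k and 'v = 'v] unfolding suboperad_def by blast
  ultimately show ?thesis by (simp add: OST_iff)
qed

lemma suboperad_OST:
  "suboperad OST (restrict_to MG_orc ST :: ('v, 'v or_multigraph \<times> 'v, 'k::field) operad_data)"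
  unfolding suboperad_def subspecies_def
proof (intro conjI allI impI ballI, simp_all)
  show "operad (restrict_to MG_orc ST :: ('v, 'v or_multigraph \<times> 'v, 'k) operad_data)"
    by (rule operad_restrict_suboperad[OF suboperad_ST])
  show "fs.subspace (OST V :: ('v or_multigraph \<times> 'v \<Rightarrow>\<^sub>0 'k) set)" for V :: "'v set" by (simp add: OST_def)
  show "finite V \<Longrightarrow> (OST V :: ('v or_multigraph \<times> 'v \<Rightarrow>\<^sub>0 'k) set) \<subseteq> ST V" for V by (auto simp: OST_iff)
  show "transport MG_orc V \<sigma> ` OST V \<subseteq> (OST (\<sigma> ` V) :: ('v or_multigraph \<times> 'v \<Rightarrow>\<^sub>0 'k) set)"
    if "finite V \<and> inj_on \<sigma> V" for V \<sigma>
    using that by (auto intro: OST_transport)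
qed (auto intro: OST_unit OST_comp_closed)

lemma operad_ideal_IST:
  "operad_ideal IST (restrict_to MG_orc OST :: ('v, 'v or_multigraph \<times> 'v, 'k::field) operad_data)"
  unfolding operad_ideal_def subspecies_def
proof (intro conjI allI impI ballI, simp_all)
  show "operad (restrict_to MG_orc OST :: ('v, 'v or_multigraph \<times> 'v, 'k) operad_data)"
    using operad_restrict_suboperad[OF suboperad_OST[where 'k = 'k and 'v = 'v]] by simp
  show "fs.subspace (IST V :: ('v or_multigraph \<times> 'v \<Rightarrow>\<^sub>0 'k) set)" for V :: "'v set" by (simp add: IST_def)
  show "finite V \<Longrightarrow> (IST V :: ('v or_multigraph \<times> 'v \<Rightarrow>\<^sub>0 'k) set) \<subseteq> OST V" for V by (rule IST_subset_OST)
  show "transport MG_orc V \<sigma> ` IST V \<subseteq> (IST (\<sigma> ` V) :: ('v or_multigraph \<times> 'v \<Rightarrow>\<^sub>0 'k) set)"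
    if "finite V \<and> inj_on \<sigma> V" for V \<sigma>
    using that by (auto intro: IST_transport)
qed (auto intro: IST_comp_left IST_comp_right)

theorem lemma2p5:
  "suboperad ST (MG_orc :: ('v, 'v or_multigraph \<times> 'v, 'k::field_char_0) operad_data) \<and>
   operad_isomorphic
     (restrict_to MG_orc ST)
     (hadamard MG PLie :: ('v, 'v multigraph \<times> 'v multigraph \<times> 'v, 'k) operad_data) \<and>
   suboperad OST
     (restrict_to MG_orc ST :: ('v, 'v or_multigraph \<times> 'v, 'k) operad_data) \<and>
   operad_ideal IST
     (restrict_to MG_orc OST :: ('v, 'v or_multigraph \<times> 'v, 'k) operad_data)"
  using suboperad_ST operad_isomorphic_ST suboperad_OST operad_ideal_IST by blast

end
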